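(* Almost surely the following holds. The hitting time $\mathsf h(X)=\inf\{t:X(s)=u_2\text{ for all }s\ge t\}$ of the limit curve $X$ equals $d_*(u_1,u_2)$, and if $\gamma:[0,d_*(u_1,u_2)]\to\check V$ denotes the unique isometric embedding with $\gamma(0)=u_1$ and $\gamma(d_*(u_1,u_2))=u_2$, then $X(t)=\xi(\gamma(t))$ for all $t\in[0,d_*(u_1,u_2)]$.
   Context: Let $u_1=(0,0)$, $u_2=(1,0)$, $u_3=(\tfrac12,\tfrac{\sqrt3}2)$ in $\mathbb R^2$ and $\psi_i(x)=\tfrac12(x-u_i)+u_i$ for $i\in\{1,2,3\}$. The Sierpiński gasket $K$ is the unique nonempty compact set with $K=\psi_1(K)\cup\psi_2(K)\cup\psi_3(K)$. The Sierpiński graphs $G_n$ (embedded in the plane, all edges as straight segments lie in $K$) are defined recursively: $G_0$ has vertex set $VG_0=\{u_1,u_2,u_3\}$ and edge set $\{\{u_1,u_2\},\{u_2,u_3\},\{u_3,u_1\}\}$; $G_{n+1}$ has vertex set $\psi_1(VG_n)\cup\psi_2(VG_n)\cup\psi_3(VG_n)$ and edge set $\psi_1(EG_n)\cup\psi_2(EG_n)\cup\psi_3(EG_n)$ (edges mapped vertexwise). For a word $w=w_1\cdots w_k\in\{1,2,3\}^k$ put $\psi_w=\psi_{w_1}\circ\cdots\circ\psi_{w_k}$; then $G_n=\bigcup_{w\in\{1,2,3\}^k}\psi_w(G_{n-k})$. For a spanning subgraph $H\subseteq G_n$ and $w\in\{1,2,3\}^k$, $\pi_w(H)=\psi_w^{-1}(H\cap\psi_w(G_{n-k}))$.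 $\mathcal T_n$ denotes the set of spanning trees of $G_n$; $\mathcal S_n^i$ the set of spanning forests of $G_n$ with two components, one containing $u_i$ and the other containing $\{u_1,u_2,u_3\}\setminus\{u_i\}$; $\mathcal R_n$ the set of spanning forests with three components each containing exactly one of $u_1,u_2,u_3$; $\mathcal Q_n=\mathcal T_n\cup\mathcal S_n^1\cup\mathcal S_n^2\cup\mathcal S_n^3\cup\mathcal R_n$. For $g\in\mathcal Q_1$, $\mathrm{Tr}\,g$ is the spanning subgraph of $G_0$ equal to: the two edges at $u_i$ if $g$ is a spanning tree of $G_1$ in which for both $j\neq i$ the path from $u_i$ to $u_j$ lies in $\psi_i(G_0)\cup\psi_j(G_0)$ (every spanning tree of $G_1$ satisfies this for exactly one $i$); the single edge not containing $u_i$ if $g\in\mathcal S_1^i$; the edgeless graph if $g\in\mathcal R_1$. For $f\in\mathcal Q_{n+1}$, $\mathrm{Tr}\,f=\bigcup_{w\in\{1,2,3\}^n}\psi_w(\mathrm{Tr}\,\pi_w(f))$; Tr maps spanning trees of $G_{n+1}$ to spanning trees of $G_n$. A consistent sequence of uniform spanning trees is a sequence $(T_n)_{n\ge0}$ of random spanning trees defined on a common probability space such that $T_n$ is uniformly distributed on $\mathcal T_n$ and $\mathrm{Tr}\,T_{n+1}=T_n$ for all $n$. Let $(T_m)$ be such a sequence and $\bar\alpha=\frac43+\frac1{15}\sqrt{205}$. $X$ is the almost sure uniform limit on $[0,\infty]$ of $X_n(t)=\mathrm{LI}(u_1T_nu_2)(\bar\alpha^nt)$, where $u_1T_nu_2$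 is the path in $T_n$ from $u_1$ to $u_2$ and $\mathrm{LI}(x)$ of a walk $x=(x_0,\dots,x_r)$ is the linear interpolation $\mathrm{LI}(x)(t)=(k+1-t)x_k+(t-k)x_{k+1}$ for $k\le t<k+1$, $k<r$, and $=x_r$ for $t\ge r$. $V_*=\bigcup_nVG_n$ and $d_*(u,v)=\lim_m\bar\alpha^{-m}d_{T_m}(u,v)$ ($d_t$ = graph distance in the tree $t$); almost surely $d_*$ is a metric on $V_*$ whose Cauchy completion $(\check V,\check d)$ is a compact $\mathbb R$-tree. Every $d_*$-Cauchy sequence in $V_*$ is Cauchy for the Euclidean norm, and $\xi:\check V\to K$ assigns to the class of a $d_*$-Cauchy sequence its Euclidean limit; $\xi$ is continuous and the identity on $V_*$. *)

theory Defs
  imports "HOL-Probability.Probability"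
begin

definition u1 :: complex where "u1 = 0"
definition u2 :: complex where "u2 = 1"
definition u3 :: complex where "u3 = Complex (1/2) (sqrt 3 / 2)"

definition u :: "nat \<Rightarrow> complex" where
  "u i = (if i = 1 then u1 else if i = 2 then u2 else u3)"

definition psi :: "nat \<Rightarrow> complex \<Rightarrow> complex" where
  "psi i x = (x - u i) / 2 + u i"

fun psiw :: "nat list \<Rightarrow> complex \<Rightarrow> complex" where
  "psiw [] = id"
| "psiw (i # w) = psi i \<circ> psiw w"

definition words :: "nat \<Rightarrow> nat list set" where
  "words k = {w. length w = k \<and> set w \<subseteq> {1,2,3}}"

fun VG :: "nat \<Rightarrow> complex set" where
  "VG 0 = {u1, u2, u3}"
| "VG (Suc n) = (\<Union>i\<in>{1,2,3}. psi i ` VG n)"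

fun EG :: "nat \<Rightarrow> complex set set" where
  "EG 0 = {{u1,u2}, {u2,u3}, {u3,u1}}"
| "EG (Suc n) = (\<Union>i\<in>{1,2,3}. image (psi i) ` EG n)"

definition Vstar :: "complex set" where
  "Vstar = (\<Union>n. VG n)"

section \<open>Spanning subgraphs (given by their edge sets; vertex set is VG n)\<close>

definition adj :: "complex set set \<Rightarrow> (complex \<times> complex) set" where
  "adj E = {(a,b). {a,b} \<in> E \<and> a \<noteq> b}"

definition reach :: "complex set set \<Rightarrow> complex \<Rightarrow> complex \<Rightarrow> bool" where
  "reach E a b \<longleftrightarrow> (a,b) \<in> (adj E)\<^sup>*"

definition is_cycle :: "complex set set \<Rightarrow> complex list \<Rightarrow> bool" where
  "is_cycle E vs \<longleftrightarrow> length vs \<ge> 3 \<and> distinct vs \<and>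
     (\<forall>i < length vs. {vs ! i, vs ! ((i + 1) mod length vs)} \<in> E)"

definition forest :: "complex set set \<Rightarrow> bool" where
  "forest E \<longleftrightarrow> \<not> (\<exists>vs. is_cycle E vs)"

definition comps :: "nat \<Rightarrow> complex set set \<Rightarrow> complex set set" where
  "comps n E = {{b \<in> VG n. reach E a b} | a. a \<in> VG n}"

definition is_spanning_tree :: "nat \<Rightarrow> complex set set \<Rightarrow> bool" where
  "is_spanning_tree n E \<longleftrightarrow> E \<subseteq> EG n \<and> forest E \<and>
     (\<forall>a\<in>VG n. \<forall>b\<in>VG n. reach E a b)"

definition trees :: "nat \<Rightarrow> complex set set set" where
  "trees n = {E. is_spanning_tree n E}"

definition in_S :: "nat \<Rightarrow> nat \<Rightarrow> complex set set \<Rightarrow> bool" where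
  "in_S n i E \<longleftrightarrow> E \<subseteq> EG n \<and> forest E \<and>
     (\<exists>C D. comps n E = {C, D} \<and> C \<noteq> D \<and> u i \<in> C \<and> {u j | j. j \<in> {1,2,3} - {i}} \<subseteq> D)"

definition in_R :: "nat \<Rightarrow> complex set set \<Rightarrow> bool" where
  "in_R n E \<longleftrightarrow> E \<subseteq> EG n \<and> forest E \<and>
     (\<exists>A B C. comps n E = {A, B, C} \<and> A \<noteq> B \<and> B \<noteq> C \<and> A \<noteq> C \<and>
        u1 \<in> A \<and> u2 \<in> B \<and> u3 \<in> C)"

text \<open>$\pi_w(H)$ for $w$ of length $k$, $H \subseteq G_n$, with $m = n - k$.\<close>
definition piw :: "nat \<Rightarrow> nat list \<Rightarrow> complex set set \<Rightarrow> complex set set" where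
  "piw m w H = {e \<in> EG m. psiw w ` e \<in> H}"

definition tree_type :: "complex set set \<Rightarrow> nat \<Rightarrow> bool" where
  "tree_type g i \<longleftrightarrow> i \<in> {1,2,3} \<and>
     (\<forall>j \<in> {1,2,3} - {i}.
        reach (g \<inter> (image (psi i) ` EG 0 \<union> image (psi j) ` EG 0)) (u i) (u j))"

definition Tr1 :: "complex set set \<Rightarrow> complex set set" where
  "Tr1 g =
    (if is_spanning_tree 1 g then
       (let i = (THE i. tree_type g i) in {{u i, u j} | j. j \<in> {1,2,3} - {i}})
     else if (\<exists>i\<in>{1,2,3}. in_S 1 i g) then
       (let i = (THE i. i \<in> {1,2,3} \<and> in_S 1 i g) in {{u j | j. j \<in> {1,2,3} - {i}}})
     else {})"

text \<open>Tr maps spanning subgraphs of $G_{n+1}$ to spanning subgraphs of $G_n$.\<close>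
definition Tr :: "nat \<Rightarrow> complex set set \<Rightarrow> complex set set" where
  "Tr n f = (\<Union>w\<in>words n. image (psiw w) ` Tr1 (piw 1 w f))"

definition tree_path :: "complex set set \<Rightarrow> complex \<Rightarrow> complex \<Rightarrow> complex list" where
  "tree_path E a b = (THE p. p \<noteq> [] \<and> hd p = a \<and> last p = b \<and> distinct p \<and>
      (\<forall>i. Suc i < length p \<longrightarrow> {p ! i, p ! Suc i} \<in> E))"

definition tdist :: "complex set set \<Rightarrow> complex \<Rightarrow> complex \<Rightarrow> nat" where
  "tdist E a b = length (tree_path E a b) - 1"

definition LI :: "complex list \<Rightarrow> real \<Rightarrow> complex" where
  "LI x t = (if t \<ge> real (length x - 1) then last x
             else (let k = nat \<lfloor>t\<rfloor> in
                   of_real (real k + 1 - t) * x ! k + of_real (t - real k) * x ! (k + 1)))"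

definition alpha_bar :: real where
  "alpha_bar = 4/3 + sqrt 205 / 15"

definition Xn :: "(nat \<Rightarrow> 'w \<Rightarrow> complex set set) \<Rightarrow> nat \<Rightarrow> 'w \<Rightarrow> real \<Rightarrow> complex" where
  "Xn T n \<omega> t = LI (tree_path (T n \<omega>) u1 u2) (alpha_bar ^ n * t)"

definition hit :: "(real \<Rightarrow> complex) \<Rightarrow> ereal" where
  "hit f = Inf {ereal t | t. t \<ge> 0 \<and> (\<forall>s\<ge>t. f s = u2)}"

definition dstar :: "(nat \<Rightarrow> 'w \<Rightarrow> complex set set) \<Rightarrow> 'w \<Rightarrow> complex \<Rightarrow> complex \<Rightarrow> real" where
  "dstar T \<omega> a b = lim (\<lambda>m. real (tdist (T m \<omega>) a b) / alpha_bar ^ m)"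

definition dcauchy :: "(nat \<Rightarrow> 'w \<Rightarrow> complex set set) \<Rightarrow> 'w \<Rightarrow> (nat \<Rightarrow> complex) \<Rightarrow> bool" where
  "dcauchy T \<omega> x \<longleftrightarrow> (\<forall>n. x n \<in> Vstar) \<and>
     (\<forall>e>0. \<exists>N. \<forall>m\<ge>N. \<forall>n\<ge>N. dstar T \<omega> (x m) (x n) < e)"

definition cls :: "(nat \<Rightarrow> 'w \<Rightarrow> complex set set) \<Rightarrow> 'w \<Rightarrow> (nat \<Rightarrow> complex) \<Rightarrow> (nat \<Rightarrow> complex) set" where
  "cls T \<omega> x = {y. dcauchy T \<omega> y \<and> (\<lambda>n. dstar T \<omega> (x n) (y n)) \<longlonglongrightarrow> 0}"

definition Vcheck :: "(nat \<Rightarrow> 'w \<Rightarrow> complex set set) \<Rightarrow> 'w \<Rightarrow> (nat \<Rightarrow> complex) set set" where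
  "Vcheck T \<omega> = cls T \<omega> ` {x. dcauchy T \<omega> x}"

definition dcheck :: "(nat \<Rightarrow> 'w \<Rightarrow> complex set set) \<Rightarrow> 'w \<Rightarrow>
    (nat \<Rightarrow> complex) set \<Rightarrow> (nat \<Rightarrow> complex) set \<Rightarrow> real" where
  "dcheck T \<omega> A B = lim (\<lambda>n. dstar T \<omega> ((SOME x. x \<in> A) n) ((SOME y. y \<in> B) n))"

definition xi :: "(nat \<Rightarrow> complex) set \<Rightarrow> complex" where
  "xi A = lim (SOME x. x \<in> A)"

definition isometric_geodesic :: "(nat \<Rightarrow> 'w \<Rightarrow> complex set set) \<Rightarrow> 'w \<Rightarrow>
    (real \<Rightarrow> (nat \<Rightarrow> complex) set) \<Rightarrow> bool" where
  "isometric_geodesic T \<omega> \<gamma> \<longleftrightarrow>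
     (let D = dstar T \<omega> u1 u2 in
       (\<forall>t\<in>{0..D}. \<gamma> t \<in> Vcheck T \<omega>) \<and>
       (\<forall>s\<in>{0..D}. \<forall>t\<in>{0..D}. dcheck T \<omega> (\<gamma> s) (\<gamma> t) = \<bar>s - t\<bar>) \<and>
       \<gamma> 0 = cls T \<omega> (\<lambda>_. u1) \<and> \<gamma> D = cls T \<omega> (\<lambda>_. u2))"

end

(* The edge set of the path from a to b in a tree t is the only subset of t whose vertices of odd degree
   are exactly a and b. This condition is additive over cells, hence a path in T_n is refined to a path
   in T_(n+1) cell by cell, and replacing the restriction of T_(n+1) to one cell by another forest with
   the same trace gives another tree with the same trace. So, given T_n, the restrictions to the cells
   are uniform and uncorrelated, and the numbers of cells crossed by a path, counted by three types,
   follow a branching process whose mean matrix has the eigenvalues alpha_bar, 4/3 - sqrt 205 / 15, 0.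
   Second moments give almost sure convergence of tdist / alpha_bar^m, positivity of the limits, and
   that the edges of the path from u1 to u2 in T_n become short.

   The rest is deterministic. A vertex of the path in T_n whose two path edges lie in different cells
   stays on the path in all T_m with m >= n; at these vertices v the curve satisfies X(d(u1,v)) = v, and
   they are dense, which gives the hitting time and a geodesic. For an arbitrary geodesic, a representing
   sequence y_n has vanishing distance to its projection to the path in T_m. A path in T_m between
   points that are far apart in the plane passes through two vertices of a coarse level, hence it is
   long, so y_n is close in the plane to its projection, which is a value of X_m. *)

theory Submission
  imports Defs
begin

section \<open>Edge sets and their boundaries modulo two\<close>

text \<open>Boundaries modulo two turn path surgery into linear algebra: they add under symmetric
  difference, and over cells they add as parities, so an edge set may be exchanged inside a cell as
  soon as its boundary is kept. The facts needed about one cell then concern 9-bit vectors and are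
  enumerated. Three types of crossings are needed because the mean offspring depends on whether the
  cell carries one edge or two, and on how many of them are used. The mean matrix has rows (1, 4/5,
  2/5), (1/2, 1, 1/2), (1, 4/3, 2/3), whence \<open>alpha_bar\<close>. Conditioning is replaced by
  counting: \<open>T n\<close> is a function of \<open>T (n + k)\<close>, all moments are finite
  averages over spanning trees, and the independence of a cell from the rest is an involution on
  pairs of a tree and a cell forest. The obstacle in the deterministic part is that the paths in the
  \<open>T n\<close> are not nested: where two successive path edges lie in one cell, the refined
  path may miss the vertex between them. Of two neighbouring vertices on the path at most one is of
  this kind, so enough vertices persist.\<close>

definition sd :: "'a set \<Rightarrow> 'a set \<Rightarrow> 'a set" where
  "sd A B = (A - B) \<union> (B - A)"

definition bd :: "'a set set \<Rightarrow> 'a set" where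
  "bd P = {v. odd (card {e \<in> P. v \<in> e})}"

text \<open>Connectedness by an edge set with the right odd vertices. Transitivity is then
  cancellation in the symmetric difference; agreement with \<open>reach\<close> is
  \<open>conn_iff_reach\<close>.\<close>

definition conn :: "'a set set \<Rightarrow> 'a \<Rightarrow> 'a \<Rightarrow> bool" where
  "conn E a b \<longleftrightarrow> (\<exists>P\<subseteq>E. bd P = sd {a} {b})"

text \<open>The cycle space of \<open>E\<close> over the field with two elements is trivial.\<close>

definition acyc :: "'a set set \<Rightarrow> bool" where
  "acyc E \<longleftrightarrow> (\<forall>P\<subseteq>E. bd P = {} \<longrightarrow> P = {})"

definition edges2 :: "'a set set \<Rightarrow> bool" where
  "edges2 E \<longleftrightarrow> finite E \<and> (\<forall>e\<in>E. card e = 2)"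

lemma in_sd: "x \<in> sd A B \<longleftrightarrow> (x \<in> A) \<noteq> (x \<in> B)"
  by (auto simp: sd_def)

lemma sd_comm: "sd A B = sd B A" by (auto simp: sd_def)
lemma sd_self[simp]: "sd A A = {}" by (auto simp: sd_def)
lemma sd_empty[simp]: "sd A {} = A" "sd {} A = A" by (auto simp: sd_def)
lemma sd_cancel: "sd (sd A B) (sd B C) = sd A C" by (auto simp: sd_def)
lemma sd_eq_empty: "sd A B = {} \<longleftrightarrow> A = B" by (auto simp: sd_def)
lemma sd_disjoint: "A \<inter> B = {} \<Longrightarrow> sd A B = A \<union> B" by (auto simp: sd_def)
lemma sd_pair: "a \<noteq> b \<Longrightarrow> sd {a} {b} = {a, b}" by (auto simp: sd_def)

lemma finite_sd: "finite A \<Longrightarrow> finite B \<Longrightarrow> finite (sd A B)" by (simp add: sd_def)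

lemma odd_card_sd:
  assumes "finite A" "finite B"
  shows "odd (card (sd A B)) \<longleftrightarrow> odd (card A) \<noteq> odd (card B)"
proof -
  have "card A = card (A - B) + card (A \<inter> B)"
    using assms by (metis Diff_Diff_Int Diff_disjoint Un_Diff_Int card_Un_disjoint finite_Diff finite_Int inf_commute Int_Diff inf.idem)
  moreover have "card B = card (B - A) + card (A \<inter> B)"
    using assms by (metis Diff_Diff_Int Diff_disjoint Un_Diff_Int card_Un_disjoint finite_Diff finite_Int inf_commute Int_Diff inf.idem)
  moreover have "card (sd A B) = card (A - B) + card (B - A)"
    unfolding sd_def using assms by (intro card_Un_disjoint) auto
  ultimately show ?thesis by presburger
qed

lemma bd_sd:
  assumes "finite P" "finite Q"
  shows "bd (sd P Q) = sd (bd P) (bd Q)"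
proof (rule set_eqI)
  fix v
  have "{e \<in> sd P Q. v \<in> e} = sd {e \<in> P. v \<in> e} {e \<in> Q. v \<in> e}"
    by (auto simp: sd_def)
  then show "v \<in> bd (sd P Q) \<longleftrightarrow> v \<in> sd (bd P) (bd Q)"
    using assms by (simp add: bd_def in_sd odd_card_sd)
qed

lemma bd_empty[simp]: "bd {} = {}" by (simp add: bd_def)

lemma bd_single[simp]: "bd {e} = e"
proof -
  have "card {x. x = e \<and> v \<in> x} = (if v \<in> e then 1 else 0)" for v
  proof (cases "v \<in> e")
    case True
    then have "{x. x = e \<and> v \<in> x} = {e}" by auto
    with True show ?thesis by simp
  next
    case False
    then have "{x. x = e \<and> v \<in> x} = {}" by auto
    with False show ?thesis by simp
  qed
  then show ?thesis by (auto simp: bd_def split: if_splits)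
qed

lemma bd_insert: "finite P \<Longrightarrow> e \<notin> P \<Longrightarrow> bd (insert e P) = sd (bd P) e"
  using bd_sd[of P "{e}"] by (simp add: sd_disjoint)

lemma edges2_finite: "edges2 E \<Longrightarrow> P \<subseteq> E \<Longrightarrow> finite P"
  by (auto simp: edges2_def finite_subset)

lemma edges2_subset: "edges2 E \<Longrightarrow> P \<subseteq> E \<Longrightarrow> edges2 P"
  by (auto simp: edges2_def finite_subset)

text \<open>Handshake lemma: every edge changes the parity at exactly two vertices.\<close>

lemma even_card_bd: "edges2 P \<Longrightarrow> finite (bd P) \<and> even (card (bd P))"
proof -
  assume "edges2 P"
  then have "finite P" by (simp add: edges2_def)
  then show ?thesis using \<open>edges2 P\<close>
  proof (induction P rule: finite_induct)
    case empty then show ?case by simp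
  next
    case (insert e P)
    have c: "card e = 2" using insert.prems by (simp add: edges2_def)
    then have fe: "finite e" using card.infinite by fastforce
    have "finite (bd P)" "even (card (bd P))"
      using insert by (auto simp: edges2_def)
    then show ?case
      using c fe odd_card_sd[of "bd P" e] insert.hyps by (simp add: bd_insert finite_sd)
  qed
qed

lemma conn_refl: "conn E a a"
  unfolding conn_def by (rule exI[of _ "{}"]) simp

lemma conn_sym: "conn E a b \<Longrightarrow> conn E b a"
  by (simp add: conn_def sd_comm)

lemma conn_trans:
  assumes "edges2 E" "conn E a b" "conn E b c" shows "conn E a c"
proof -
  obtain P Q where P: "P \<subseteq> E" "bd P = sd {a} {b}" and Q: "Q \<subseteq> E" "bd Q = sd {b} {c}"
    using assms by (auto simp: conn_def)
  have "bd (sd P Q) = sd {a} {c}"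
    using P Q assms(1) by (simp add: bd_sd edges2_finite sd_cancel)
  moreover have "sd P Q \<subseteq> E" using P Q by (auto simp: sd_def)
  ultimately show ?thesis by (auto simp: conn_def)
qed

lemma conn_mono: "conn E a b \<Longrightarrow> E \<subseteq> F \<Longrightarrow> conn F a b"
  unfolding conn_def by blast

lemma conn_edge: "{a,b} \<in> E \<Longrightarrow> a \<noteq> b \<Longrightarrow> conn E a b"
  unfolding conn_def by (rule exI[of _ "{{a,b}}"]) (simp add: sd_pair)

lemma acyc_unique:
  assumes "edges2 E" "acyc E" "P \<subseteq> E" "Q \<subseteq> E" "bd P = bd Q" shows "P = Q"
proof -
  have "bd (sd P Q) = {}" using assms by (simp add: bd_sd edges2_finite)
  moreover have "sd P Q \<subseteq> E" using assms by (auto simp: sd_def)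
  ultimately show ?thesis using assms(2) unfolding acyc_def by (metis sd_eq_empty)
qed

subsection \<open>Walks as lists\<close>

fun pe :: "'a list \<Rightarrow> 'a set set" where
  "pe (x # y # zs) = insert {x,y} (pe (y # zs))"
| "pe _ = {}"

lemma pe_conv: "pe p = {{p ! i, p ! Suc i} | i. Suc i < length p}"
proof (induction p rule: pe.induct)
  case (1 x y zs)
  have "{{(x#y#zs) ! i, (x#y#zs) ! Suc i} | i. Suc i < length (x#y#zs)} =
     insert {x,y} {{(y#zs) ! i, (y#zs) ! Suc i} | i. Suc i < length (y#zs)}" (is "?L = ?R")
  proof
    show "?L \<subseteq> ?R"
    proof
      fix e assume "e \<in> ?L"
      then obtain i where i: "e = {(x#y#zs) ! i, (x#y#zs) ! Suc i}" "Suc i < length (x#y#zs)" by blast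
      show "e \<in> ?R" using i by (cases i) auto
    qed
    show "?R \<subseteq> ?L"
    proof
      fix e assume "e \<in> ?R"
      then consider "e = {x,y}" | i where "e = {(y#zs) ! i, (y#zs) ! Suc i}" "Suc i < length (y#zs)" by blast
      then show "e \<in> ?L"
      proof cases
        case 1 then show ?thesis by (intro CollectI exI[of _ 0]) auto
      next
        case (2 i) then show ?thesis by (intro CollectI exI[of _ "Suc i"]) auto
      qed
    qed
  qed
  then show ?case using 1 by simp
qed auto

lemma finite_pe[simp]: "finite (pe p)" by (induction p rule: pe.induct) auto

lemma pe_sub_set: "e \<in> pe p \<Longrightarrow> e \<subseteq> set p" by (induction p rule: pe.induct) auto

lemma pe_subset_iff: "pe p \<subseteq> E \<longleftrightarrow> (\<forall>i. Suc i < length p \<longrightarrow> {p ! i, p ! Suc i} \<in> E)"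
  unfolding pe_conv by blast

lemma bd_pe: "distinct p \<Longrightarrow> p \<noteq> [] \<Longrightarrow> bd (pe p) = sd {hd p} {last p}"
proof (induction p rule: pe.induct)
  case (1 x y zs)
  have n: "{x,y} \<notin> pe (y # zs)" using 1 pe_sub_set[of "{x,y}" "y#zs"] by auto
  have "bd (pe (x#y#zs)) = sd (sd {y} {last (y#zs)}) {x,y}"
    using 1 n by (simp add: bd_insert)
  also have "\<dots> = sd {x} {last (y#zs)}"
    using 1 by (auto simp: sd_def split: if_splits)
  finally show ?case by simp
qed auto

lemma card_pe: "distinct p \<Longrightarrow> card (pe p) = length p - 1"
proof (induction p rule: pe.induct)
  case (1 x y zs)
  have n: "{x,y} \<notin> pe (y # zs)" using 1 pe_sub_set[of "{x,y}" "y#zs"] by auto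
  then show ?case using 1 by simp
qed auto

lemma pe_append: "xs \<noteq> [] \<Longrightarrow> ys \<noteq> [] \<Longrightarrow> pe (xs @ ys) = insert {last xs, hd ys} (pe xs \<union> pe ys)"
proof (induction xs rule: pe.induct)
  case (1 x y zs)
  have "pe ((x # y # zs) @ ys) = insert {x,y} (pe ((y # zs) @ ys))" by simp
  also have "pe ((y # zs) @ ys) = insert {last (y#zs), hd ys} (pe (y#zs) \<union> pe ys)"
    using 1 by blast
  finally show ?case by (simp only: pe.simps last.simps list.simps if_False) blast
next
  case ("2_2" v)
  then obtain y zs where "ys = y # zs" by (cases ys) auto
  then show ?case by simp
qed simp

lemma pe_glue: "pe (xs @ a # ys) = pe (xs @ [a]) \<union> pe (a # ys)"
proof (cases "xs = []")
  case False
  then show ?thesis by (simp add: pe_append)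
qed simp

text \<open>The first edge is the only one at the first vertex, so a simple path can be read off
  from its edges once its starting point is known.\<close>

lemma pe_determines:
  "distinct p \<Longrightarrow> distinct q \<Longrightarrow> p \<noteq> [] \<Longrightarrow> q \<noteq> [] \<Longrightarrow> hd p = hd q \<Longrightarrow> pe p = pe q \<Longrightarrow> p = q"
proof (induction p arbitrary: q rule: pe.induct)
  case (1 x y zs)
  have "card (pe q) = card (pe (x#y#zs))" using "1.prems"(6) by argo
  then have l: "length q = length (x#y#zs)"
    using "1.prems"(1,2,4) card_pe[of q] card_pe[of "x#y#zs"] by (cases q) (simp_all del: pe.simps)
  obtain y' zs' where q: "q = x # y' # zs'" using l "1.prems"(5) by (cases q; cases "tl q") auto
  have n: "{x,y} \<notin> pe (y # zs)" "{x,y} \<notin> pe (y' # zs')" "{x,y'} \<notin> pe (y' # zs')"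
    using "1.prems"(1,2) q pe_sub_set[of "{x,y}" "y#zs"] pe_sub_set[of "{x,y}" "y'#zs'"] pe_sub_set[of "{x,y'}" "y'#zs'"] by auto
  have i: "insert {x,y} (pe (y#zs)) = insert {x,y'} (pe (y'#zs'))" using "1.prems"(6) unfolding q pe.simps .
  then have "{x,y} = {x,y'}" using n by blast
  then have yy: "y = y'" by (metis doubleton_eq_iff)
  then have "pe (y#zs) = pe (y'#zs')" using i n by (metis insert_ident)
  then have "y # zs = y' # zs'" using "1.IH"[of "y' # zs'"] "1.prems"(1,2) q yy by simp
  then show ?case using q by simp
next
  case ("2_2" v)
  then have "card (pe q) = 0" by simp
  then have "length q \<le> 1" using "2_2" card_pe[of q] by simp
  then show ?case using "2_2" by (cases q) auto
qed auto

text \<open>If the next vertex of the walk already occurs on the path, the path is cut there, which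
  keeps it simple.\<close>

lemma reach_path:
  assumes "reach E a b"
  shows "\<exists>p. p \<noteq> [] \<and> hd p = a \<and> last p = b \<and> distinct p \<and> pe p \<subseteq> E"
  using assms unfolding reach_def
proof (induction rule: rtrancl_induct)
  case base
  then show ?case by (intro exI[of _ "[a]"]) auto
next
  case (step y z)
  then obtain p where p: "p \<noteq> []" "hd p = a" "last p = y" "distinct p" "pe p \<subseteq> E" by blast
  have yz: "{y,z} \<in> E" using step by (simp add: adj_def)
  show ?case
  proof (cases "z \<in> set p")
    case True
    then obtain xs ys where xy: "p = xs @ z # ys" by (meson split_list)
    have "pe (xs @ [z]) \<subseteq> E" using p(5) unfolding xy by (subst (asm) pe_glue) simp
    then show ?thesis using p xy by (intro exI[of _ "xs @ [z]"]) (auto simp: hd_append split: if_splits)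
  next
    case False
    then show ?thesis using p yz by (intro exI[of _ "p @ [z]"]) (auto simp: pe_append)
  qed
qed

lemma reach_sym: "reach E a b \<Longrightarrow> reach E b a"
proof -
  have "sym (adj E)" by (auto simp: sym_def adj_def insert_commute)
  then have "sym ((adj E)\<^sup>*)" by (rule sym_rtrancl)
  then show "reach E a b \<Longrightarrow> reach E b a" unfolding reach_def by (auto dest: symD)
qed

text \<open>An edge with one end in the component of \<open>a\<close> has both ends there, so the
  edges of \<open>P\<close> inside the component have exactly the part of \<open>bd P\<close> in it
  as boundary; the handshake lemma applies to them.\<close>

lemma even_card_bd_comp:
  assumes E: "edges2 E" and P: "P \<subseteq> E"
  shows "even (card (bd P \<inter> {v. reach E a v}))"
proof -
  define C where "C = {v. reach E a v}"
  define Q where "Q = {e\<in>P. e \<subseteq> C}"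
  have fP: "finite P" using E P edges2_finite by blast
  have dich: "e \<subseteq> C" if e: "e \<in> P" "v \<in> e" "v \<in> C" for e v
  proof -
    have "card e = 2" "e \<in> E" using e P E by (auto simp: edges2_def)
    then obtain x y where xy: "e = {x,y}" "x \<noteq> y" by (meson card_2_iff)
    have "(x,y) \<in> adj E" "(y,x) \<in> adj E"
      using xy \<open>e \<in> E\<close> by (auto simp: adj_def insert_commute)
    then show ?thesis using e xy unfolding C_def reach_def
      by (auto intro: rtrancl_into_rtrancl)
  qed
  have "bd Q = bd P \<inter> C"
  proof (rule set_eqI)
    fix v
    show "v \<in> bd Q \<longleftrightarrow> v \<in> bd P \<inter> C"
    proof (cases "v \<in> C")
      case True
      then have "{e \<in> Q. v \<in> e} = {e \<in> P. v \<in> e}" using dich by (auto simp: Q_def)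
      then show ?thesis using True by (simp add: bd_def)
    next
      case False
      then have "{e \<in> Q. v \<in> e} = {}" by (auto simp: Q_def)
      then have "v \<notin> bd Q" unfolding bd_def mem_Collect_eq by (metis card.empty even_zero)
      then show ?thesis using False by simp
    qed
  qed
  moreover have "even (card (bd Q))" using even_card_bd[of Q] E P edges2_subset[of E Q] by (auto simp: Q_def)
  ultimately show ?thesis by (simp add: C_def)
qed

text \<open>For the direction from \<open>conn\<close>: the component of \<open>a\<close> contains
  an even number of the odd vertices \<open>a\<close> and \<open>b\<close>, hence not
  \<open>a\<close> alone.\<close>

lemma conn_iff_reach:
  assumes E: "edges2 E" shows "conn E a b \<longleftrightarrow> reach E a b"
proof
  assume "reach E a b"
  then obtain p where p: "p \<noteq> []" "hd p = a" "last p = b" "distinct p" "pe p \<subseteq> E" using reach_path by blast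
  then show "conn E a b" unfolding conn_def using bd_pe[of p] by blast
next
  assume "conn E a b"
  then obtain P where P: "P \<subseteq> E" "bd P = sd {a} {b}" by (auto simp: conn_def)
  show "reach E a b"
  proof (cases "a = b")
    case True then show ?thesis by (simp add: reach_def)
  next
    case False
    then have "even (card ({a,b} \<inter> {v. reach E a v}))"
      using even_card_bd_comp[OF E P(1), of a] P by (simp add: sd_pair)
    moreover have "reach E a a" by (simp add: reach_def)
    ultimately show ?thesis by (cases "reach E a b") auto
  qed
qed

text \<open>A nonempty edge set with empty boundary, minus one edge, connects the two ends of this
  edge, and the connecting path closes up to a cycle. Conversely the edges of a cycle have empty
  boundary.\<close>

lemma forest_iff_acyc:
  assumes E: "edges2 E" shows "forest E \<longleftrightarrow> acyc E"
proof
  assume f: "forest E"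
  show "acyc E" unfolding acyc_def
  proof (intro allI impI)
    fix P assume P: "P \<subseteq> E" "bd P = {}"
    show "P = {}"
    proof (rule ccontr)
      assume "P \<noteq> {}"
      then obtain e where e: "e \<in> P" by blast
      then have "card e = 2" using P E by (auto simp: edges2_def)
      then obtain a b where ab: "e = {a,b}" "a \<noteq> b" by (meson card_2_iff)
      have fP: "edges2 P" "finite P" using E P edges2_subset edges2_finite by blast+
      have "P = insert e (P - {e})" using e by blast
      then have "sd (bd (P - {e})) e = {}" using bd_insert[of "P - {e}" e] fP P by auto
      then have "bd (P - {e}) = sd {a} {b}" using ab by (simp add: sd_eq_empty sd_pair)
      then have "conn (P - {e}) a b" unfolding conn_def by blast
      then have "reach (P - {e}) a b"
        using conn_iff_reach[of "P - {e}"] fP edges2_subset by blast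
      then obtain p where p: "p \<noteq> []" "hd p = a" "last p = b" "distinct p" "pe p \<subseteq> P - {e}"
        using reach_path by blast
      \<comment> \<open>The path avoids the removed edge, so it has a vertex besides the two
        ends.\<close>
      have l: "length p \<ge> 3"
      proof (rule ccontr)
        assume "\<not> 3 \<le> length p"
        then consider x where "p = [x]" | x y where "p = [x,y]" using p(1)
          by (cases p; cases "tl p"; cases "tl (tl p)") auto
        then show False using p ab by cases auto
      qed
      have "is_cycle E p" unfolding is_cycle_def
      proof (intro conjI allI impI)
        fix i assume i: "i < length p"
        show "{p ! i, p ! ((i + 1) mod length p)} \<in> E"
        proof (cases "Suc i < length p")
          case True
          then have "{p ! i, p ! Suc i} \<in> pe p" by (auto simp: pe_conv)
          then show ?thesis using True p P by auto
        next
          case False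
          then have "Suc i = length p" using i by simp
          then have "p ! i = b" "(i + 1) mod length p = 0"
            using p last_conv_nth[of p] by (auto simp flip: \<open>Suc i = length p\<close>)
          then show ?thesis using p hd_conv_nth[of p] e ab P by (auto simp: insert_commute)
        qed
      qed (use l p in auto)
      then show False using f by (auto simp: forest_def)
    qed
  qed
next
  assume a: "acyc E"
  show "forest E" unfolding forest_def
  proof
    assume "\<exists>vs. is_cycle E vs"
    then obtain p where l: "length p \<ge> 3" and d: "distinct p"
      and ed: "\<And>i. i < length p \<Longrightarrow> {p ! i, p ! ((i + 1) mod length p)} \<in> E"
      by (auto simp: is_cycle_def)
    have ne: "p \<noteq> []" using l by auto
    have pE: "pe p \<subseteq> E" unfolding pe_subset_iff
    proof (intro allI impI)
      fix i assume "Suc i < length p" then show "{p ! i, p ! Suc i} \<in> E" using ed[of i] by simp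
    qed
    have cl: "{last p, hd p} \<in> E" using ed[of "length p - 1"] ne l
      by (simp add: last_conv_nth hd_conv_nth)
    \<comment> \<open>The closing edge must be new, otherwise adding it would not change the
      boundary; this is where three vertices are needed.\<close>
    have nn: "{last p, hd p} \<notin> pe p"
    proof
      assume "{last p, hd p} \<in> pe p"
      then obtain i where i: "Suc i < length p" "{p ! (length p - 1), p ! 0} = {p ! i, p ! Suc i}"
        using ne by (auto simp: pe_conv last_conv_nth hd_conv_nth)
      then have "(length p - 1 = i \<and> 0 = Suc i) \<or> (length p - 1 = Suc i \<and> 0 = i)"
        using nth_eq_iff_index_eq[OF d] l unfolding doubleton_eq_iff
        by (smt (verit) Suc_lessD diff_less gr_implies_not0 not_gr_zero zero_less_one)
      then show False using l by auto
    qed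
    have hl: "hd p \<noteq> last p" using d l ne by (cases p) (auto split: if_splits)
    have "bd (insert {last p, hd p} (pe p)) = {}"
      using nn bd_pe[OF d ne] hl by (simp add: bd_insert sd_pair insert_commute)
    then show False using a pE cl unfolding acyc_def by blast
  qed
qed

section \<open>Paths, distances and projections in a tree\<close>

definition pth :: "'a set set \<Rightarrow> 'a \<Rightarrow> 'a \<Rightarrow> 'a set set" where
  "pth E a b = (THE P. P \<subseteq> E \<and> bd P = sd {a} {b})"

lemma pth_eq:
  assumes "edges2 E" "acyc E" "P \<subseteq> E" "bd P = sd {a} {b}" shows "pth E a b = P"
  unfolding pth_def using assms acyc_unique[OF assms(1,2)] by (intro the_equality) auto

lemma pth_props:
  assumes "edges2 E" "acyc E" "conn E a b"
  shows "pth E a b \<subseteq> E" "bd (pth E a b) = sd {a} {b}"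
  using assms pth_eq[OF assms(1,2)] unfolding conn_def by auto

lemma tree_path_unique:
  assumes E: "edges2 E" "acyc E"
    and p: "p \<noteq> []" "hd p = a" "last p = b" "distinct p" "pe p \<subseteq> E"
  shows "tree_path E a b = p"
  unfolding tree_path_def pe_subset_iff[symmetric]
proof (rule the_equality)
  show "p \<noteq> [] \<and> hd p = a \<and> last p = b \<and> distinct p \<and> pe p \<subseteq> E" using p by simp
  fix q assume q: "q \<noteq> [] \<and> hd q = a \<and> last q = b \<and> distinct q \<and> pe q \<subseteq> E"
  then have "pe p = pe q" using p acyc_unique[OF E, of "pe p" "pe q"] bd_pe[of p] bd_pe[of q] by auto
  then show "q = p" using p q pe_determines[of q p] by auto
qed

lemma tree_path_props:
  assumes E: "edges2 E" "acyc E" "conn E a b"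
  shows "tree_path E a b \<noteq> []" "hd (tree_path E a b) = a" "last (tree_path E a b) = b"
    "distinct (tree_path E a b)" "pe (tree_path E a b) \<subseteq> E" "pe (tree_path E a b) = pth E a b"
    "tdist E a b = card (pth E a b)"
proof -
  have "reach E a b" using conn_iff_reach E by blast
  then obtain p where p: "p \<noteq> []" "hd p = a" "last p = b" "distinct p" "pe p \<subseteq> E"
    using reach_path by blast
  then have e: "tree_path E a b = p" using tree_path_unique E by blast
  show "tree_path E a b \<noteq> []" "hd (tree_path E a b) = a" "last (tree_path E a b) = b"
    "distinct (tree_path E a b)" "pe (tree_path E a b) \<subseteq> E" using p e by auto
  show pp: "pe (tree_path E a b) = pth E a b" using p e pth_eq[OF E(1,2) p(5)] bd_pe[of p] by auto
  show "tdist E a b = card (pth E a b)" unfolding tdist_def pp[symmetric] using e p by (simp add: card_pe)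
qed

definition stree :: "'a set \<Rightarrow> 'a set set \<Rightarrow> bool" where
  "stree V E \<longleftrightarrow> edges2 E \<and> acyc E \<and> (\<forall>a\<in>V. \<forall>b\<in>V. conn E a b) \<and> \<Union>E \<subseteq> V"

lemma streeD: assumes "stree V E" shows "edges2 E" "acyc E" "a \<in> V \<Longrightarrow> b \<in> V \<Longrightarrow> conn E a b" "\<Union>E \<subseteq> V"
  using assms by (auto simp: stree_def)

lemma tdist_split:
  assumes T: "stree V E" and p: "xs @ v # ys = tree_path E a b" and ab: "a \<in> V" "b \<in> V"
  shows "tdist E a v = length xs" "tdist E v b = length ys" "v \<in> V"
    "tdist E a b = tdist E a v + tdist E v b"
proof -
  note tp = tree_path_props[OF streeD(1,2)[OF T] streeD(3)[OF T ab]]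
  let ?q = "xs @ [v]" and ?r = "v # ys"
  have "pe ?q \<union> pe ?r \<subseteq> E" using tp(5) unfolding p[symmetric] by (subst (asm) pe_glue)
  moreover have "distinct ?q" "distinct ?r" using tp(4) unfolding p[symmetric] by auto
  moreover have "hd ?q = a" using tp(2) unfolding p[symmetric] by (cases xs) auto
  moreover have "last ?r = b" using tp(3) unfolding p[symmetric] by auto
  ultimately have "tree_path E a v = ?q" "tree_path E v b = ?r"
    using tree_path_unique[OF streeD(1,2)[OF T]] by auto
  then show 1: "tdist E a v = length xs" "tdist E v b = length ys" by (auto simp: tdist_def)
  show "tdist E a b = tdist E a v + tdist E v b"
    unfolding 1 by (simp add: tdist_def p[symmetric])
  show "v \<in> V"
  proof (cases xs)
    case Nil then show ?thesis using tp(2) ab unfolding p[symmetric] by auto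
  next
    case (Cons x zs)
    then have "{last xs, v} \<in> pe (tree_path E a b)" unfolding p[symmetric] by (subst pe_append) auto
    then show ?thesis using tp(5) streeD(4)[OF T] by blast
  qed
qed

lemma tdist_sym:
  assumes T: "stree V E" and ab: "a \<in> V" "b \<in> V" shows "tdist E a b = tdist E b a"
  using tree_path_props(7)[OF streeD(1,2)[OF T] streeD(3)[OF T]] ab
  by (metis pth_def sd_comm)

lemma tdist_self: assumes T: "stree V E" and ab: "a \<in> V" shows "tdist E a a = 0"
  using tree_path_props(7)[OF streeD(1,2)[OF T] streeD(3)[OF T ab ab]]
    pth_eq[OF streeD(1,2)[OF T], of "{}" a a] by simp

text \<open>The edges common to both paths cancel; the result has the right boundary, which
  determines it in an acyclic edge set.\<close>

lemma pth_sd: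
  assumes T: "stree V E" and ab: "a \<in> V" "b \<in> V" "c \<in> V"
  shows "pth E a c = sd (pth E a b) (pth E b c)"
proof -
  note pp = pth_props[OF streeD(1,2)[OF T] streeD(3)[OF T]]
  have f: "finite (pth E a b)" "finite (pth E b c)"
    using pp[of a b] pp[of b c] ab edges2_finite[OF streeD(1)[OF T]] by auto
  show ?thesis
  proof (rule pth_eq[OF streeD(1,2)[OF T]])
    show "sd (pth E a b) (pth E b c) \<subseteq> E" using pp(1)[of a b] pp(1)[of b c] ab by (auto simp: sd_def)
    show "bd (sd (pth E a b) (pth E b c)) = sd {a} {c}"
      using pp(2)[of a b] pp(2)[of b c] ab f by (simp add: bd_sd sd_cancel)
  qed
qed

lemma tdist_triangle:
  assumes T: "stree V E" and ab: "a \<in> V" "b \<in> V" "c \<in> V"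
  shows "tdist E a c \<le> tdist E a b + tdist E b c"
proof -
  note pp = pth_props[OF streeD(1,2)[OF T] streeD(3)[OF T]]
  note tp = tree_path_props(7)[OF streeD(1,2)[OF T] streeD(3)[OF T]]
  have f: "finite (pth E a b)" "finite (pth E b c)"
    using pp[of a b] pp[of b c] ab edges2_finite[OF streeD(1)[OF T]] by auto
  have "card (sd (pth E a b) (pth E b c)) \<le> card (pth E a b \<union> pth E b c)"
    using f by (intro card_mono) (auto simp: sd_def)
  also have "\<dots> \<le> card (pth E a b) + card (pth E b c)" by (rule card_Un_le)
  finally show ?thesis using tp ab pth_sd[OF T ab] by metis
qed

lemma tdist_pos:
  assumes T: "stree V E" and ab: "a \<in> V" "b \<in> V" "a \<noteq> b" shows "pth E a b \<noteq> {}"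
  using pth_props(2)[OF streeD(1,2)[OF T] streeD(3)[OF T]] ab
  by (metis bd_empty sd_pair insert_not_empty)

text \<open>The projection is the first vertex of the path from \<open>x\<close> to \<open>a\<close> that lies on the path from \<open>a\<close> to \<open>b\<close>.\<close>

lemma tree_projection:
  assumes T: "stree V E" and ab: "a \<in> V" "b \<in> V" and x: "x \<in> V"
  obtains v xs ys where "tree_path E a b = xs @ v # ys" "v \<in> V"
    "tdist E a x = tdist E a v + tdist E v x" "tdist E x b = tdist E x v + tdist E v b"
    "tdist E a b = tdist E a v + tdist E v b" "tdist E a v = length xs"
proof -
  let ?L = "tree_path E a b" and ?M = "tree_path E x a"
  note tl = tree_path_props[OF streeD(1,2)[OF T] streeD(3)[OF T ab]]
  note tm = tree_path_props[OF streeD(1,2)[OF T] streeD(3)[OF T x ab(1)]]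
  have "\<exists>v\<in>set ?M. v \<in> set ?L"
  proof
    show "a \<in> set ?L" using tl(1,2) hd_in_set by metis
    show "a \<in> set ?M" using tm(1,3) last_in_set by metis
  qed
  then obtain us v vs where M: "?M = us @ v # vs" "v \<in> set ?L" "\<forall>y\<in>set us. y \<notin> set ?L"
    by (auto dest!: split_list_first_prop[where P="\<lambda>v. v \<in> set ?L"])
  obtain xs ys where L: "?L = xs @ v # ys" using M(2) by (meson split_list)
  note s1 = tdist_split[OF T L[symmetric] ab]
  note s2 = tdist_split[OF T M(1)[symmetric] x ab(1)]
  \<comment> \<open>By the choice of \<open>v\<close> as first hit, \<open>us\<close> is disjoint
    from the path between \<open>a\<close> and \<open>b\<close>, so the concatenation is
    simple.\<close>
  let ?Q = "us @ v # ys"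
  have "pe ?Q \<subseteq> E" using tl(5) tm(5) unfolding L M(1)
    by (simp add: pe_glue[of us v ys] pe_glue[of us v vs] pe_glue[of xs v ys])
  moreover have "distinct ?Q" using tl(4) tm(4) M L by auto
  moreover have "hd ?Q = x" using tm(2) unfolding M by (cases us) auto
  moreover have "last ?Q = b" using tl(3) unfolding L by auto
  ultimately have Q: "tree_path E x b = ?Q" using tree_path_unique[OF streeD(1,2)[OF T], of ?Q] by auto
  note s3 = tdist_split[OF T Q[symmetric] x ab(2)]
  show ?thesis
  proof (rule that[OF L s1(3) _ s3(4) s1(4) s1(1)])
    show "tdist E a x = tdist E a v + tdist E v x"
      using s2(4) tdist_sym[OF T] s1(3) x ab by simp
  qed
qed

lemma tdist_on_path:
  assumes T: "stree V E" and p: "tree_path E a b = xs @ v # ys" "tree_path E a b = xs' @ v' # ys'"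
    and ab: "a \<in> V" "b \<in> V" and le: "length xs \<le> length xs'"
  shows "tdist E v v' = length xs' - length xs"
proof -
  have vV: "v' \<in> V" using tdist_split(3)[OF T p(2)[symmetric] ab] .
  have tp: "tree_path E a v' = xs' @ [v']"
  proof -
    note tl = tree_path_props[OF streeD(1,2)[OF T] streeD(3)[OF T ab]]
    have "pe (xs' @ [v']) \<subseteq> E" using tl(5) unfolding p(2) by (subst (asm) pe_glue) simp
    moreover have "distinct (xs' @ [v'])" using tl(4) unfolding p(2) by auto
    moreover have "hd (xs' @ [v']) = a" using tl(2) unfolding p(2) by (cases xs') auto
    ultimately show ?thesis using tree_path_unique[OF streeD(1,2)[OF T], of "xs' @ [v']"] by auto
  qed
  have "\<exists>zs. xs' @ [v'] = xs @ v # zs"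
  proof -
    have "xs @ v # ys = xs' @ v' # ys'" using p by simp
    then have "take (length xs') (xs @ v # ys) = xs'" "take (Suc (length xs')) (xs @ v # ys) = xs' @ [v']"
      by simp_all
    then have "xs' @ [v'] = xs @ v # take (length xs' - length xs) ys" using le by (simp add: Suc_diff_le)
    then show ?thesis by blast
  qed
  then obtain zs where z: "xs' @ [v'] = xs @ v # zs" by blast
  have "tree_path E a v' = xs @ v # zs" using tp z by simp
  then have "tdist E v v' = length zs" using tdist_split(2)[OF T _ ab(1) vV] by metis
  moreover have "length zs = length xs' - length xs" using arg_cong[OF z, of length] by simp
  ultimately show ?thesis by simp
qed

section \<open>Cells of the Sierpinski graphs\<close>

text \<open>Barycentric coordinates with respect to the corners \<open>u 1\<close>,
  \<open>u 2\<close>, \<open>u 3\<close>.\<close>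

definition bar :: "nat \<Rightarrow> complex \<Rightarrow> real" where
  "bar i x = (if i = 1 then 1 - Re x - Im x / sqrt 3 else if i = 2 then Re x - Im x / sqrt 3
     else 2 * Im x / sqrt 3)"

definition Tri :: "complex set" where
  "Tri = {x. bar 1 x \<ge> 0 \<and> bar 2 x \<ge> 0 \<and> bar 3 x \<ge> 0}"

lemma bar_sum: "bar 1 x + bar 2 x + bar 3 x = 1" by (simp add: bar_def)

lemma bar_inj: "bar 2 x = bar 2 y \<Longrightarrow> bar 3 x = bar 3 y \<Longrightarrow> x = y"
  by (simp add: bar_def complex_eq_iff)

lemma bar_u: "i \<in> {1,2,3} \<Longrightarrow> j \<in> {1,2,3} \<Longrightarrow> bar i (u j) = (if i = j then 1 else 0)"
  by (auto simp: bar_def u_def u1_def u2_def u3_def)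

lemma bar_mid: "bar i ((x + y) / 2) = (bar i x + bar i y) / 2"
proof -
  have "Re ((x + y) / 2) = (Re x + Re y) / 2" "Im ((x + y) / 2) = (Im x + Im y) / 2" by simp_all
  then show ?thesis by (simp only: bar_def split: if_split) (simp add: diff_divide_distrib add_divide_distrib algebra_simps)
qed

lemma psi_mid: "psi j x = (x + u j) / 2" by (simp add: psi_def field_simps)

lemma bar_psi: "i \<in> {1,2,3} \<Longrightarrow> j \<in> {1,2,3} \<Longrightarrow> bar i (psi j x) = (bar i x + (if i = j then 1 else 0)) / 2"
  by (simp add: psi_mid bar_mid bar_u)

lemma Tri_iff: "x \<in> Tri \<longleftrightarrow> (\<forall>i\<in>{1,2,3}. bar i x \<ge> 0)" by (simp add: Tri_def)

lemma bar_one: assumes "x \<in> Tri" "bar j x \<ge> 1" "j \<in> {1,2,3}" shows "x = u j"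
proof -
  have "bar i x = bar i (u j)" if "i \<in> {1,2,3}" for i
    using assms bar_sum[of x] that bar_u[OF that assms(3)] by (auto simp: Tri_def)
  then show ?thesis by (intro bar_inj) auto
qed

lemma u_Tri: "j \<in> {1,2,3} \<Longrightarrow> u j \<in> Tri" unfolding Tri_iff using bar_u by auto

lemma psi_Tri: "x \<in> Tri \<Longrightarrow> j \<in> {1,2,3} \<Longrightarrow> psi j x \<in> Tri"
  unfolding Tri_iff by (simp add: bar_psi del: One_nat_def)

lemma VG0: "VG 0 = u ` {1,2,3}" by (auto simp: u_def)

lemma u_inj: "i \<in> {1,2,3} \<Longrightarrow> j \<in> {1,2,3} \<Longrightarrow> u i = u j \<longleftrightarrow> i = j"
  using bar_u[of i i] bar_u[of i j] by (auto split: if_splits)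

text \<open>The \<open>j\<close>-th coordinate is at least 1/2 on cell \<open>j\<close> and at most
  1/2 on cell \<open>i\<close>, so at a common point both bounds are attained.\<close>

lemma psi_collision:
  assumes "i \<in> {1,2,3}" "j \<in> {1,2,3}" "i \<noteq> j" "x \<in> Tri" "y \<in> Tri" "psi i x = psi j y"
  shows "x = u j"
proof -
  have "bar j (psi i x) = bar j (psi j y)" using assms by simp
  then have "bar j x = bar j y + 1" using bar_psi[of j i x] bar_psi[of j j y] assms by simp
  then show ?thesis using assms Tri_iff[of y] by (intro bar_one) auto
qed

lemma words_0[simp]: "words 0 = {[]}" by (auto simp: words_def)

lemma words_Suc: "words (Suc n) = (\<Union>i\<in>{1,2,3}. (#) i ` words n)"
proof
  show "words (Suc n) \<subseteq> (\<Union>i\<in>{1,2,3}. (#) i ` words n)"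
  proof
    fix w assume "w \<in> words (Suc n)"
    then obtain i v where "w = i # v" "i \<in> {1,2,3}" "v \<in> words n" by (cases w) (auto simp: words_def)
    then show "w \<in> (\<Union>i\<in>{1,2,3}. (#) i ` words n)" by blast
  qed
qed (auto simp: words_def)

lemma words_append: "w \<in> words k \<Longrightarrow> v \<in> words j \<Longrightarrow> w @ v \<in> words (k + j)"
  by (auto simp: words_def)

lemma words_split: "w \<in> words (k + j) \<Longrightarrow> \<exists>x\<in>words k. \<exists>y\<in>words j. w = x @ y"
  by (rule bexI[of _ "take k w"], rule bexI[of _ "drop k w"])
     (auto simp: words_def dest: in_set_takeD in_set_dropD)

lemma finite_words[simp]: "finite (words n)" by (induction n) (auto simp: words_Suc)

lemma psiw_append: "psiw (w @ v) = psiw w \<circ> psiw v" by (induction w) (simp_all only: append.simps psiw.simps id_o o_assoc)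

lemma psi_inj: "inj (psi i)" by (auto simp: inj_def psi_def)

lemma psiw_inj: "inj (psiw w)" 
proof (induction w)
  case (Cons i w) then show ?case using inj_compose[OF psi_inj[of i] Cons.IH] by (simp only: psiw.simps)
qed simp

lemma psiw_image_eq: "psiw w ` A = psiw w ` B \<longleftrightarrow> A = B"
  by (simp add: inj_image_eq_iff psiw_inj)

lemma psiw_mid: "psiw w ((x + y) / 2) = (psiw w x + psiw w y) / 2"
proof (induction w arbitrary: x y)
  case (Cons i w)
  then show ?case by (simp only: psiw.simps o_apply psi_mid) (simp add: field_simps)
qed simp

lemma psiw_diff: "psiw w x - psiw w y = (x - y) / 2 ^ length w"
  by (induction w arbitrary: x y) (simp_all add: psi_def diff_divide_distrib[symmetric])

lemma psiw_Tri: "w \<in> words n \<Longrightarrow> x \<in> Tri \<Longrightarrow> psiw w x \<in> Tri"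
proof (induction n arbitrary: w)
  case 0 then show ?case by simp
next
  case (Suc n)
  then obtain i v where "w = i # v" "i \<in> {1,2,3}" "v \<in> words n" by (auto simp: words_Suc)
  then show ?case using Suc psi_Tri[of "psiw v x" i] by simp
qed

text \<open>Each map averages with a corner, so the maximal coordinate 1 is reached only from
  coordinate 1.\<close>

lemma psiw_corner: "w \<in> words n \<Longrightarrow> x \<in> Tri \<Longrightarrow> j \<in> {1,2,3} \<Longrightarrow> bar j (psiw w x) \<ge> 1 \<Longrightarrow> x = u j"
proof (induction n arbitrary: w)
  case 0 then show ?case by (simp add: bar_one)
next
  case (Suc n)
  then obtain i v where w: "w = i # v" "i \<in> {1,2,3}" "v \<in> words n" by (auto simp: words_Suc)
  have "bar j (psiw v x) \<le> 1"
    using psiw_Tri[OF w(3) Suc.prems(2)] bar_sum[of "psiw v x"] Suc.prems(3) by (auto simp: Tri_def)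
  then have "bar j (psiw v x) \<ge> 1"
    using Suc.prems(4) bar_psi[OF Suc.prems(3) w(2), of "psiw v x"] by (simp add: w(1) split: if_splits)
  then show ?case using Suc w by blast
qed

text \<open>At the first letter where the words differ, the common point is a corner of the subcell
  by \<open>psi_collision\<close>, and only corners are mapped to corners.\<close>

lemma cell_inter:
  "w \<in> words n \<Longrightarrow> w' \<in> words n \<Longrightarrow> w \<noteq> w' \<Longrightarrow> x \<in> Tri \<Longrightarrow> y \<in> Tri \<Longrightarrow> psiw w x = psiw w' y \<Longrightarrow> x \<in> VG 0"
proof (induction n arbitrary: w w')
  case 0 then show ?case by simp
next
  case (Suc n)
  obtain i v where w: "w = i # v" "i \<in> {1,2,3}" "v \<in> words n" using Suc.prems(1) by (auto simp: words_Suc)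
  obtain i' v' where w': "w' = i' # v'" "i' \<in> {1,2,3}" "v' \<in> words n" using Suc.prems(2) by (auto simp: words_Suc)
  show ?case
  proof (cases "i = i'")
    case True
    then have "psiw v x = psiw v' y" using Suc.prems w w' injD[OF psi_inj] by auto
    then show ?thesis using Suc True w w' by blast
  next
    case False
    have "psiw v x = u i'"
      using psi_collision[OF w(2) w'(2) False psiw_Tri[OF w(3) Suc.prems(4)] psiw_Tri[OF w'(3) Suc.prems(5)]]
        Suc.prems(6) w w' by simp
    then have "x = u i'" using psiw_corner[OF w(3) Suc.prems(4) w'(2)] bar_u[OF w'(2) w'(2)] by simp
    then show ?thesis using w'(2) unfolding VG0 by blast
  qed
qed

lemma EG_add: "EG (k + j) = (\<Union>w\<in>words k. image (psiw w) ` EG j)"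
proof (induction k)
  case (Suc k)
  have "EG (Suc k + j) = (\<Union>i\<in>{1,2,3}. image (psi i) ` (\<Union>w\<in>words k. image (psiw w) ` EG j))"
    using Suc by simp
  also have "\<dots> = (\<Union>i\<in>{1,2,3}. \<Union>w\<in>words k. image (psiw (i # w)) ` EG j)"
    by (simp only: image_UN image_image psiw.simps o_def)
  also have "\<dots> = (\<Union>w\<in>words (Suc k). image (psiw w) ` EG j)" unfolding words_Suc by blast
  finally show ?case .
qed simp

lemma VG_add: "VG (k + j) = (\<Union>w\<in>words k. psiw w ` VG j)"
proof (induction k)
  case (Suc k)
  have "VG (Suc k + j) = (\<Union>i\<in>{1,2,3}. psi i ` (\<Union>w\<in>words k. psiw w ` VG j))"
    using Suc by simp
  also have "\<dots> = (\<Union>i\<in>{1,2,3}. \<Union>w\<in>words k. psiw (i # w) ` VG j)"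
    by (simp only: image_UN image_image psiw.simps o_def)
  also have "\<dots> = (\<Union>w\<in>words (Suc k). psiw w ` VG j)" unfolding words_Suc by blast
  finally show ?case .
qed simp

lemma VG_Tri: "VG n \<subseteq> Tri"
proof (induction n)
  case 0 then show ?case using u_Tri unfolding VG0 by auto
next
  case (Suc n) then show ?case using psi_Tri by auto
qed

lemma EG_edge: "e \<in> EG n \<Longrightarrow> \<exists>x\<in>VG n. \<exists>y\<in>VG n. x \<noteq> y \<and> e = {x,y}"
proof (induction n arbitrary: e)
  case 0
  have "u1 \<noteq> u2" "u2 \<noteq> u3" "u3 \<noteq> u1" using u_inj[of 1 2] u_inj[of 2 3] u_inj[of 3 1] by (auto simp: u_def)
  then show ?case using 0 by auto
next
  case (Suc n)
  then obtain i e' where i: "i \<in> {1,2,3}" "e' \<in> EG n" "e = psi i ` e'" by auto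
  then obtain x y where "x \<in> VG n" "y \<in> VG n" "x \<noteq> y" "e' = {x,y}" using Suc by blast
  then show ?case using i injD[OF psi_inj, of i x y] by (intro bexI[of _ "psi i x"] bexI[of _ "psi i y"]) auto
qed

lemma EG_sub_VG: "e \<in> EG n \<Longrightarrow> e \<subseteq> VG n" using EG_edge by blast

lemma finite_EG[simp]: "finite (EG n)" by (induction n) auto
lemma finite_VG[simp]: "finite (VG n)" by (induction n) auto

lemma edges2_EG: "E \<subseteq> EG n \<Longrightarrow> edges2 E"
  unfolding edges2_def using EG_edge finite_subset[OF _ finite_EG] by (metis card_2_iff subsetD)

lemma VG_mono_Suc: "VG n \<subseteq> VG (Suc n)"
proof (induction n)
  case 0
  have "psi i (u i) = u i" for i by (simp add: psi_def)
  then have "u ` {1,2,3} \<subseteq> (\<Union>i\<in>{1,2,3}. psi i ` (u ` {1,2,3}))" by force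
  then show ?case unfolding VG.simps(2) VG0 .
next
  case (Suc n) then show ?case by auto
qed

lemma VG_mono: "n \<le> m \<Longrightarrow> VG n \<subseteq> VG m" by (rule lift_Suc_mono_le[of VG]) (rule VG_mono_Suc)

text \<open>The midpoint of an edge is not a corner, since corners are extreme points.\<close>

lemma edge_cell_unique:
  assumes "e \<in> EG j" "e' \<in> EG j" "w \<in> words n" "w' \<in> words n" "psiw w ` e = psiw w' ` e'"
  shows "w = w'"
proof (rule ccontr)
  assume ne: "w \<noteq> w'"
  obtain x y where x: "x \<in> VG j" "y \<in> VG j" "x \<noteq> y" "e = {x,y}" using EG_edge[OF assms(1)] by blast
  obtain x' y' where x': "x' \<in> VG j" "y' \<in> VG j" "x' \<noteq> y'" "e' = {x',y'}" using EG_edge[OF assms(2)] by blast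
  have "{psiw w x, psiw w y} = {psiw w' x', psiw w' y'}" using assms(5) x x' by simp
  then have "psiw w x + psiw w y = psiw w' x' + psiw w' y'" by (auto simp: doubleton_eq_iff)
  then have m: "psiw w ((x + y) / 2) = psiw w' ((x' + y') / 2)" by (simp add: psiw_mid)
  have T: "x \<in> Tri" "y \<in> Tri" "x' \<in> Tri" "y' \<in> Tri" using x x' VG_Tri by auto
  then have T2: "(x + y) / 2 \<in> Tri" "(x' + y') / 2 \<in> Tri" unfolding Tri_iff bar_mid by auto
  have "(x + y) / 2 \<in> VG 0" using cell_inter[OF assms(3,4) ne T2 m] .
  then obtain i where i: "i \<in> {1,2,3}" "(x + y) / 2 = u i" unfolding VG0 by blast
  have "bar i x \<le> 1" "bar i y \<le> 1" using T bar_sum[of x] bar_sum[of y] i(1) by (auto simp: Tri_def)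
  moreover have "(bar i x + bar i y) / 2 = 1" using bar_mid[of i x y] i bar_u[OF i(1) i(1)] by simp
  ultimately have "bar i x \<ge> 1" "bar i y \<ge> 1" by auto
  then have "x = y" using bar_one[OF T(1) _ i(1)] bar_one[OF T(2) _ i(1)] by simp
  then show False using x by simp
qed

section \<open>Decomposition of edge sets into cells\<close>

definition glue :: "nat \<Rightarrow> (nat list \<Rightarrow> complex set set) \<Rightarrow> complex set set" where
  "glue n Q = (\<Union>w\<in>words n. image (psiw w) ` Q w)"

lemma piw_sub: "piw j w H \<subseteq> EG j" by (auto simp: piw_def)

lemma piw_mono: "P \<subseteq> H \<Longrightarrow> piw j w P \<subseteq> piw j w H" by (auto simp: piw_def)

text \<open>Every edge lies in exactly one cell. Together with \<open>glue_piw\<close> this gives a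
  bijection between the edge sets in \<open>EG (n + j)\<close> and the families of edge sets in
  \<open>EG j\<close> indexed by words.\<close>

lemma piw_glue:
  assumes "\<And>w. w \<in> words n \<Longrightarrow> Q w \<subseteq> EG j" "w \<in> words n"
  shows "piw j w (glue n Q) = Q w"
proof
  show "piw j w (glue n Q) \<subseteq> Q w"
  proof
    fix e assume "e \<in> piw j w (glue n Q)"
    then obtain w' e' where e: "e \<in> EG j" "w' \<in> words n" "e' \<in> Q w'" "psiw w ` e = psiw w' ` e'"
      by (auto simp: piw_def glue_def)
    then have "w = w'" using edge_cell_unique[OF e(1) _ assms(2) e(2)] assms(1) by blast
    then show "e \<in> Q w" using e psiw_image_eq by metis
  qed
  show "Q w \<subseteq> piw j w (glue n Q)" using assms by (auto simp: piw_def glue_def)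
qed

lemma glue_piw: "P \<subseteq> EG (n + j) \<Longrightarrow> glue n (\<lambda>w. piw j w P) = P"
proof
  assume P: "P \<subseteq> EG (n + j)"
  show "P \<subseteq> glue n (\<lambda>w. piw j w P)"
  proof
    fix e assume e: "e \<in> P"
    then obtain w e' where "w \<in> words n" "e' \<in> EG j" "e = psiw w ` e'" using P unfolding EG_add by blast
    then show "e \<in> glue n (\<lambda>w. piw j w P)" using e unfolding glue_def piw_def by blast
  qed
qed (auto simp: glue_def piw_def)

lemma glue_sub: "(\<And>w. w \<in> words n \<Longrightarrow> Q w \<subseteq> EG j) \<Longrightarrow> glue n Q \<subseteq> EG (n + j)"
  unfolding glue_def EG_add by blast

lemma glue_mono: "(\<And>w. w \<in> words n \<Longrightarrow> Q w \<subseteq> R w) \<Longrightarrow> glue n Q \<subseteq> glue n R"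
  unfolding glue_def by blast

lemma piw_piw: "v \<in> words i \<Longrightarrow> piw j v (piw (i + j) w f) = piw j (w @ v) f"
  unfolding piw_def by (auto simp: psiw_append image_comp EG_add)

text \<open>No edge belongs to two cells, so the degree of a vertex is the sum of its degrees over
  the cells, and its parity is that of the number of cells with odd degree.\<close>

lemma bd_glue:
  assumes Q: "\<And>w. w \<in> words n \<Longrightarrow> Q w \<subseteq> EG j"
  shows "v \<in> bd (glue n Q) \<longleftrightarrow> odd (card {w \<in> words n. v \<in> psiw w ` bd (Q w)})"
proof -
  let ?A = "\<lambda>w. image (psiw w) ` {e \<in> Q w. v \<in> psiw w ` e}"
  have fQ: "finite (Q w)" if "w \<in> words n" for w using finite_subset[OF Q[OF that] finite_EG] .
  have "{e \<in> glue n Q. v \<in> e} = (\<Union>w\<in>words n. ?A w)" by (auto simp: glue_def)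
  moreover have "card (\<Union>w\<in>words n. ?A w) = (\<Sum>w\<in>words n. card (?A w))"
  proof (rule card_UN_disjoint)
    show "\<forall>i\<in>words n. \<forall>k\<in>words n. i \<noteq> k \<longrightarrow> ?A i \<inter> ?A k = {}"
    proof (intro ballI impI)
      fix i k assume ik: "i \<in> words n" "k \<in> words n" "i \<noteq> k"
      show "?A i \<inter> ?A k = {}"
      proof (rule ccontr)
        assume "?A i \<inter> ?A k \<noteq> {}"
        then obtain e e' where "e \<in> Q i" "e' \<in> Q k" "psiw i ` e = psiw k ` e'" by auto
        then show False using edge_cell_unique[of e j e' i n k] ik Q[OF ik(1)] Q[OF ik(2)] by blast
      qed
    qed
  qed (use fQ in auto)
  moreover have "card (?A w) = card {e \<in> Q w. v \<in> psiw w ` e}" for w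
    by (rule card_image) (simp add: inj_on_def psiw_image_eq)
  ultimately have "card {e \<in> glue n Q. v \<in> e} = (\<Sum>w\<in>words n. card {e \<in> Q w. v \<in> psiw w ` e})" by simp
  then have "v \<in> bd (glue n Q) \<longleftrightarrow> odd (card {w \<in> words n. odd (card {e \<in> Q w. v \<in> psiw w ` e})})"
    using even_sum_iff[OF finite_words, of "\<lambda>w. card {e \<in> Q w. v \<in> psiw w ` e}" n]
    unfolding bd_def mem_Collect_eq by argo
  moreover have "odd (card {e \<in> Q w. v \<in> psiw w ` e}) \<longleftrightarrow> v \<in> psiw w ` bd (Q w)" for w
  proof (cases "v \<in> range (psiw w)")
    case True
    then obtain z where z: "v = psiw w z" by blast
    show ?thesis unfolding z inj_image_mem_iff[OF psiw_inj] bd_def by simp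
  next
    case False
    then have "{e \<in> Q w. v \<in> psiw w ` e} = {}" "v \<notin> psiw w ` bd (Q w)" by blast+
    then show ?thesis by (metis card.empty even_zero)
  qed
  ultimately show ?thesis by simp
qed

text \<open>Pieces in cells may be exchanged, even for pieces of another level, as long as their
  boundaries agree. The refinement of a path is the case of the levels 1 and 0.\<close>

lemma bd_glue_cong:
  assumes "\<And>w. w \<in> words n \<Longrightarrow> Q w \<subseteq> EG j" "\<And>w. w \<in> words n \<Longrightarrow> R w \<subseteq> EG i"
    "\<And>w. w \<in> words n \<Longrightarrow> bd (Q w) = bd (R w)"
  shows "bd (glue n Q) = bd (glue n R)"
proof (rule set_eqI)
  fix v
  have "{w \<in> words n. v \<in> psiw w ` bd (Q w)} = {w \<in> words n. v \<in> psiw w ` bd (R w)}" using assms(3) by auto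
  then show "v \<in> bd (glue n Q) \<longleftrightarrow> v \<in> bd (glue n R)" using bd_glue[of n Q j v] bd_glue[of n R i v] assms by simp
qed

lemma bd_sub: "P \<subseteq> EG n \<Longrightarrow> bd P \<subseteq> VG n"
proof
  fix v assume P: "P \<subseteq> EG n" "v \<in> bd P"
  then have "{e\<in>P. v \<in> e} \<noteq> {}" unfolding bd_def by (metis (mono_tags, lifting) card.empty even_zero mem_Collect_eq)
  then show "v \<in> VG n" using P EG_sub_VG by blast
qed

text \<open>A point that is not the image of a corner lies in one cell only, and this cell decides
  its parity.\<close>

lemma bd_local:
  assumes "z \<in> Tri" "z \<notin> VG 0" "w \<in> words n" "P \<subseteq> EG (n + j)"
  shows "psiw w z \<in> bd P \<longleftrightarrow> z \<in> bd (piw j w P)"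
proof -
  let ?S = "{w' \<in> words n. psiw w z \<in> psiw w' ` bd (piw j w' P)}"
  have "psiw w z \<in> bd P \<longleftrightarrow> odd (card ?S)"
    using bd_glue[of n "\<lambda>w. piw j w P" j "psiw w z"] piw_sub glue_piw[OF assms(4)] by simp
  moreover have "?S = (if z \<in> bd (piw j w P) then {w} else {})"
  proof -
    have "w' = w" if w'S: "w' \<in> ?S" for w'
    proof (rule ccontr)
      assume "w' \<noteq> w"
      obtain y where y: "y \<in> bd (piw j w' P)" "psiw w z = psiw w' y" using w'S by blast
      have "y \<in> Tri" using y bd_sub[OF piw_sub] VG_Tri by blast
      then have "z \<in> VG 0" using cell_inter[of w n w' z y] assms w'S y \<open>w' \<noteq> w\<close> by auto
      then show False using assms by simp
    qed
    moreover have "w \<in> ?S \<longleftrightarrow> z \<in> bd (piw j w P)"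
      using assms(3) by (simp add: inj_image_mem_iff[OF psiw_inj])
    ultimately show ?thesis by (cases "z \<in> bd (piw j w P)") (simp, blast, metis (lifting) ex_in_conv)
  qed
  ultimately show ?thesis by simp
qed

section \<open>Existence of spanning trees\<close>

lemma trees_iff: "E \<in> trees n \<longleftrightarrow> E \<subseteq> EG n \<and> stree (VG n) E"
proof (cases "E \<subseteq> EG n")
  case True
  then have e: "edges2 E" by (rule edges2_EG)
  have "\<Union>E \<subseteq> VG n" using True EG_sub_VG by blast
  then show ?thesis using True e
    by (simp add: trees_def is_spanning_tree_def stree_def forest_iff_acyc conn_iff_reach)
qed (simp add: trees_def is_spanning_tree_def)

lemma finite_trees[simp]: "finite (trees n)"
proof (rule finite_subset)
  show "trees n \<subseteq> Pow (EG n)" by (auto simp: trees_iff)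
qed simp

lemma conn_psi: "conn E a b \<Longrightarrow> edges2 E \<Longrightarrow> conn (image (psi i) ` E) (psi i a) (psi i b)"
proof -
  assume e: "edges2 E" "conn E a b"
  then obtain p where p: "p \<noteq> []" "hd p = a" "last p = b" "distinct p" "pe p \<subseteq> E"
    using conn_iff_reach[of E] reach_path by blast
  have "pe (map (psi i) p) \<subseteq> image (psi i) ` E" unfolding pe_subset_iff
  proof (intro allI impI)
    fix k assume "Suc k < length (map (psi i) p)"
    then have "{p ! k, p ! Suc k} \<in> E" "k < length p" "Suc k < length p" using p(5) by (auto simp: pe_subset_iff)
    then have "psi i ` {p ! k, p ! Suc k} \<in> image (psi i) ` E" by blast
    then show "{map (psi i) p ! k, map (psi i) p ! Suc k} \<in> image (psi i) ` E"
      using \<open>k < length p\<close> \<open>Suc k < length p\<close> by simp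
  qed
  moreover have "distinct (map (psi i) p)" using p psi_inj inj_on_subset[OF psi_inj subset_UNIV] by (simp add: distinct_map)
  moreover have "map (psi i) p \<noteq> []" "hd (map (psi i) p) = psi i a" "last (map (psi i) p) = psi i b"
    using p by (simp_all add: hd_map last_map)
  ultimately show ?thesis using bd_pe[of "map (psi i) p"] unfolding conn_def by metis
qed

lemma EG_connected: "a \<in> VG n \<Longrightarrow> b \<in> VG n \<Longrightarrow> conn (EG n) a b"
proof (induction n arbitrary: a b)
  case 0
  have "conn (EG 0) x y" if "x = y \<or> {x,y} \<in> EG 0" for x y
    using that conn_refl[of "EG 0" x] conn_edge[of x y "EG 0"] by auto
  moreover have "a = b \<or> {a,b} \<in> EG 0" using 0 by (simp add: doubleton_eq_iff) metis
  ultimately show ?case by blast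
next
  case (Suc n)
  have u0: "u j \<in> VG n" if "j \<in> {1,2,3}" for j using VG_mono[of 0 n] that unfolding VG0 by auto
  have c: "conn (EG (Suc n)) (psi i x) (psi i y)" if "x \<in> VG n" "y \<in> VG n" "i \<in> {1,2,3}" for i x y
  proof (rule conn_mono)
    show "conn (image (psi i) ` EG n) (psi i x) (psi i y)"
      by (rule conn_psi[OF Suc.IH[OF that(1,2)] edges2_EG[OF subset_refl]])
    show "image (psi i) ` EG n \<subseteq> EG (Suc n)" unfolding EG.simps using that(3) by blast
  qed
  obtain i x where a: "i \<in> {1,2,3}" "x \<in> VG n" "a = psi i x" using Suc.prems(1) by auto
  obtain j y where b: "j \<in> {1,2,3}" "y \<in> VG n" "b = psi j y" using Suc.prems(2) by auto
  \<comment> \<open>This midpoint is the common vertex of cells \<open>i\<close> and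
    \<open>j\<close> through which they are connected.\<close>
  have "psi i (u j) = psi j (u i)" by (simp add: psi_def field_simps)
  then show ?case
    using conn_trans[OF edges2_EG[OF subset_refl] c[OF a(2) u0[OF b(1)] a(1)], of b]
      c[OF u0[OF a(1)] b(2) b(1)] a b by simp
qed

text \<open>A largest acyclic edge set is spanning: adding a further edge creates an edge set with
  empty boundary through this edge, whose remainder connects the two ends. Nonemptiness makes the
  probabilities \<open>1 / card (trees n)\<close> sum to 1.\<close>

lemma trees_nonempty: "trees n \<noteq> {}"
proof -
  have "\<exists>E. (E \<subseteq> EG n \<and> acyc E) \<and> (\<forall>F. F \<subseteq> EG n \<and> acyc F \<longrightarrow> card F \<le> card E)"
  proof (rule ex_has_greatest_nat)
    show "{} \<subseteq> EG n \<and> acyc {}" by (simp add: acyc_def)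
    show "\<forall>F. F \<subseteq> EG n \<and> acyc F \<longrightarrow> card F < Suc (card (EG n))" by (simp add: card_mono le_imp_less_Suc)
  qed
  then obtain E where E: "E \<subseteq> EG n" "acyc E" and mx: "\<And>F. F \<subseteq> EG n \<Longrightarrow> acyc F \<Longrightarrow> card F \<le> card E" by blast
  have e2: "edges2 E" using E edges2_EG by blast
  have ed: "conn E a b" if ab: "{a,b} \<in> EG n" "a \<noteq> b" for a b
  proof (cases "{a,b} \<in> E")
    case True then show ?thesis using conn_edge ab(2) by metis
  next
    case False
    have "card (insert {a,b} E) > card E" using False e2 by (simp add: edges2_def)
    then have "\<not> acyc (insert {a,b} E)" using mx[of "insert {a,b} E"] E(1) ab(1) by force
    then obtain P where P: "P \<subseteq> insert {a,b} E" "bd P = {}" "P \<noteq> {}" unfolding acyc_def by metis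
    have fP: "finite P" using P e2 finite_subset[of P "insert {a,b} E"] by (auto simp: edges2_def)
    have abP: "{a,b} \<in> P"
    proof (rule ccontr)
      assume "{a,b} \<notin> P"
      then have "P \<subseteq> E" using P(1) by blast
      then show False using P E(2) by (simp add: acyc_def)
    qed
    then have "bd P = sd (bd (P - {{a,b}})) {a,b}"
      using bd_insert[of "P - {{a,b}}" "{a,b}"] fP insert_Diff[OF abP] by simp
    then have "bd (P - {{a,b}}) = sd {a} {b}" using P(2) ab(2) sd_eq_empty sd_pair by metis
    moreover have "P - {{a,b}} \<subseteq> E" using P(1) by blast
    ultimately show ?thesis unfolding conn_def by blast
  qed
  have "conn E a b" if ab: "a \<in> VG n" "b \<in> VG n" for a b
  proof -
    have "reach (EG n) a b" using EG_connected[OF ab] conn_iff_reach[OF edges2_EG[OF subset_refl], of n a b] by simp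
    then show ?thesis unfolding reach_def
    proof (induction rule: rtrancl_induct)
      case base show ?case by (rule conn_refl)
    next
      case (step y z)
      then have "{y,z} \<in> EG n" "y \<noteq> z" by (auto simp: adj_def)
      then show ?case using conn_trans[OF e2 step.IH ed] by blast
    qed
  qed
  moreover have "\<Union>E \<subseteq> VG n" using E(1) EG_sub_VG by blast
  ultimately have "E \<in> trees n" using E e2 unfolding trees_iff stree_def by simp
  then show ?thesis by blast
qed

subsection \<open>Euclidean distances along paths\<close>

lemma Tri_norm: "x \<in> Tri \<Longrightarrow> norm x \<le> 1"
proof -
  assume x: "x \<in> Tri"
  have "x = of_real (bar 2 x) * u2 + of_real (bar 3 x) * u3"
    by (simp add: complex_eq_iff bar_def u2_def u3_def field_simps)
  then have "norm x \<le> norm (of_real (bar 2 x) * u2) + norm (of_real (bar 3 x) * u3)"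
    by (metis norm_triangle_ineq)
  also have "norm u3 = 1" by (simp add: u3_def cmod_def power2_eq_square)
  then have "norm (of_real (bar 2 x) * u2) + norm (of_real (bar 3 x) * u3) = bar 2 x + bar 3 x"
    using x by (simp add: norm_mult u2_def Tri_def)
  also have "\<dots> \<le> 1" using bar_sum[of x] x by (auto simp: Tri_def)
  finally show ?thesis .
qed

lemma cell_diam:
  assumes "w \<in> words k" "x \<in> psiw w ` Tri" "y \<in> psiw w ` Tri" shows "norm (x - y) \<le> 2 / 2 ^ k"
proof -
  obtain x' y' where xy: "x = psiw w x'" "y = psiw w y'" "x' \<in> Tri" "y' \<in> Tri" using assms by blast
  have "norm (x' - y') \<le> 2" using Tri_norm[OF xy(3)] Tri_norm[OF xy(4)] norm_triangle_ineq4[of x' y'] by simp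
  moreover have "x - y = (x' - y') / 2 ^ k" using psiw_diff[of w x' y'] assms(1) xy by (simp add: words_def)
  ultimately show ?thesis by (simp add: norm_divide norm_power divide_right_mono)
qed

text \<open>Distinct cells of level \<open>k\<close> meet only in \<open>VG k\<close>, so a path can
  change the cell only at a vertex of \<open>VG k\<close>.\<close>

lemma path_in_cell:
  assumes "pe p \<subseteq> EG m" "k \<le> m" "length p \<ge> 2" "set (butlast (tl p)) \<inter> VG k = {}"
  shows "\<exists>w\<in>words k. set p \<subseteq> psiw w ` Tri"
  using assms
proof (induction p rule: pe.induct)
  case (1 x y zs)
  have "{x,y} \<in> EG (k + (m - k))" using 1 by auto
  then obtain w e where w: "w \<in> words k" "e \<in> EG (m - k)" "{x,y} = psiw w ` e" unfolding EG_add by auto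
  then have xy: "x \<in> psiw w ` Tri" "y \<in> psiw w ` Tri" using EG_sub_VG[OF w(2)] VG_Tri by blast+
  show ?case
  proof (cases zs)
    case Nil then show ?thesis using w(1) xy by (intro bexI[of _ w]) auto
  next
    case (Cons z zs')
    have y: "y \<notin> VG k" using 1 Cons by auto
    have "\<exists>w\<in>words k. set (y # zs) \<subseteq> psiw w ` Tri" using 1 Cons by (auto split: if_splits)
    then obtain v where v: "v \<in> words k" "set (y # zs) \<subseteq> psiw v ` Tri" by blast
    have "v = w"
    proof (rule ccontr)
      assume ne: "v \<noteq> w"
      obtain a b where ab: "y = psiw v a" "y = psiw w b" "a \<in> Tri" "b \<in> Tri" using v xy by auto
      then have "a \<in> VG 0" using cell_inter[OF v(1) w(1) ne ab(3,4)] by simp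
      then have "y \<in> VG (k + 0)" unfolding VG_add using ab v by blast
      then show False using y by simp
    qed
    then show ?thesis using v xy w by auto
  qed
qed auto

lemma path_short:
  assumes "pe p \<subseteq> EG m" "k \<le> m" "p \<noteq> []" "set (butlast (tl p)) \<inter> VG k = {}"
  shows "norm (hd p - last p) \<le> 2 / 2 ^ k"
proof (cases "length p \<ge> 2")
  case True
  then obtain w where "w \<in> words k" "set p \<subseteq> psiw w ` Tri" using path_in_cell assms by blast
  then show ?thesis using cell_diam[of w k "hd p" "last p"] assms(3) hd_in_set[of p] last_in_set[of p] by blast
next
  case False
  then obtain a where "p = [a]" using assms(3) by (cases p; cases "tl p") auto
  then have "hd p = last p" by simp
  then show ?thesis by simp
qed

text \<open>Cut at the only possible vertex of \<open>VG k\<close>: each of the two pieces stays in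
  one cell and joins points at distance at most \<open>2 / 2 ^ k\<close>.\<close>

lemma path_few_vertices:
  assumes "pe p \<subseteq> EG m" "k \<le> m" "p \<noteq> []" "distinct p" "\<And>a b. a \<in> set p \<inter> VG k \<Longrightarrow> b \<in> set p \<inter> VG k \<Longrightarrow> a = b"
  shows "norm (hd p - last p) \<le> 4 / 2 ^ k"
proof (cases "set p \<inter> VG k = {}")
  case True
  have "set (butlast (tl p)) \<subseteq> set p" by (meson in_set_butlastD list.set_sel(2) subsetI assms(3))
  then have "norm (hd p - last p) \<le> 2 / 2 ^ k" using path_short[OF assms(1-3)] True by blast
  also have "\<dots> \<le> 4 / 2 ^ k" by (simp add: divide_right_mono)
  finally show ?thesis .
next
  case False
  then obtain a where a: "a \<in> set p" "a \<in> VG k" by blast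
  then obtain xs ys where p: "p = xs @ a # ys" by (meson split_list)
  have pp: "pe (xs @ [a]) \<subseteq> EG m" "pe (a # ys) \<subseteq> EG m" using assms(1) unfolding p by (subst (asm) pe_glue, simp)+
  have no: "v \<notin> VG k" if "v \<in> set xs \<union> set ys" for v
    using assms(4,5) a that unfolding p by (auto 4 3)
  have "set (butlast (tl (xs @ [a]))) \<subseteq> set xs" by (cases xs) auto
  then have 1: "norm (hd (xs @ [a]) - a) \<le> 2 / 2 ^ k" using path_short[OF pp(1) assms(2)] no by fastforce
  have "set (butlast (tl (a # ys))) \<subseteq> set ys" by (auto dest: in_set_butlastD)
  then have 2: "norm (a - last (a # ys)) \<le> 2 / 2 ^ k" using path_short[OF pp(2) assms(2)] no by fastforce
  have "hd p = hd (xs @ [a])" "last p = last (a # ys)" unfolding p by (cases xs) auto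
  then show ?thesis using norm_triangle_ineq[of "hd (xs @ [a]) - a" "a - last (a # ys)"] 1 2 by simp
qed

text \<open>Turns a lower bound for tree distances between vertices of a coarse level into closeness
  in the plane, as used in \<open>near_X\<close>.\<close>

lemma far_points_cross:
  assumes f: "f \<in> trees m" and k: "k \<le> m" and xy: "x \<in> VG m" "y \<in> VG m" and far: "norm (x - y) > 4 / 2 ^ k"
  shows "\<exists>a\<in>VG k. \<exists>b\<in>VG k. a \<noteq> b \<and> tdist f a b \<le> tdist f x y"
proof -
  have T: "stree (VG m) f" "f \<subseteq> EG m" using f by (auto simp: trees_iff)
  note tp = tree_path_props[OF streeD(1,2)[OF T(1)] streeD(3)[OF T(1) xy]]
  let ?p = "tree_path f x y"
  have "\<not> (\<forall>a b. a \<in> set ?p \<inter> VG k \<longrightarrow> b \<in> set ?p \<inter> VG k \<longrightarrow> a = b)"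
    using path_few_vertices[of ?p m k] tp T far k by force
  then obtain a b where ab: "a \<in> set ?p" "b \<in> set ?p" "a \<in> VG k" "b \<in> VG k" "a \<noteq> b" by blast
  obtain xs ys where 1: "?p = xs @ a # ys" using ab by (meson split_list)
  obtain xs' ys' where 2: "?p = xs' @ b # ys'" using ab by (meson split_list)
  have td: "tdist f x y = length ?p - 1" by (simp add: tdist_def)
  show ?thesis
  proof (cases "length xs \<le> length xs'")
    case True
    have "tdist f a b \<le> tdist f x y" using tdist_on_path[OF T(1) 1 2 xy True] td 2 by simp
    then show ?thesis using ab by blast
  next
    case False
    then have "tdist f b a \<le> tdist f x y" using tdist_on_path[OF T(1) 2 1 xy] td 1 by simp
    then show ?thesis using ab by metis
  qed
qed

section \<open>Enumeration of the forests in a cell at level one\<close>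

text \<open>A subset of \<open>EG 1\<close> is a list of nine Booleans, three for each cell, the \<open>k\<close>-th of them for the edge
  opposite to the \<open>k\<close>-th corner. \<open>bd1\<close> lists the parities of the degrees of \<open>u1\<close>, \<open>u2\<close>, \<open>u3\<close> and of
  the midpoints of the sides opposite to them. \<open>cycs\<close> is the cycle space, so \<open>map (xor b) cycs\<close>
  lists the edge sets with the same boundary as \<open>b\<close>.\<close>

fun bd1 :: "bool list \<Rightarrow> bool list" where
  "bd1 [a1,a2,a3,b1,b2,b3,c1,c2,c3] =
    [a2 \<noteq> a3, b1 \<noteq> b3, c1 \<noteq> c2, (b1 \<noteq> b2) \<noteq> (c1 \<noteq> c3), (a1 \<noteq> a2) \<noteq> (c2 \<noteq> c3), (a1 \<noteq> a3) \<noteq> (b2 \<noteq> b3)]"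
| "bd1 _ = []"

fun bd0 :: "bool list \<Rightarrow> bool list" where
  "bd0 [s1,s2,s3] = [s2 \<noteq> s3, s1 \<noteq> s3, s1 \<noteq> s2, False, False, False]"
| "bd0 _ = []"

fun blists :: "nat \<Rightarrow> bool list list" where
  "blists 0 = [[]]"
| "blists (Suc n) = map ((#) False) (blists n) @ map ((#) True) (blists n)"

fun le :: "bool list \<Rightarrow> bool list \<Rightarrow> bool" where
  "le (x # xs) (y # ys) = ((x \<longrightarrow> y) \<and> le xs ys)"
| "le _ _ = True"

fun xor :: "bool list \<Rightarrow> bool list \<Rightarrow> bool list" where
  "xor (x # xs) (y # ys) = (x \<noteq> y) # xor xs ys"
| "xor _ _ = []"

definition F9 :: "bool list" where
  "F9 = [False,False,False,False,False,False,False,False,False]"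

definition cycs :: "bool list list" where
  "cycs = (let addg = (\<lambda>g L. L @ map (xor g) L) in
    addg [True,True,True,False,False,False,False,False,False]
    (addg [False,False,False,True,True,True,False,False,False]
    (addg [False,False,False,False,False,False,True,True,True]
    (addg [True,False,False,False,True,False,False,False,True] [F9]))))"

definition pick :: "bool list \<Rightarrow> bool list \<Rightarrow> bool list list" where
  "pick b g = filter (\<lambda>p. le p g) (map (xor b) cycs)"

text \<open>The straight path along a side of the triangle, as representative of its boundary;
  likewise \<open>e13\<close> and \<open>e23\<close>.\<close>

definition e12 where "e12 = [False,False,True,False,False,True,False,False,False]"
definition e13 where "e13 = [False,True,False,False,False,False,False,True,False]"
definition e23 where "e23 = [False,False,False,True,False,False,True,False,False]"

text \<open>Boolean form of membership in \<open>Q1\<close>. The inner lists contain, for each of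
  the three midpoints, one path from every corner to this midpoint, again only as representative of
  its boundary.\<close>

definition q1 :: "bool list \<Rightarrow> bool" where
  "q1 g \<longleftrightarrow> list_all (\<lambda>z. z = F9 \<or> \<not> le z g) cycs \<and>
    list_all (\<lambda>bs. list_ex (\<lambda>b. pick b g \<noteq> []) bs)
     [[[False,False,False,True,False,False,False,False,False],
       [False,False,False,False,False,False,True,False,False],
       [False,False,True,False,True,False,False,False,False]],
      [[False,True,False,False,False,False,False,False,False],
       [False,False,False,False,False,False,False,True,False],
       [True,False,False,False,False,True,False,False,False]],
      [[False,False,True,False,False,False,False,False,False],
       [False,False,False,False,False,True,False,False,False],
       [True,False,False,False,False,False,False,True,False]]]"

fun cellof :: "nat \<Rightarrow> bool list \<Rightarrow> bool list" where
  "cellof k [a1,a2,a3,b1,b2,b3,c1,c2,c3] =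
     (case k of 0 \<Rightarrow> [a1,a2,a3] | Suc j \<Rightarrow> (case j of 0 \<Rightarrow> [b1,b2,b3] | Suc _ \<Rightarrow> [c1,c2,c3]))"
| "cellof k _ = []"

definition emp :: "bool list \<Rightarrow> bool" where "emp = list_all Not"

text \<open>For a path between two corners, having no edge in the cell at the third corner
  \<open>k\<close> is the condition in \<open>tree_type\<close>.\<close>

definition avoid :: "nat \<Rightarrow> bool list \<Rightarrow> bool list \<Rightarrow> bool" where
  "avoid k b g \<longleftrightarrow> list_ex (\<lambda>p. emp (cellof k p)) (pick b g)"

definition tys :: "bool list \<Rightarrow> bool list" where
  "tys g = [avoid (Suc (Suc 0)) e12 g \<and> avoid (Suc 0) e13 g,
            avoid (Suc (Suc 0)) e12 g \<and> avoid 0 e23 g,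
            avoid (Suc 0) e13 g \<and> avoid 0 e23 g]"

text \<open>If two pairs of corners are connected, so is the third, and the trace lacks only the
  edge opposite to the corner that gives the type of the tree. Otherwise at most one pair is
  connected, and the trace is its edge.\<close>

definition tr1 :: "bool list \<Rightarrow> bool list" where
  "tr1 g = (let c12 = pick e12 g \<noteq> []; c13 = pick e13 g \<noteq> []; c23 = pick e23 g \<noteq> [] in
     if c12 \<and> c13 then map Not (tys g) else [c23, c13, c12])"

fun cnt :: "bool list \<Rightarrow> nat" where
  "cnt [] = 0" | "cnt (x # xs) = (if x then Suc (cnt xs) else cnt xs)"

text \<open>Type of the crossing \<open>p\<close> of a cell with state \<open>s\<close>: 0 if the cell is not crossed, 1 if \<open>p\<close> is the only
  edge of \<open>s\<close>, 2 if it is one of two edges, 3 if it consists of both.\<close>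

fun ty :: "bool list \<Rightarrow> bool list \<Rightarrow> nat" where
  "ty s p = (if emp p then 0 else if cnt s = Suc 0 then Suc 0 else if cnt p = Suc 0 then Suc (Suc 0) else Suc (Suc (Suc 0)))"

definition tyc :: "bool list \<Rightarrow> bool list \<Rightarrow> nat list" where
  "tyc b g = (case pick b g of [] \<Rightarrow> [] | p # _ \<Rightarrow> map (\<lambda>k. ty (cellof k g) (cellof k p)) [0, Suc 0, Suc (Suc 0)])"

definition L9 :: "bool list list" where
  "L9 = blists (Suc (Suc (Suc (Suc (Suc (Suc (Suc (Suc (Suc 0)))))))))"
definition L3 :: "bool list list" where "L3 = blists (Suc (Suc (Suc 0)))"

definition conn0 :: "bool list \<Rightarrow> bool list" where
  "conn0 s = (case s of [s1,s2,s3] \<Rightarrow> [s1 \<or> (s2 \<and> s3), s2 \<or> (s1 \<and> s3), s3 \<or> (s1 \<and> s2)] | _ \<Rightarrow> [])"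

definition connl :: "bool list \<Rightarrow> bool list" where
  "connl g = [pick e23 g \<noteq> [], pick e13 g \<noteq> [], pick e12 g \<noteq> []]"

definition basel :: "bool list \<Rightarrow> bool list" where
  "basel p = (if bd0 p = bd1 e12 then e12 else if bd0 p = bd1 e13 then e13 else e23)"

definition rows :: "(bool list \<times> bool list) list \<Rightarrow> bool list \<Rightarrow> bool list \<Rightarrow> nat list" where
  "rows Q s b = concat (map (\<lambda>(g, t). if t = s then tyc b g else []) Q)"

text \<open>The facts behind \<open>Tr1_props\<close>, and the uniqueness of the type on which the
  \<open>THE\<close> in \<open>Tr1\<close> relies.\<close>

definition check1 :: "bool list \<times> bool list \<Rightarrow> bool" where
  "check1 = (\<lambda>(g, s). s \<noteq> [True,True,True] \<and> connl g = conn0 s \<and>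
     (connl g = [True,True,True] \<longrightarrow>
       tys g \<in> set [[True,False,False],[False,True,False],[False,False,True]]))"

text \<open>The entries are totals over all forests with trace \<open>s\<close>: the number of these
  forests, then the numbers of crossings of type 1, 2, 3 in the subcells. Division by the first
  entry gives the mean matrix, with characteristic polynomial l (l^2 - 8/3 l + 13/15). Its last two
  columns are in the ratio 2 : 1, as for a uniform spanning tree of a triangle, where the path
  between two given corners has one edge in two of three cases.\<close>

definition check2 :: "(bool list \<times> bool list) list \<Rightarrow> bool" where
  "check2 Q = list_all (\<lambda>s. list_all (\<lambda>p. le p s \<and> \<not> emp p \<and> s \<noteq> [True,True,True] \<longrightarrow>
     (let R = rows Q s (basel p) in
      (length (filter (\<lambda>(g, t). t = s) Q), length (filter (\<lambda>x. x = 1) R), length (filter (\<lambda>x. x = 2) R), length (filter (\<lambda>x. x = 3) R))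
      = (if ty s p = 1 then (30, 30, 24, 12) else if ty s p = 2 then (18, 9, 18, 9) else (18, 18, 24, 12)))) L3) L3"

definition Q1L :: "(bool list \<times> bool list) list" where
  "Q1L = map (\<lambda>g. (g, tr1 g)) (filter q1 L9)"

lemma core1: "list_all check1 Q1L"
  by code_simp

lemma core2: "check2 Q1L"
  by code_simp

text \<open>The graph of level one is connected with nine edges and six vertices, so its cycle space
  has dimension 4; the generators are the triangles of the three cells and the central
  triangle.\<close>

lemma cycs_complete: "list_all (\<lambda>z. bd1 z = [False,False,False,False,False,False] \<longrightarrow> z \<in> set cycs) L9"
  by code_simp

lemma cycs_sound: "list_all (\<lambda>z. length z = length F9 \<and> bd1 z = [False,False,False,False,False,False]) cycs"
  by code_simp

subsection \<open>Lists of Booleans as subsets\<close>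

definition dl :: "'a list \<Rightarrow> bool list \<Rightarrow> 'a set" where
  "dl es bs = set (map fst (filter snd (zip es bs)))"

lemma dl_Nil[simp]: "dl [] bs = {}" "dl es [] = {}" by (simp_all add: dl_def)
lemma dl_Cons[simp]: "dl (e # es) (b # bs) = (if b then insert e (dl es bs) else dl es bs)"
  by (simp add: dl_def)

lemma in_dl_Cons: "v \<in> dl (e # es) (b # bs) \<longleftrightarrow> (b \<and> v = e) \<or> v \<in> dl es bs" by auto

lemma dl_subset_set: "dl es bs \<subseteq> set es" unfolding dl_def by (auto dest: set_zip_leftD)

lemma le_iff_dl: "distinct es \<Longrightarrow> length a = length es \<Longrightarrow> length b = length es \<Longrightarrow> dl es a \<subseteq> dl es b \<longleftrightarrow> le a b"
proof (induction es arbitrary: a b)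
  case (Cons e es)
  obtain x a' where a: "a = x # a'" "length a' = length es" using Cons.prems by (cases a) auto
  obtain y b' where b: "b = y # b'" "length b' = length es" using Cons.prems by (cases b) auto
  have n: "e \<notin> dl es a'" "e \<notin> dl es b'" using dl_subset_set Cons.prems(1) by fastforce+
  have "dl es a' \<subseteq> dl es b' \<longleftrightarrow> le a' b'" using Cons a b by simp
  then show ?case using n a b by auto
qed simp

lemma le_antisym: "le a b \<Longrightarrow> le b a \<Longrightarrow> length a = length b \<Longrightarrow> a = b"
proof (induction a arbitrary: b)
  case (Cons x a) then show ?case by (cases b) auto
qed simp

lemma dl_inj: "distinct es \<Longrightarrow> length a = length es \<Longrightarrow> length b = length es \<Longrightarrow> dl es a = dl es b \<longleftrightarrow> a = b"
  using le_iff_dl[of es a b] le_iff_dl[of es b a] le_antisym[of a b] by auto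

lemma dl_surj: "distinct es \<Longrightarrow> P \<subseteq> set es \<Longrightarrow> \<exists>b. length b = length es \<and> P = dl es b"
proof (induction es arbitrary: P)
  case (Cons e es)
  have "P - {e} \<subseteq> set es" using Cons.prems by auto
  then obtain b where b: "length b = length es" "P - {e} = dl es b" using Cons.IH[of "P - {e}"] Cons.prems(1) by auto
  show ?case using b by (intro exI[of _ "(e \<in> P) # b"]) auto
qed simp

lemma card_dl: "distinct es \<Longrightarrow> length b = length es \<Longrightarrow> card (dl es b) = cnt b"
proof (induction es arbitrary: b)
  case (Cons e es)
  obtain y b' where b: "b = y # b'" "length b' = length es" using Cons.prems by (cases b) auto
  have "e \<notin> dl es b'" using dl_subset_set[of es b'] Cons.prems(1) by auto
  moreover have "finite (dl es b')" by (simp add: dl_def)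
  ultimately show ?case using Cons b by simp
qed simp

lemma emp_dl: "length b = length es \<Longrightarrow> dl es b = {} \<longleftrightarrow> emp b"
proof (induction es arbitrary: b)
  case (Cons e es)
  obtain y b' where b: "b = y # b'" "length b' = length es" using Cons.prems by (cases b) auto
  then show ?case using Cons by (simp add: emp_def)
qed (simp add: emp_def)

lemma bd_dl: "distinct es \<Longrightarrow> length b = length es \<Longrightarrow>
   v \<in> bd (dl es b) \<longleftrightarrow> foldr (\<lambda>(e,b) x. (b \<and> v \<in> e) \<noteq> x) (zip es b) False"
proof (induction es arbitrary: b)
  case (Cons e es)
  obtain y b' where b: "b = y # b'" "length b' = length es" using Cons.prems by (cases b) auto
  have n: "e \<notin> dl es b'" using dl_subset_set[of es b'] Cons.prems(1) by auto
  have f: "finite (dl es b')" by (simp add: dl_def)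
  show ?case using Cons b n f by (auto simp: bd_insert in_sd)
qed simp

lemma set_blists: "set (blists n) = {b. length b = n}"
proof (induction n)
  case (Suc n)
  show ?case
  proof
    show "{b. length b = Suc n} \<subseteq> set (blists (Suc n))"
    proof
      fix b :: "bool list" assume "b \<in> {b. length b = Suc n}"
      then obtain x c where "b = x # c" "length c = n" by (cases b) auto
      then show "b \<in> set (blists (Suc n))" using Suc by (cases x) auto
    qed
  qed (use Suc in auto)
qed simp

lemma distinct_blists: "distinct (blists n)"
  by (induction n) (auto simp: distinct_map)

lemma L9: "set L9 = {b. length b = 9}" "distinct L9"
  unfolding L9_def set_blists by (simp add: numeral_eq_Suc, rule distinct_blists)
lemma L3: "set L3 = {b. length b = 3}"
  unfolding L3_def set_blists by (simp add: numeral_eq_Suc)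

lemma len9: "length p = 9 \<Longrightarrow> \<exists>a1 a2 a3 b1 b2 b3 c1 c2 c3. p = [a1,a2,a3,b1,b2,b3,c1,c2,c3]"
  by (simp add: numeral_eq_Suc length_Suc_conv) blast

lemma len3: "length p = 3 \<Longrightarrow> \<exists>a1 a2 a3. p = [a1,a2,a3]"
  by (simp add: numeral_eq_Suc length_Suc_conv) blast

lemma xor_length: "length p = length q \<Longrightarrow> length (xor p q) = length q"
  by (induction p q rule: xor.induct) auto

lemma xor_xor: "length p = length q \<Longrightarrow> xor p (xor p q) = q"
  by (induction p q rule: xor.induct) auto

lemma bd1_xor: assumes "length p = 9" "length q = 9" shows "bd1 (xor p q) = xor (bd1 p) (bd1 q)"
proof -
  obtain a1 a2 a3 b1 b2 b3 c1 c2 c3 where p: "p = [a1,a2,a3,b1,b2,b3,c1,c2,c3]" using len9[OF assms(1)] by blast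
  obtain d1 d2 d3 e1 e2 e3 f1 f2 f3 where q: "q = [d1,d2,d3,e1,e2,e3,f1,f2,f3]" using len9[OF assms(2)] by blast
  show ?thesis unfolding p q bd1.simps xor.simps list.inject by (intro conjI refl; blast)
qed

lemma set_cycs: "z \<in> set cycs \<longleftrightarrow> length z = 9 \<and> bd1 z = [False,False,False,False,False,False]"
proof
  assume "z \<in> set cycs"
  then show "length z = 9 \<and> bd1 z = [False,False,False,False,False,False]"
    using cycs_sound by (simp add: list_all_iff F9_def)
next
  assume "length z = 9 \<and> bd1 z = [False,False,False,False,False,False]"
  then show "z \<in> set cycs" using cycs_complete L9(1) by (simp add: list_all_iff)
qed

lemma set_pick:
  assumes "length b = 9" "length g = 9"
  shows "p \<in> set (pick b g) \<longleftrightarrow> length p = 9 \<and> le p g \<and> bd1 p = bd1 b"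
proof -
  have x: "xor (bd1 b) (bd1 p) = [False,False,False,False,False,False] \<longleftrightarrow> bd1 p = bd1 b" if p9: "length p = 9"
  proof -
    obtain a1 a2 a3 b1 b2 b3 c1 c2 c3 where p: "p = [a1,a2,a3,b1,b2,b3,c1,c2,c3]" using len9[OF p9] by blast
    obtain d1 d2 d3 e1 e2 e3 f1 f2 f3 where q: "b = [d1,d2,d3,e1,e2,e3,f1,f2,f3]" using len9[OF assms(1)] by blast
    show ?thesis unfolding p q bd1.simps xor.simps list.inject by (intro arg_cong2[where f="(\<and>)"]; blast)
  qed
  have "p \<in> set (map (xor b) cycs) \<longleftrightarrow> length p = 9 \<and> bd1 p = bd1 b"
  proof
    assume "p \<in> set (map (xor b) cycs)"
    then obtain z where z: "z \<in> set cycs" "p = xor b z" by auto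
    then have "length p = 9" using xor_length[of b z] assms set_cycs by simp
    moreover have "xor b p = z" using z xor_xor[of b z] assms set_cycs by simp
    ultimately show "length p = 9 \<and> bd1 p = bd1 b"
      using x bd1_xor[OF assms(1), of p] z set_cycs by simp
  next
    assume p: "length p = 9 \<and> bd1 p = bd1 b"
    then have "xor b p \<in> set cycs"
      using set_cycs[of "xor b p"] xor_length[of b p] bd1_xor[of b p] x assms by simp
    then show "p \<in> set (map (xor b) cycs)" using xor_xor[of b p] p assms by (force simp: image_iff)
  qed
  then show ?thesis unfolding pick_def by auto
qed

subsection \<open>The graph at level one\<close>

definition "m12 = psi 1 u2"
definition "m13 = psi 1 u3"
definition "m23 = psi 2 u3"

definition "vl = [u1, u2, u3, m23, m13, m12]"
definition "el0 = [{u2,u3},{u1,u3},{u1,u2}]"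
definition "el1 = [{m12,m13},{u1,m13},{u1,m12},{u2,m23},{m12,m23},{m12,u2},{m23,u3},{m13,u3},{m13,m23}]"

lemma psi_u: "psi 1 u1 = u1" "psi 1 u2 = m12" "psi 1 u3 = m13"
  "psi 2 u1 = m12" "psi 2 u2 = u2" "psi 2 u3 = m23"
  "psi 3 u1 = m13" "psi 3 u2 = m23" "psi 3 u3 = u3"
  by (simp_all add: psi_def m12_def m13_def m23_def u_def field_simps)

lemma psi_u_Suc: "psi (Suc 0) u1 = u1" "psi (Suc 0) u2 = m12" "psi (Suc 0) u3 = m13"
  using psi_u by simp_all

lemma distinct_vl: "distinct vl"
proof -
  have e: "u1 = Complex 0 0" "u2 = Complex 1 0" "m12 = Complex (1/2) 0" "m13 = Complex (1/4) (sqrt 3 / 4)"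
    "m23 = Complex (3/4) (sqrt 3 / 4)"
    by (simp_all add: complex_eq_iff m12_def m13_def m23_def psi_def u_def u1_def u2_def u3_def field_simps)
  show ?thesis unfolding vl_def u3_def e by simp
qed

lemma v_neq: "u1 \<noteq> u2" "u1 \<noteq> u3" "u1 \<noteq> m23" "u1 \<noteq> m13" "u1 \<noteq> m12"
  "u2 \<noteq> u3" "u2 \<noteq> m23" "u2 \<noteq> m13" "u2 \<noteq> m12" "u3 \<noteq> m23" "u3 \<noteq> m13" "u3 \<noteq> m12"
  "m23 \<noteq> m13" "m23 \<noteq> m12" "m13 \<noteq> m12"
  using distinct_vl by (auto simp: vl_def)

lemmas v_neqs = v_neq v_neq[symmetric]

lemma EG0_el0: "EG 0 = set el0" by (auto simp: el0_def insert_commute)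

lemma EG1_el1: "EG 1 = set el1"
proof -
  have "EG 1 = (\<Union>i\<in>{1,2,3}. image (psi i) ` EG 0)" by (simp only: One_nat_def EG.simps(2))
  also have "\<dots> = image (psi 1) ` set el0 \<union> (image (psi 2) ` set el0 \<union> image (psi 3) ` set el0)"
    by (simp only: UN_insert UN_empty EG0_el0 Un_empty_right)
  finally show ?thesis
    by (simp only: el0_def el1_def list.set image_insert image_empty psi_u Un_insert_left Un_empty_left)
qed

lemma VG1_vl: "VG 1 = set vl"
  by (simp only: One_nat_def VG.simps vl_def) (auto simp: psi_u psi_u_Suc)

lemma distinct_el0: "distinct el0" by (simp add: el0_def doubleton_eq_iff v_neqs)
lemma distinct_el1: "distinct el1" by (simp add: el1_def doubleton_eq_iff v_neqs)
lemma lens: "length el0 = 3" "length el1 = 9" "length vl = 6" by (simp_all add: el0_def el1_def vl_def)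

lemma bd_el1: assumes "length p = 9" shows "bd (dl el1 p) = dl vl (bd1 p)"
proof (rule set_eqI)
  fix v
  obtain a1 a2 a3 b1 b2 b3 c1 c2 c3 where p: "p = [a1,a2,a3,b1,b2,b3,c1,c2,c3]" using len9[OF assms] by blast
  have 1: "v \<in> bd (dl el1 p) \<longleftrightarrow> foldr (\<lambda>(e,b) x. (b \<and> v \<in> e) \<noteq> x) (zip el1 p) False"
    using bd_dl[OF distinct_el1] assms lens by simp
  consider "v = u1" | "v = u2" | "v = u3" | "v = m23" | "v = m13" | "v = m12" | "v \<notin> set vl" by (auto simp: vl_def)
  then show "v \<in> bd (dl el1 p) \<longleftrightarrow> v \<in> dl vl (bd1 p)"
  proof cases
    case 7
    have "v \<notin> dl vl (bd1 p)" using 7 subsetD[OF dl_subset_set, of v vl "bd1 p"] by blast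
    moreover have "v \<notin> bd (dl el1 p)"
      using 7 bd_sub[of "dl el1 p" 1] dl_subset_set[of el1 p] EG1_el1 VG1_vl by auto
    ultimately show ?thesis by simp
  qed (unfold 1, simp add: p el1_def vl_def v_neqs in_dl_Cons del: dl_Cons; blast)+
qed

lemma bd_el0: assumes "length p = 3" shows "bd (dl el0 p) = dl vl (bd0 p)"
proof (rule set_eqI)
  fix v
  obtain s1 s2 s3 where p: "p = [s1,s2,s3]" using len3[OF assms] by blast
  have 1: "v \<in> bd (dl el0 p) \<longleftrightarrow> foldr (\<lambda>(e,b) x. (b \<and> v \<in> e) \<noteq> x) (zip el0 p) False"
    using bd_dl[OF distinct_el0] assms lens by simp
  consider "v = u1" | "v = u2" | "v = u3" | "v \<notin> {u1,u2,u3}" by auto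
  then show "v \<in> bd (dl el0 p) \<longleftrightarrow> v \<in> dl vl (bd0 p)"
  proof cases
    case 4
    have "v \<notin> dl vl (bd0 p)" using 4 by (simp add: p vl_def)
    moreover have "v \<notin> bd (dl el0 p)"
      using 4 bd_sub[of "dl el0 p" 0] dl_subset_set[of el0 p] EG0_el0 by auto
    ultimately show ?thesis by simp
  qed (unfold 1, simp add: p el0_def vl_def v_neqs in_dl_Cons del: dl_Cons; blast)+
qed

lemma len_bd1: assumes "length p = 9" shows "length (bd1 p) = 6"
proof -
  obtain a1 a2 a3 b1 b2 b3 c1 c2 c3 where p: "p = [a1,a2,a3,b1,b2,b3,c1,c2,c3]" using len9[OF assms] by blast
  show ?thesis by (simp add: p)
qed

declare EG.simps [simp del] VG.simps [simp del]

text \<open>Forests in which every component contains a corner: the union of the spanning trees and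
  of the forests with two or three components separating corners, in a form that restrictions of
  trees satisfy directly.\<close>

definition Q1 :: "complex set set set" where
  "Q1 = {g. g \<subseteq> EG 1 \<and> acyc g \<and> (\<forall>v\<in>VG 1. \<exists>i\<in>{1,2,3}. conn g v (u i))}"

lemma Q1D: assumes "g \<in> Q1" shows "g \<subseteq> EG 1" "edges2 g" "acyc g"
  "v \<in> VG 1 \<Longrightarrow> \<exists>i\<in>{1,2,3}. conn g v (u i)"
  using assms edges2_EG by (auto simp: Q1_def)

lemma u_simps: "u 1 = u1" "u (Suc 0) = u1" "u 2 = u2" "u 3 = u3" by (simp_all add: u_def)

definition bpath :: "'a set set \<Rightarrow> 'a set \<Rightarrow> 'a set set" where
  "bpath g D = (THE P. P \<subseteq> g \<and> bd P = D)"

lemma bpath_eq: "edges2 g \<Longrightarrow> acyc g \<Longrightarrow> P \<subseteq> g \<Longrightarrow> bd P = D \<Longrightarrow> bpath g D = P"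
  unfolding bpath_def using acyc_unique[of g _ P] by (intro the_equality) blast+

lemma sub_el1: "P \<subseteq> EG 1 \<Longrightarrow> \<exists>p. length p = 9 \<and> P = dl el1 p"
  using dl_surj[OF distinct_el1, of P] EG1_el1 lens by simp

lemma sub_el0: "P \<subseteq> EG 0 \<Longrightarrow> \<exists>p. length p = 3 \<and> P = dl el0 p"
  using dl_surj[OF distinct_el0, of P] EG0_el0 lens by simp

lemma dl_el1_sub: "dl el1 p \<subseteq> EG 1" unfolding EG1_el1 by (rule dl_subset_set)
lemma dl_el0_sub: "dl el0 p \<subseteq> EG 0" unfolding EG0_el0 by (rule dl_subset_set)

lemma pick_paths:
  assumes "length b = 9" "length g = 9" "bd1 b = D"
  shows "P \<subseteq> dl el1 g \<and> bd P = dl vl D \<longleftrightarrow> (\<exists>p\<in>set (pick b g). P = dl el1 p)"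
proof
  assume P: "P \<subseteq> dl el1 g \<and> bd P = dl vl D"
  then obtain p where p: "length p = 9" "P = dl el1 p" using sub_el1[of P] dl_el1_sub[of g] by auto
  have "le p g" using P p assms le_iff_dl[OF distinct_el1] lens by simp
  moreover have "bd1 p = bd1 b"
    using P p assms bd_el1[OF p(1)] dl_inj[OF distinct_vl, of "bd1 p" D] lens len_bd1[OF p(1)] len_bd1[OF assms(1)]
    by simp
  ultimately show "\<exists>p\<in>set (pick b g). P = dl el1 p" using p set_pick[OF assms(1,2)] by blast
next
  assume "\<exists>p\<in>set (pick b g). P = dl el1 p"
  then obtain p where p: "p \<in> set (pick b g)" "P = dl el1 p" by blast
  then have q: "length p = 9" "le p g" "bd1 p = bd1 b" using set_pick[OF assms(1,2)] by auto
  then show "P \<subseteq> dl el1 g \<and> bd P = dl vl D"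
    using p assms le_iff_dl[OF distinct_el1, of p g] bd_el1[OF q(1)] lens by simp
qed

lemma conn_pick:
  assumes "length b = 9" "length g = 9" "dl vl (bd1 b) = {x,y}" "x \<noteq> y"
  shows "conn (dl el1 g) x y \<longleftrightarrow> pick b g \<noteq> []"
proof -
  have "conn (dl el1 g) x y \<longleftrightarrow> (\<exists>P. P \<subseteq> dl el1 g \<and> bd P = dl vl (bd1 b))"
    unfolding conn_def using assms(3,4) by (simp add: sd_pair)
  also have "\<dots> \<longleftrightarrow> pick b g \<noteq> []"
    using pick_paths[OF assms(1,2) refl] by (metis ex_in_conv set_empty)
  finally show ?thesis .
qed

lemma e_props: "length e12 = 9" "length e13 = 9" "length e23 = 9"
  "bd1 e12 = [True,True,False,False,False,False]" "bd1 e13 = [True,False,True,False,False,False]"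
  "bd1 e23 = [False,True,True,False,False,False]"
  by (simp_all add: e12_def e13_def e23_def)

lemma connl: assumes "length g = 9"
  shows "connl g = [conn (dl el1 g) u2 u3, conn (dl el1 g) u1 u3, conn (dl el1 g) u1 u2]"
proof -
  have "conn (dl el1 g) u2 u3 \<longleftrightarrow> pick e23 g \<noteq> []" "conn (dl el1 g) u1 u3 \<longleftrightarrow> pick e13 g \<noteq> []"
    "conn (dl el1 g) u1 u2 \<longleftrightarrow> pick e12 g \<noteq> []"
    using v_neq by (intro conn_pick assms e_props; simp add: e_props vl_def)+
  then show ?thesis by (simp add: connl_def)
qed

lemma Q1_q1: assumes g: "length g = 9" shows "dl el1 g \<in> Q1 \<longleftrightarrow> q1 g"
proof -
  have F9: "length F9 = 9" "dl el1 F9 = {}" by (simp_all add: F9_def el1_def)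
  have a: "acyc (dl el1 g) \<longleftrightarrow> list_all (\<lambda>z. z = F9 \<or> \<not> le z g) cycs"
  proof
    assume a: "acyc (dl el1 g)"
    show "list_all (\<lambda>z. z = F9 \<or> \<not> le z g) cycs" unfolding list_all_iff
    proof
      fix z assume "z \<in> set cycs"
      then have z: "length z = 9" "bd1 z = [False,False,False,False,False,False]" using set_cycs by auto
      show "z = F9 \<or> \<not> le z g"
      proof (rule disjCI)
        assume "\<not> \<not> le z g"
        then have "dl el1 z \<subseteq> dl el1 g" using le_iff_dl[OF distinct_el1, of z g] z g lens by simp
        moreover have "bd (dl el1 z) = {}" using bd_el1[OF z(1)] z(2) by (simp add: vl_def)
        ultimately have "dl el1 z = dl el1 F9" using a F9 unfolding acyc_def by blast
        then show "z = F9" using dl_inj[OF distinct_el1, of z F9] z F9 lens by simp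
      qed
    qed
  next
    assume l: "list_all (\<lambda>z. z = F9 \<or> \<not> le z g) cycs"
    show "acyc (dl el1 g)" unfolding acyc_def
    proof (intro allI impI)
      fix P assume P: "P \<subseteq> dl el1 g" "bd P = {}"
      then obtain p where p: "length p = 9" "P = dl el1 p" using sub_el1[of P] dl_el1_sub[of g] by auto
      have "dl vl (bd1 p) = dl vl [False,False,False,False,False,False]"
        using bd_el1[OF p(1)] P p by (simp add: vl_def)
      then have "bd1 p = [False,False,False,False,False,False]"
        using dl_inj[OF distinct_vl, of "bd1 p"] len_bd1[OF p(1)] lens by simp
      then have "p \<in> set cycs" using set_cycs p by simp
      moreover have "le p g" using P p g le_iff_dl[OF distinct_el1, of p g] lens by simp
      ultimately show "P = {}" using l F9 p unfolding list_all_iff by auto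
    qed
  qed
  have c: "list_all (\<lambda>bs. list_ex (\<lambda>b. pick b g \<noteq> []) bs)
     [[[False,False,False,True,False,False,False,False,False],
       [False,False,False,False,False,False,True,False,False],
       [False,False,True,False,True,False,False,False,False]],
      [[False,True,False,False,False,False,False,False,False],
       [False,False,False,False,False,False,False,True,False],
       [True,False,False,False,False,True,False,False,False]],
      [[False,False,True,False,False,False,False,False,False],
       [False,False,False,False,False,True,False,False,False],
       [True,False,False,False,False,False,False,True,False]]] \<longleftrightarrow>
     (conn (dl el1 g) u2 m23 \<or> conn (dl el1 g) u3 m23 \<or> conn (dl el1 g) u1 m23) \<and>
     (conn (dl el1 g) u1 m13 \<or> conn (dl el1 g) u3 m13 \<or> conn (dl el1 g) u2 m13) \<and>
     (conn (dl el1 g) u1 m12 \<or> conn (dl el1 g) u2 m12 \<or> conn (dl el1 g) u3 m12)"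
  proof -
    have "pick [False,False,False,True,False,False,False,False,False] g \<noteq> [] \<longleftrightarrow> conn (dl el1 g) u2 m23"
      "pick [False,False,False,False,False,False,True,False,False] g \<noteq> [] \<longleftrightarrow> conn (dl el1 g) u3 m23"
      "pick [False,False,True,False,True,False,False,False,False] g \<noteq> [] \<longleftrightarrow> conn (dl el1 g) u1 m23"
      "pick [False,True,False,False,False,False,False,False,False] g \<noteq> [] \<longleftrightarrow> conn (dl el1 g) u1 m13"
      "pick [False,False,False,False,False,False,False,True,False] g \<noteq> [] \<longleftrightarrow> conn (dl el1 g) u3 m13"
      "pick [True,False,False,False,False,True,False,False,False] g \<noteq> [] \<longleftrightarrow> conn (dl el1 g) u2 m13"
      "pick [False,False,True,False,False,False,False,False,False] g \<noteq> [] \<longleftrightarrow> conn (dl el1 g) u1 m12"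
      "pick [False,False,False,False,False,True,False,False,False] g \<noteq> [] \<longleftrightarrow> conn (dl el1 g) u2 m12"
      "pick [True,False,False,False,False,False,False,True,False] g \<noteq> [] \<longleftrightarrow> conn (dl el1 g) u3 m12"
      by (rule conn_pick[OF _ g, symmetric]; simp add: vl_def v_neq)+
    then show ?thesis by simp
  qed
  have s: "conn (dl el1 g) a b = conn (dl el1 g) b a" for a b using conn_sym[of "dl el1 g"] by metis
  have v: "(\<forall>v\<in>VG 1. \<exists>i\<in>{1,2,3}. conn (dl el1 g) v (u i)) \<longleftrightarrow>
     (conn (dl el1 g) u2 m23 \<or> conn (dl el1 g) u3 m23 \<or> conn (dl el1 g) u1 m23) \<and>
     (conn (dl el1 g) u1 m13 \<or> conn (dl el1 g) u3 m13 \<or> conn (dl el1 g) u2 m13) \<and>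
     (conn (dl el1 g) u1 m12 \<or> conn (dl el1 g) u2 m12 \<or> conn (dl el1 g) u3 m12)"
    unfolding VG1_vl vl_def by (simp add: u_simps conn_refl s[of m12] s[of m13] s[of m23] del: One_nat_def) metis
  show ?thesis unfolding q1_def c v[symmetric] a[symmetric] Q1_def using dl_el1_sub by simp
qed

lemma Q1L_mem: "(g, s) \<in> set Q1L \<longleftrightarrow> length g = 9 \<and> dl el1 g \<in> Q1 \<and> s = tr1 g"
  unfolding Q1L_def using L9(1) Q1_q1 by auto

lemma chk1: assumes "length g = 9" "dl el1 g \<in> Q1"
  shows "tr1 g \<noteq> [True,True,True]" "connl g = conn0 (tr1 g)"
    "connl g = [True,True,True] \<Longrightarrow> tys g \<in> {[True,False,False],[False,True,False],[False,False,True]}"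
  using core1 Q1L_mem[of g "tr1 g"] assms unfolding list_all_iff check1_def by auto

lemma cells_dl:
  "image (psi 1) ` EG 0 \<union> image (psi 2) ` EG 0 = dl el1 [True,True,True,True,True,True,False,False,False]"
  "image (psi 1) ` EG 0 \<union> image (psi 3) ` EG 0 = dl el1 [True,True,True,False,False,False,True,True,True]"
  "image (psi 2) ` EG 0 \<union> image (psi 3) ` EG 0 = dl el1 [False,False,False,True,True,True,True,True,True]"
  unfolding EG0_el0 el0_def el1_def list.set image_insert image_empty psi_u dl_Cons dl_Nil if_True if_False
    Un_insert_left Un_empty_left by (rule refl)+

text \<open>Here \<open>c\<close> lists the edges outside cell \<open>k\<close>, so that staying in
  \<open>dl el1 c\<close> and having no edge in cell \<open>k\<close> are the same.\<close>

lemma avoid_reach: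
  assumes g: "length g = 9" and b: "length b = 9" "dl vl (bd1 b) = {x,y}" "x \<noteq> y"
    and k: "length c = 9" "\<And>p. length p = 9 \<Longrightarrow> le p c \<longleftrightarrow> emp (cellof k p)"
  shows "reach (dl el1 g \<inter> dl el1 c) x y \<longleftrightarrow> avoid k b g"
proof -
  have e: "edges2 (dl el1 g \<inter> dl el1 c)" using edges2_EG dl_el1_sub by (metis inf.coboundedI1)
  have "reach (dl el1 g \<inter> dl el1 c) x y \<longleftrightarrow> (\<exists>P. P \<subseteq> dl el1 g \<and> bd P = dl vl (bd1 b) \<and> P \<subseteq> dl el1 c)"
    unfolding conn_iff_reach[OF e, symmetric] conn_def using b by (auto simp: sd_pair)
  also have "\<dots> \<longleftrightarrow> (\<exists>p\<in>set (pick b g). dl el1 p \<subseteq> dl el1 c)"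
    using pick_paths[OF b(1) g refl] by metis
  also have "\<dots> \<longleftrightarrow> (\<exists>p\<in>set (pick b g). emp (cellof k p))"
    using set_pick[OF b(1) g] k le_iff_dl[OF distinct_el1, of _ c] lens by auto
  finally show ?thesis by (simp add: avoid_def list_ex_iff)
qed

lemma tree_type_tys:
  assumes g: "length g = 9"
  shows "tree_type (dl el1 g) i \<longleftrightarrow> i \<in> {1,2,3} \<and> tys g ! (i - 1)"
proof -
  have e: "le p c = emp (cellof k p)" if "length p = 9"
     "(k, c) \<in> {(2, [True,True,True,True,True,True,False,False,False]),
       (1, [True,True,True,False,False,False,True,True,True]),
       (0, [False,False,False,True,True,True,True,True,True])}" for p k c
    using len9[OF that(1)] that(2) by (auto simp: emp_def numeral_2_eq_2)
  have s: "reach E a b = reach E b a" for E :: "complex set set" and a b using reach_sym by blast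
  have a12: "reach (dl el1 g \<inter> (image (psi 1) ` EG 0 \<union> image (psi 2) ` EG 0)) u1 u2 \<longleftrightarrow> avoid (Suc (Suc 0)) e12 g"
    unfolding cells_dl by (rule avoid_reach[OF g e_props(1)])
      (use e[of _ 2] v_neq in \<open>simp_all add: e_props vl_def numeral_2_eq_2\<close>)
  have a13: "reach (dl el1 g \<inter> (image (psi 1) ` EG 0 \<union> image (psi 3) ` EG 0)) u1 u3 \<longleftrightarrow> avoid (Suc 0) e13 g"
    unfolding cells_dl by (rule avoid_reach[OF g e_props(2)])
      (use e[of _ 1] v_neq in \<open>simp_all add: e_props vl_def\<close>)
  have a23: "reach (dl el1 g \<inter> (image (psi 2) ` EG 0 \<union> image (psi 3) ` EG 0)) u2 u3 \<longleftrightarrow> avoid 0 e23 g"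
    unfolding cells_dl by (rule avoid_reach[OF g e_props(3)])
      (use e[of _ 0] v_neq in \<open>simp_all add: e_props vl_def\<close>)
  note a21 = a12[unfolded Un_commute[of "image (psi 1) ` EG 0"] s[of _ u1]]
  note a31 = a13[unfolded Un_commute[of "image (psi 1) ` EG 0"] s[of _ u1]]
  note a32 = a23[unfolded Un_commute[of "image (psi 2) ` EG 0"] s[of _ u2]]
  have d: "{1,2,3} - {1::nat} = {2,3}" "{1,2,3} - {2::nat} = {1,3}" "{1,2,3} - {3::nat} = {1,2}" by auto
  have "tree_type (dl el1 g) 1 \<longleftrightarrow> tys g ! 0"
    unfolding tree_type_def d by (simp add: u_simps a12[simplified] a13[simplified] tys_def)
  moreover have "tree_type (dl el1 g) 2 \<longleftrightarrow> tys g ! 1"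
    unfolding tree_type_def d by (simp add: u_simps a21[simplified] a23[simplified] tys_def)
  moreover have "tree_type (dl el1 g) 3 \<longleftrightarrow> tys g ! 2"
    unfolding tree_type_def d by (simp add: u_simps a31[simplified] a32[simplified] tys_def)
  moreover have "i \<in> {1,2,3}" if "tree_type (dl el1 g) i" using that by (simp add: tree_type_def)
  ultimately show ?thesis by auto
qed

section \<open>The trace at level one\<close>

lemma spanning_tree_Q1:
  assumes "g \<in> Q1"
  shows "is_spanning_tree 1 g \<longleftrightarrow> conn g u1 u2 \<and> conn g u1 u3"
proof
  assume "is_spanning_tree 1 g"
  then have "g \<in> trees 1" by (simp add: trees_def)
  then have "stree (VG 1) g" by (simp add: trees_iff)
  moreover have "u1 \<in> VG 1" "u2 \<in> VG 1" "u3 \<in> VG 1" using VG1_vl by (auto simp: vl_def)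
  ultimately show "conn g u1 u2 \<and> conn g u1 u3" using streeD(3) by metis
next
  assume c: "conn g u1 u2 \<and> conn g u1 u3"
  note Q = Q1D[OF assms]
  have 1: "conn g v u1" if v: "v \<in> VG 1" for v
  proof -
    obtain i where i: "i \<in> {1,2,3}" "conn g v (u i)" using Q(4)[OF v] by blast
    have "conn g (u i) u1" using i(1) c conn_sym[of g] conn_refl[of g u1] by (auto simp: u_simps)
    then show ?thesis using conn_trans[OF Q(2) i(2)] by blast
  qed
  have "stree (VG 1) g" unfolding stree_def
    using Q(1-3) 1 conn_trans[OF Q(2)] conn_sym[of g] EG_sub_VG by (meson UnionE subset_iff)
  then show "is_spanning_tree 1 g" using trees_iff[of g 1] Q(1) by (simp add: trees_def)
qed

text \<open>Each component contains a corner, so the components are described by the connections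
  among the corners.\<close>

lemma in_S_Q1:
  assumes Q: "g \<in> Q1" and ijk: "{i,j,k} = {1,2,3}"
  shows "in_S 1 i g \<longleftrightarrow> conn g (u j) (u k) \<and> \<not> conn g (u i) (u j)"
proof -
  note q = Q1D[OF Q]
  have ne: "i \<noteq> j" "i \<noteq> k" "j \<noteq> k" using arg_cong[OF ijk, of card] by (auto simp: card_insert_if split: if_splits)
  have D: "{u j' | j'. j' \<in> {1,2,3} - {i}} = {u j, u k}" using ijk[symmetric] ne by auto
  have cr: "conn g a b \<longleftrightarrow> reach g a b" for a b by (rule conn_iff_reach[OF q(2)])
  define cl where "cl = (\<lambda>a. {b \<in> VG 1. conn g a b})"
  have cm: "comps 1 g = cl ` VG 1" by (auto simp: comps_def cl_def cr)
  have uV: "u l \<in> VG 1" for l using VG1_vl by (auto simp: vl_def u_def)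
  have cl_eq: "cl a = cl b" if "conn g a b" for a b
    unfolding cl_def using that conn_trans[OF q(2)] conn_sym[of g] by blast
  have fo: "forest g" using q(3) forest_iff_acyc[OF q(2)] by simp
  show ?thesis
  proof
    assume "in_S 1 i g"
    then obtain C E where CE: "comps 1 g = {C, E}" "C \<noteq> E" "u i \<in> C" "u j \<in> E" "u k \<in> E"
      unfolding in_S_def D by blast
    obtain c where c: "C = cl c" using CE(1) cm by blast
    obtain e where e: "E = cl e" using CE(1) cm by blast
    have "conn g e (u j)" "conn g e (u k)" "conn g c (u i)" using CE c e by (auto simp: cl_def)
    then have "conn g (u j) (u k)" "conn g (u i) (u j) \<Longrightarrow> C = E"
      using conn_trans[OF q(2)] conn_sym[of g] cl_eq c e by (metis, metis)
    then show "conn g (u j) (u k) \<and> \<not> conn g (u i) (u j)" using CE by blast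
  next
    assume c: "conn g (u j) (u k) \<and> \<not> conn g (u i) (u j)"
    have "cl v = cl (u i) \<or> cl v = cl (u j)" if v: "v \<in> VG 1" for v
    proof -
      obtain l where "l \<in> {1,2,3}" "conn g v (u l)" using q(4)[OF v] by blast
      then have "cl v = cl (u l)" "l \<in> {i,j,k}" using cl_eq ijk by auto
      then show ?thesis using cl_eq[of "u j" "u k"] c by auto
    qed
    then have "comps 1 g = {cl (u i), cl (u j)}" unfolding cm using uV by blast
    moreover have "u i \<in> cl (u i)" "u j \<in> cl (u j)" "u k \<in> cl (u j)" "u j \<notin> cl (u i)"
      using c uV conn_refl by (auto simp: cl_def)
    ultimately show "in_S 1 i g" unfolding in_S_def D using q(1) fo by (metis empty_subsetI insert_subset)
  qed
qed

text \<open>Transfers the enumeration to \<open>Tr1\<close>. The case in its definition is decided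
  by the connections among the corners, and for a spanning tree \<open>check1\<close> provides
  exactly one type.\<close>

lemma Tr1_dl:
  assumes g: "length g = 9" "dl el1 g \<in> Q1"
  shows "Tr1 (dl el1 g) = dl el0 (tr1 g)"
proof -
  let ?g = "dl el1 g"
  note q = Q1D[OF g(2)]
  have S: "in_S 1 1 ?g \<longleftrightarrow> conn ?g u2 u3 \<and> \<not> conn ?g u1 u2" "in_S 1 2 ?g \<longleftrightarrow> conn ?g u1 u3 \<and> \<not> conn ?g u1 u2"
    "in_S 1 3 ?g \<longleftrightarrow> conn ?g u1 u2 \<and> \<not> conn ?g u1 u3"
    using in_S_Q1[OF g(2), of 1 2 3] in_S_Q1[OF g(2), of 2 1 3] in_S_Q1[OF g(2), of 3 1 2] conn_sym[of ?g]
    by (auto simp: u_simps insert_commute)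
  have cl: "connl g = [conn ?g u2 u3, conn ?g u1 u3, conn ?g u1 u2]" by (rule connl[OF g(1)])
  have tr: "tr1 g = (if conn ?g u1 u2 \<and> conn ?g u1 u3 then map Not (tys g) else connl g)"
    using cl by (simp add: tr1_def connl_def Let_def)
  have t: "conn ?g u1 u2 \<Longrightarrow> conn ?g u1 u3 \<Longrightarrow> conn ?g u2 u3" "conn ?g u1 u2 \<Longrightarrow> conn ?g u2 u3 \<Longrightarrow> conn ?g u1 u3"
    "conn ?g u1 u3 \<Longrightarrow> conn ?g u2 u3 \<Longrightarrow> conn ?g u1 u2"
    using conn_trans[OF q(2)] conn_sym[of ?g] by metis+
  show ?thesis
  proof (cases "conn ?g u1 u2 \<and> conn ?g u1 u3")
    case True
    then have st: "is_spanning_tree 1 ?g" using spanning_tree_Q1[OF g(2)] by simp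
    have ty: "tys g \<in> {[True,False,False],[False,True,False],[False,False,True]}"
      using chk1(3)[OF g] cl t True by simp
    have R: "Tr1 ?g = {{u i, u j} | j. j \<in> {1,2,3} - {i}}" if "tree_type ?g i" "\<And>k. tree_type ?g k \<Longrightarrow> k = i" for i
      using st the_equality[of "tree_type ?g" i, OF that] by (simp add: Tr1_def Let_def)
    have sets: "{{u 1, u j} | j. j \<in> {1,2,3} - {1}} = {{u1,u2},{u1,u3}}"
      "{{u 2, u j} | j. j \<in> {1,2,3} - {2}} = {{u1,u2},{u2,u3}}"
      "{{u 3, u j} | j. j \<in> {1,2,3} - {3}} = {{u1,u3},{u2,u3}}"
    proof -
      have d: "{1,2,3} - {1::nat} = {2,3}" "{1,2,3} - {2::nat} = {1,3}" "{1,2,3} - {3::nat} = {1,2}" by auto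
      have i: "{{a, u j} | j. j \<in> {k,l}} = {{a, u k}, {a, u l}}" for a k l by blast
      show "{{u 1, u j} | j. j \<in> {1,2,3} - {1}} = {{u1,u2},{u1,u3}}"
        unfolding d i u_simps ..
      show "{{u 2, u j} | j. j \<in> {1,2,3} - {2}} = {{u1,u2},{u2,u3}}"
        unfolding d i u_simps by (simp only: insert_commute)
      show "{{u 3, u j} | j. j \<in> {1,2,3} - {3}} = {{u1,u3},{u2,u3}}"
        unfolding d i u_simps by (simp only: insert_commute)
    qed
    from ty consider "tys g = [True,False,False]" | "tys g = [False,True,False]" | "tys g = [False,False,True]" by auto
    then show ?thesis
    proof cases
      case 1
      have "Tr1 ?g = {{u1,u2},{u1,u3}}"
        by (subst sets(1)[symmetric], rule R) (auto simp: tree_type_tys[OF g(1)] 1)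
      then show ?thesis using True 1 tr by (auto simp: el0_def)
    next
      case 2
      have "Tr1 ?g = {{u1,u2},{u2,u3}}"
        by (subst sets(2)[symmetric], rule R) (auto simp: tree_type_tys[OF g(1)] 2)
      then show ?thesis using True 2 tr by (auto simp: el0_def)
    next
      case 3
      have "Tr1 ?g = {{u1,u3},{u2,u3}}"
        by (subst sets(3)[symmetric], rule R) (auto simp: tree_type_tys[OF g(1)] 3 numeral_2_eq_2)
      then show ?thesis using True 3 tr by (auto simp: el0_def)
    qed
  next
    case False
    then have st: "\<not> is_spanning_tree 1 ?g" using spanning_tree_Q1[OF g(2)] by simp
    have R: "Tr1 ?g = {{u j | j. j \<in> {1,2,3} - {i}}}"
      if "i \<in> {1,2,3}" "in_S 1 i ?g" "\<And>k. k \<in> {1,2,3} \<Longrightarrow> in_S 1 k ?g \<Longrightarrow> k = i" for i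
    proof -
      have "(THE i. i \<in> {1,2,3} \<and> in_S 1 i ?g) = i" using that by (intro the_equality) blast+
      moreover have "\<exists>i\<in>{1,2,3}. in_S 1 i ?g" using that by blast
      ultimately show ?thesis unfolding Tr1_def Let_def using st by (simp only: if_False if_True)
    qed
    have sets: "{u j | j. j \<in> {1,2,3} - {1}} = {u2,u3}" "{u j | j. j \<in> {1,2,3} - {2}} = {u1,u3}"
      "{u j | j. j \<in> {1,2,3} - {3}} = {u1,u2}"
      by (auto simp: u_simps intro: exI[of _ "1::nat"] exI[of _ "2::nat"] exI[of _ "3::nat"])
    consider "conn ?g u1 u2" "\<not> conn ?g u1 u3" "\<not> conn ?g u2 u3" | "conn ?g u1 u3" "\<not> conn ?g u1 u2" "\<not> conn ?g u2 u3"
      | "conn ?g u2 u3" "\<not> conn ?g u1 u2" "\<not> conn ?g u1 u3" | "\<not> conn ?g u2 u3" "\<not> conn ?g u1 u2" "\<not> conn ?g u1 u3"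
      using False t by blast
    then show ?thesis
    proof cases
      case 1
      have "Tr1 ?g = {{u1,u2}}"
        by (subst sets(3)[symmetric], rule R) (use S 1 in auto)
      then show ?thesis using 1 tr cl by (simp add: el0_def)
    next
      case 2
      have "Tr1 ?g = {{u1,u3}}"
        by (subst sets(2)[symmetric], rule R) (use S 2 in auto)
      then show ?thesis using 2 tr cl by (simp add: el0_def)
    next
      case 3
      have "Tr1 ?g = {{u2,u3}}"
        by (subst sets(1)[symmetric], rule R) (use S 3 in auto)
      then show ?thesis using 3 tr cl by (simp add: el0_def)
    next
      case 4
      then have "\<not> (\<exists>i\<in>{1,2,3}. in_S 1 i ?g)" using S by auto
      then have "Tr1 ?g = {}" unfolding Tr1_def using st by simp
      then show ?thesis using 4 tr cl by (simp add: el0_def)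
    qed
  qed
qed

lemma bd_psiw: assumes "w \<in> words n" "P \<subseteq> EG j" shows "bd (image (psiw w) ` P) = psiw w ` bd P"
proof (rule set_eqI)
  fix v
  let ?Q = "\<lambda>v. if v = w then P else {}"
  have "image (psiw w) ` P = glue n ?Q" using assms(1) by (auto simp: glue_def split: if_splits)
  moreover have "v \<in> bd (glue n ?Q) \<longleftrightarrow> odd (card {x \<in> words n. v \<in> psiw x ` bd (?Q x)})"
    by (rule bd_glue[of n ?Q j v]) (use assms(2) in auto)
  moreover have "{x \<in> words n. v \<in> psiw x ` bd (?Q x)} = (if v \<in> psiw w ` bd P then {w} else {})"
    using assms(1) by auto
  ultimately show "v \<in> bd (image (psiw w) ` P) \<longleftrightarrow> v \<in> psiw w ` bd P" by simp
qed

lemma u_in_VG: "u i \<in> VG n"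
  using VG_mono[of 0 n] by (auto simp: u_def VG.simps)

lemma psiw_mid_not_corner:
  assumes "w \<in> words n" "z \<in> VG 1" "z \<notin> VG 0" shows "psiw w z \<notin> VG 0"
proof
  assume "psiw w z \<in> VG 0"
  then obtain i where i: "i \<in> {1,2,3}" "psiw w z = u i" unfolding VG0 by blast
  then have "bar i (psiw w z) \<ge> 1" using bar_u[OF i(1) i(1)] by simp
  then have "z = u i" using psiw_corner[OF assms(1) _ i(1)] assms(2) VG_Tri by blast
  then show False using assms(3) i(1) unfolding VG0 by blast
qed

text \<open>A cycle in a cell would be a cycle in the tree. A midpoint in the cell reaches a corner
  of the cell because its path in the tree to the corner \<open>u 1\<close> of the whole triangle
  cannot end inside.\<close>

lemma cell_Q1:
  assumes f: "f \<in> trees (n + 1)" and w: "w \<in> words n" shows "piw 1 w f \<in> Q1"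
proof -
  let ?g = "piw 1 w f"
  have T: "stree (VG (n + 1)) f" "f \<subseteq> EG (n + 1)" using f by (auto simp only: trees_iff)
  have e2: "edges2 ?g" by (rule edges2_EG[OF piw_sub])
  have ac: "acyc ?g" unfolding acyc_def
  proof (intro allI impI)
    fix P assume P: "P \<subseteq> ?g" "bd P = {}"
    then have PE: "image (psiw w) ` P \<subseteq> f" "P \<subseteq> EG 1" by (auto simp: piw_def)
    have "image (psiw w) ` P = {}"
      using streeD(2)[OF T(1)] PE(1) bd_psiw[OF w PE(2)] P(2) image_empty unfolding acyc_def by metis
    then show "P = {}" by simp
  qed
  have "\<exists>i\<in>{1,2,3}. conn ?g v (u i)" if v: "v \<in> VG 1" for v
  proof (cases "v \<in> VG 0")
    case True then show ?thesis unfolding VG0 using conn_refl[of ?g v] by blast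
  next
    case False
    have vV: "psiw w v \<in> VG (n + 1)" unfolding VG_add using w v by blast
    have u0: "u 1 \<in> VG 0" unfolding VG0 by blast
    obtain P where P: "P \<subseteq> f" "bd P = sd {psiw w v} {u 1}"
      using streeD(3)[OF T(1) vV u_in_VG[of 1 "n+1"]] unfolding conn_def by blast
    have nc: "psiw w v \<notin> VG 0" by (rule psiw_mid_not_corner[OF w v False])
    then have bP: "bd P = {psiw w v, u 1}" using P(2) u0 sd_pair[of "psiw w v" "u 1"] by metis
    let ?R = "piw 1 w P"
    have PE: "P \<subseteq> EG (n + 1)" using P(1) T(2) by blast
    have bR: "z \<in> bd ?R \<longleftrightarrow> z = v" if z: "z \<in> VG 1" "z \<notin> VG 0" for z
    proof -
      have zT: "z \<in> Tri" using z(1) VG_Tri by blast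
      have "psiw w z \<noteq> u 1" using psiw_mid_not_corner[OF w z] u0 by metis
      then show ?thesis using bd_local[OF zT z(2) w PE] bP injD[OF psiw_inj, of w z v] by auto
    qed
    \<comment> \<open>Besides \<open>v\<close>, only corners of the cell can be odd in
      \<open>?R\<close>; by parity the component of \<open>v\<close> contains one of them.\<close>
    have ev: "even (card (bd ?R \<inter> {y. reach ?g v y}))" by (rule even_card_bd_comp[OF e2 piw_mono[OF P(1)]])
    have vin: "v \<in> bd ?R \<inter> {y. reach ?g v y}" using bR[OF v False] by (simp add: reach_def)
    obtain y where y: "y \<in> bd ?R" "reach ?g v y" "y \<noteq> v"
    proof -
      have "bd ?R \<inter> {y. reach ?g v y} \<noteq> {v}" using ev by auto
      then show ?thesis using vin that by blast
    qed
    have "y \<in> VG 1" using y(1) bd_sub[OF piw_sub] by blast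
    then have "y \<in> VG 0" using bR y by blast
    then show ?thesis using y(2) conn_iff_reach[OF e2, of v y] unfolding VG0 by blast
  qed
  then show ?thesis unfolding Q1_def using ac piw_sub by blast
qed

lemma set_L3: "set L3 = {[False,False,False],[False,False,True],[False,True,False],[False,True,True],
   [True,False,False],[True,False,True],[True,True,False],[True,True,True]}"
  by (simp add: L3_def)

lemma conn_el0:
  assumes "length s = 3" "length D = 6" "dl vl D = {x,y}" "x \<noteq> y"
  shows "conn (dl el0 s) x y \<longleftrightarrow> (\<exists>p\<in>set L3. le p s \<and> bd0 p = D)"
proof -
  have l: "length (bd0 p) = 6" if l3: "length p = 3" for p
    using len3[OF l3] by (elim exE) simp
  have "conn (dl el0 s) x y \<longleftrightarrow> (\<exists>P. P \<subseteq> dl el0 s \<and> bd P = dl vl D)"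
    unfolding conn_def using assms(3,4) by (simp add: sd_pair)
  also have "\<dots> \<longleftrightarrow> (\<exists>p\<in>set L3. le p s \<and> bd0 p = D)"
  proof
    assume "\<exists>P. P \<subseteq> dl el0 s \<and> bd P = dl vl D"
    then obtain P where P: "P \<subseteq> dl el0 s" "bd P = dl vl D" by blast
    then obtain p where p: "length p = 3" "P = dl el0 p" using sub_el0[of P] dl_el0_sub[of s] by auto
    have "le p s" using P(1) p assms(1) le_iff_dl[OF distinct_el0, of p s] lens by simp
    moreover have "bd0 p = D"
      using P(2) bd_el0[OF p(1)] dl_inj[OF distinct_vl, of "bd0 p" D] l[OF p(1)] assms(2) lens p(2) by simp
    ultimately show "\<exists>p\<in>set L3. le p s \<and> bd0 p = D" using p(1) L3 by blast
  next
    assume "\<exists>p\<in>set L3. le p s \<and> bd0 p = D"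
    then obtain p where p: "length p = 3" "le p s" "bd0 p = D" using L3 by blast
    then show "\<exists>P. P \<subseteq> dl el0 s \<and> bd P = dl vl D"
      using bd_el0[OF p(1)] le_iff_dl[OF distinct_el0, of p s] assms(1) lens by (intro exI[of _ "dl el0 p"]) simp
  qed
  finally show ?thesis .
qed

lemma conn0_conn:
  assumes "length s = 3"
  shows "conn0 s = [conn (dl el0 s) u2 u3, conn (dl el0 s) u1 u3, conn (dl el0 s) u1 u2]"
proof -
  obtain s1 s2 s3 where s: "s = [s1,s2,s3]" using len3[OF assms] by blast
  have 1: "conn (dl el0 s) u2 u3 \<longleftrightarrow> (\<exists>p\<in>set L3. le p s \<and> bd0 p = [False,True,True,False,False,False])"
    by (rule conn_el0[OF assms]) (simp_all add: vl_def v_neq)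
  have 2: "conn (dl el0 s) u1 u3 \<longleftrightarrow> (\<exists>p\<in>set L3. le p s \<and> bd0 p = [True,False,True,False,False,False])"
    by (rule conn_el0[OF assms]) (simp_all add: vl_def v_neq)
  have 3: "conn (dl el0 s) u1 u2 \<longleftrightarrow> (\<exists>p\<in>set L3. le p s \<and> bd0 p = [True,True,False,False,False,False])"
    by (rule conn_el0[OF assms]) (simp_all add: vl_def v_neq)
  show ?thesis unfolding 1 2 3 unfolding set_L3 s conn0_def by simp blast
qed

lemma len_tr1: "length (tr1 g) = 3" by (simp add: tr1_def Let_def tys_def)

lemma corner_pairs:
  assumes D: "D \<subseteq> VG 0" "even (card D)" shows "D = {} \<or> D \<in> {{u1,u2},{u1,u3},{u2,u3}}"
proof -
  have D3: "D \<subseteq> {u1,u2,u3}" using D(1) by (simp add: VG.simps)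
  have "D = {x\<in>{u1,u2,u3}. x \<in> D}" using D3 by blast
  also have "\<dots> = (if u1 \<in> D then {u1} else {}) \<union> (if u2 \<in> D then {u2} else {}) \<union> (if u3 \<in> D then {u3} else {})"
    by auto
  finally show ?thesis using D(2) v_neq by (auto simp: card_insert_if split: if_splits)
qed

text \<open>Even sets of corners are empty or pairs, so the same boundaries occur in
  \<open>g\<close> and in its trace once both connect the same corners, which \<open>check1\<close>
  verifies. This is what allows paths to be refined and forests to be exchanged cell by
  cell.\<close>

lemma Tr1_props:
  assumes "g \<in> Q1"
  shows "Tr1 g \<subseteq> EG 0" "acyc (Tr1 g)"
    "D \<subseteq> VG 0 \<Longrightarrow> (\<exists>P\<subseteq>g. bd P = D) \<longleftrightarrow> (\<exists>p\<subseteq>Tr1 g. bd p = D)" "card (Tr1 g) \<le> 2"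
proof -
  obtain gl where gl: "length gl = 9" "g = dl el1 gl" using sub_el1 Q1D(1)[OF assms] by blast
  have Qg: "dl el1 gl \<in> Q1" using assms gl by simp
  have T: "Tr1 g = dl el0 (tr1 gl)" using Tr1_dl[OF gl(1) Qg] gl(2) by simp
  show 0: "Tr1 g \<subseteq> EG 0" unfolding T by (rule dl_el0_sub)
  obtain s1 s2 s3 where s: "tr1 gl = [s1,s2,s3]" using len3[OF len_tr1] by blast
  have nt: "\<not> (s1 \<and> s2 \<and> s3)" using chk1(1)[OF gl(1) Qg] s by auto
  show "card (Tr1 g) \<le> 2" unfolding T card_dl[OF distinct_el0, of "tr1 gl", unfolded lens, OF len_tr1]
    using nt by (auto simp: s)
  show "acyc (Tr1 g)" unfolding acyc_def
  proof (intro allI impI)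
    fix P assume P: "P \<subseteq> Tr1 g" "bd P = {}"
    then obtain p where p: "length p = 3" "P = dl el0 p" using sub_el0[of P] 0 by auto
    obtain p1 p2 p3 where p3: "p = [p1,p2,p3]" using len3[OF p(1)] by blast
    have "le p (tr1 gl)" using P(1) p le_iff_dl[OF distinct_el0, of p "tr1 gl"] lens len_tr1 T by simp
    then have np: "\<not> (p1 \<and> p2 \<and> p3)" using nt unfolding s p3 by auto
    have "dl vl (bd0 p) = dl vl [False,False,False,False,False,False]"
      using bd_el0[OF p(1)] P(2) p by (simp add: vl_def)
    moreover have "length (bd0 p) = length vl" "length [False,False,False,False,False,False] = length vl"
      by (simp_all add: p3 vl_def)
    ultimately have "bd0 p = [False,False,False,False,False,False]"
      using dl_inj[OF distinct_vl] by metis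
    then show "P = {}" using np unfolding p(2) p3 by (auto simp: el0_def)
  qed
  have "[conn g u2 u3, conn g u1 u3, conn g u1 u2] = [conn (Tr1 g) u2 u3, conn (Tr1 g) u1 u3, conn (Tr1 g) u1 u2]"
    using chk1(2)[OF gl(1) Qg] connl[OF gl(1)] conn0_conn[OF len_tr1[of gl]] unfolding T unfolding gl(2) by (simp only:)
  then have c: "conn g u1 u2 = conn (Tr1 g) u1 u2" "conn g u1 u3 = conn (Tr1 g) u1 u3" "conn g u2 u3 = conn (Tr1 g) u2 u3"
    by simp_all
  assume D: "D \<subseteq> VG 0"
  have ev: "\<exists>P\<subseteq>E. bd P = D \<Longrightarrow> edges2 E \<Longrightarrow> even (card D)" for E
    using even_card_bd edges2_subset by metis
  have e: "edges2 g" "edges2 (Tr1 g)" using Q1D(2)[OF assms] edges2_EG[OF 0] by auto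
  show "(\<exists>P\<subseteq>g. bd P = D) \<longleftrightarrow> (\<exists>p\<subseteq>Tr1 g. bd p = D)"
  proof (cases "even (card D)")
    case False then show ?thesis using ev e by blast
  next
    case True
    consider "D = {}" | "D = {u1,u2}" | "D = {u1,u3}" | "D = {u2,u3}" using corner_pairs[OF D True] by blast
    then show ?thesis
    proof cases
      case 1 then show ?thesis by (metis bd_empty empty_subsetI)
    next
      case 2 then show ?thesis using c(1) v_neq(1) unfolding conn_def by (simp add: sd_pair)
    next
      case 3 then show ?thesis using c(2) v_neq(2) unfolding conn_def by (simp add: sd_pair)
    next
      case 4 then show ?thesis using c(3) v_neq(6) unfolding conn_def by (simp add: sd_pair)
    qed
  qed
qed

subsection \<open>Offspring means of cell crossings\<close>

text \<open>The argument of \<open>h\<close> is the type of the crossing \<open>p\<close> of a cell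
  with state \<open>s\<close>, as in \<open>ty\<close>.\<close>

definition wt :: "(nat \<Rightarrow> real) \<Rightarrow> complex set set \<Rightarrow> complex set set \<Rightarrow> real" where
  "wt h s p = h (if p = {} then 0 else if card s = 1 then 1 else if card p = 1 then 2 else 3)"

text \<open>The offspring of one crossing, weighted by \<open>h\<close>; \<open>D\<close> holds the
  two corners through which the cell is crossed.\<close>

definition offs :: "(nat \<Rightarrow> real) \<Rightarrow> complex set set \<Rightarrow> complex set \<Rightarrow> real" where
  "offs h g D = (\<Sum>c\<in>{1,2,3}. wt h (piw 0 [c] g) (piw 0 [c] (bpath g D)))"

text \<open>\<open>eig l h\<close>: \<open>h\<close> is a right eigenvector for \<open>l\<close> of the matrix of mean numbers of offspring crossings; there
  are 30 forests refining a single edge and 18 refining a tree, with the totals in \<open>check2\<close>.\<close>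

definition eig :: "real \<Rightarrow> (nat \<Rightarrow> real) \<Rightarrow> bool" where
  "eig l h \<longleftrightarrow> h 0 = 0 \<and> 30 * h 1 + 24 * h 2 + 12 * h 3 = 30 * l * h 1 \<and>
     9 * h 1 + 18 * h 2 + 9 * h 3 = 18 * l * h 2 \<and> 18 * h 1 + 24 * h 2 + 12 * h 3 = 18 * l * h 3"

lemma wt_dl: "length s = 3 \<Longrightarrow> length p = 3 \<Longrightarrow> wt h (dl el0 s) (dl el0 p) = h (ty s p)"
  using card_dl[OF distinct_el0, of s] card_dl[OF distinct_el0, of p] emp_dl[of p el0] lens
  by (simp add: wt_def numeral_2_eq_2 numeral_3_eq_3)

lemma piw_cell:
  assumes "length g = 9"
  shows "piw 0 [1] (dl el1 g) = dl el0 (cellof 0 g)" "piw 0 [2] (dl el1 g) = dl el0 (cellof (Suc 0) g)"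
    "piw 0 [3] (dl el1 g) = dl el0 (cellof (Suc (Suc 0)) g)"
proof -
  obtain a1 a2 a3 b1 b2 b3 c1 c2 c3 where g: "g = [a1,a2,a3,b1,b2,b3,c1,c2,c3]" using len9[OF assms] by blast
  have p: "x \<in> piw 0 [c] (dl el1 g) \<longleftrightarrow> x \<in> set el0 \<and> psi c ` x \<in> dl el1 g" for x c
    by (simp add: piw_def EG0_el0)
  have q: "x \<in> dl el0 s \<longleftrightarrow> x \<in> set el0 \<and> x \<in> dl el0 s" for x s using subsetD[OF dl_subset_set, of x el0 s] by blast
  have e: "set el0 = {{u2,u3},{u1,u3},{u1,u2}}" by (simp add: el0_def)
  note simps = in_dl_Cons psi_u psi_u_Suc doubleton_eq_iff v_neqs el1_def el0_def g
  show "piw 0 [1] (dl el1 g) = dl el0 (cellof 0 g)"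
    unfolding g cellof.simps nat.case
  proof (rule set_eqI)
    fix x
    consider "x = {u2,u3}" | "x = {u1,u3}" | "x = {u1,u2}" | "x \<notin> set el0" unfolding e by blast
    then show "x \<in> piw 0 [1] (dl el1 [a1,a2,a3,b1,b2,b3,c1,c2,c3]) \<longleftrightarrow> x \<in> dl el0 [a1,a2,a3]"
    proof cases
      case 4 then show ?thesis using p[of x] q[of x] unfolding g by blast
    qed (simp add: p[unfolded g el1_def el0_def] simps del: dl_Cons)+
  qed
  show "piw 0 [2] (dl el1 g) = dl el0 (cellof (Suc 0) g)"
    unfolding g cellof.simps nat.case
  proof (rule set_eqI)
    fix x
    consider "x = {u2,u3}" | "x = {u1,u3}" | "x = {u1,u2}" | "x \<notin> set el0" unfolding e by blast
    then show "x \<in> piw 0 [2] (dl el1 [a1,a2,a3,b1,b2,b3,c1,c2,c3]) \<longleftrightarrow> x \<in> dl el0 [b1,b2,b3]"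
    proof cases
      case 4 then show ?thesis using p[of x] q[of x] unfolding g by blast
    qed (simp add: p[unfolded g el1_def el0_def] simps del: dl_Cons)+
  qed
  show "piw 0 [3] (dl el1 g) = dl el0 (cellof (Suc (Suc 0)) g)"
    unfolding g cellof.simps nat.case
  proof (rule set_eqI)
    fix x
    consider "x = {u2,u3}" | "x = {u1,u3}" | "x = {u1,u2}" | "x \<notin> set el0" unfolding e by blast
    then show "x \<in> piw 0 [3] (dl el1 [a1,a2,a3,b1,b2,b3,c1,c2,c3]) \<longleftrightarrow> x \<in> dl el0 [c1,c2,c3]"
    proof cases
      case 4 then show ?thesis using p[of x] q[of x] unfolding g by blast
    qed (simp add: p[unfolded g el1_def el0_def] simps del: dl_Cons)+
  qed
qed

lemma len_cellof: assumes "length g = 9" shows "length (cellof k g) = 3"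
proof -
  obtain a1 a2 a3 b1 b2 b3 c1 c2 c3 where g: "g = [a1,a2,a3,b1,b2,b3,c1,c2,c3]" using len9[OF assms] by blast
  show ?thesis unfolding g by (simp split: nat.split)
qed

lemma offs_tyc:
  assumes g: "length g = 9" "dl el1 g \<in> Q1" and b: "length b = 9" "bd1 b = D" and ne: "pick b g \<noteq> []"
  shows "offs h (dl el1 g) (dl vl D) = sum_list (map h (tyc b g))" "set (tyc b g) \<subseteq> {0,1,2,3}"
proof -
  obtain p ps where p: "pick b g = p # ps" using ne by (cases "pick b g") auto
  then have pp: "length p = 9" "dl el1 p \<subseteq> dl el1 g \<and> bd (dl el1 p) = dl vl D"
    using set_pick[OF b(1) g(1), of p] pick_paths[OF b(1) g(1) b(2), of "dl el1 p"] by auto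
  have bp: "bpath (dl el1 g) (dl vl D) = dl el1 p"
    using bpath_eq[OF Q1D(2,3)[OF g(2)]] pp(2) by blast
  have s: "(\<Sum>c\<in>{1,2,3}. F c) = F 1 + F 2 + F (3::nat)" for F :: "nat \<Rightarrow> real" by simp
  have t: "tyc b g = map (\<lambda>k. ty (cellof k g) (cellof k p)) [0, Suc 0, Suc (Suc 0)]" by (simp add: tyc_def p)
  show "offs h (dl el1 g) (dl vl D) = sum_list (map h (tyc b g))"
    unfolding offs_def bp s piw_cell[OF g(1)] piw_cell[OF pp(1)] t
    by (simp only: wt_dl[OF len_cellof[OF g(1)] len_cellof[OF pp(1)]]) (simp del: ty.simps)
  show "set (tyc b g) \<subseteq> {0,1,2,3}" unfolding t by auto
qed

lemma sum_list_types:
  fixes h :: "nat \<Rightarrow> real"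
  assumes "h 0 = 0" "set R \<subseteq> {0,1,2,3}"
  shows "sum_list (map h R) = h 1 * real (length (filter (\<lambda>x. x = 1) R)) +
    h 2 * real (length (filter (\<lambda>x. x = 2) R)) + h 3 * real (length (filter (\<lambda>x. x = 3) R))"
  using assms(2) by (induction R) (auto simp: assms(1) algebra_simps)

lemma rows_sum: "sum_list (map h (rows Q s b)) =
    sum_list (map (\<lambda>(g,t). sum_list (map h (tyc b g))) (filter (\<lambda>(g,t). t = s) Q))" for h :: "nat \<Rightarrow> real"
  by (induction Q) (auto simp: rows_def)

text \<open>The sum over the forests with the given trace is a sum over rows of the enumeration;
  \<open>check2\<close> gives the totals, and \<open>eig l h\<close> says precisely that they
  cancel.\<close>

lemma offspring_mean:
  assumes h: "eig l h" and g0: "g0 \<in> Q1" and p: "p \<subseteq> Tr1 g0"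
  shows "(\<Sum>g\<in>{g\<in>Q1. Tr1 g = Tr1 g0}. offs h g (bd p) - l * wt h (Tr1 g0) p) = 0"
proof (cases "p = {}")
  case True
  have "offs h g (bd p) - l * wt h (Tr1 g0) p = 0" if "g \<in> Q1" for g
  proof -
    have "bpath g {} = {}" using bpath_eq[OF Q1D(2,3)[OF that], of "{}"] by simp
    then show ?thesis using True h by (simp add: offs_def wt_def eig_def piw_def)
  qed
  then show ?thesis by simp
next
  case False
  obtain gl where gl: "length gl = 9" "g0 = dl el1 gl" using sub_el1 Q1D(1)[OF g0] by blast
  have Qg: "dl el1 gl \<in> Q1" using g0 gl by simp
  define s where "s = tr1 gl"
  have T: "Tr1 g0 = dl el0 s" using Tr1_dl[OF gl(1) Qg] gl(2) by (simp add: s_def)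
  have ls: "length s = 3" "s \<noteq> [True,True,True]" using len_tr1 chk1(1)[OF gl(1) Qg] by (auto simp: s_def)
  obtain q where q: "length q = 3" "p = dl el0 q" using sub_el0[of p] p dl_el0_sub[of s] T by auto
  have leq: "le q s" using p T q ls le_iff_dl[OF distinct_el0, of q s] lens by simp
  have ne: "\<not> emp q" using emp_dl[of q el0] q False lens by simp
  \<comment> \<open>Only the boundary matters: a path of two edges has the boundary of the third
    edge, so three representatives suffice.\<close>
  define b where "b = basel q"
  have b: "length b = 9" "bd1 b = bd0 q"
  proof -
    show "length b = 9" by (simp add: b_def basel_def e_props)
    obtain q1 q2 q3 where q3: "q = [q1,q2,q3]" using len3[OF q(1)] by blast
    obtain s1 s2 s3 where s3: "s = [s1,s2,s3]" using len3[OF ls(1)] by blast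
    have "bd0 q \<in> {[True,True,False,False,False,False], [True,False,True,False,False,False], [False,True,True,False,False,False]}"
      using leq ne ls(2) unfolding q3 s3 by (cases q1; cases q2; cases q3) (simp_all add: emp_def)
    then show "bd1 b = bd0 q" unfolding b_def basel_def by (auto simp: e_props)
  qed
  have bdp: "bd p = dl vl (bd0 q)" using bd_el0[OF q(1)] q(2) by simp
  have sq: "s \<in> set L3" "q \<in> set L3" using ls q L3 by auto
  let ?R = "rows Q1L s b"
  let ?G = "filter (\<lambda>(g,t). t = s) Q1L"
  have ck: "(length ?G, length (filter (\<lambda>x. x = 1) ?R), length (filter (\<lambda>x. x = 2) ?R), length (filter (\<lambda>x. x = 3) ?R))
      = (if ty s q = 1 then (30, 30, 24, 12) else if ty s q = 2 then (18, 9, 18, 9) else (18, 18, 24, 12))"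
    using core2 sq leq ne ls(2) unfolding check2_def list_all_iff Let_def b_def by blast
  have dG: "distinct (map fst ?G)" "distinct (map (\<lambda>x. dl el1 (fst x)) ?G)"
  proof -
    have "distinct (map fst Q1L)" using L9(2) by (simp add: Q1L_def comp_def)
    then show 1: "distinct (map fst ?G)" by (rule distinct_map_filter)
    have "inj_on (dl el1) (set (map fst ?G))"
      using Q1L_mem dl_inj[OF distinct_el1] lens by (auto simp: inj_on_def)
    then have "distinct (map (dl el1) (map fst ?G))" using 1 by (subst distinct_map) blast
    then show "distinct (map (\<lambda>x. dl el1 (fst x)) ?G)" by (simp add: comp_def)
  qed
  let ?N = "{g\<in>Q1. Tr1 g = Tr1 g0}"
  have N: "?N = set (map (\<lambda>x. dl el1 (fst x)) ?G)"
  proof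
    show "?N \<subseteq> set (map (\<lambda>x. dl el1 (fst x)) ?G)"
    proof
      fix g assume g: "g \<in> ?N"
      then obtain k where k: "length k = 9" "g = dl el1 k" using sub_el1 Q1D(1)[of g] by blast
      then have "dl el0 (tr1 k) = dl el0 s" using g Tr1_dl[OF k(1)] T by simp
      then have "tr1 k = s" using dl_inj[OF distinct_el0, of "tr1 k" s] len_tr1 ls lens by simp
      then have "(k, s) \<in> set ?G" using Q1L_mem[of k s] k g by simp
      then show "g \<in> set (map (\<lambda>x. dl el1 (fst x)) ?G)" using k by force
    qed
    show "set (map (\<lambda>x. dl el1 (fst x)) ?G) \<subseteq> ?N"
      using Q1L_mem Tr1_dl T by auto
  qed
  have card: "card ?N = length ?G" unfolding N distinct_card[OF dG(2)] by simp
  have pk: "pick b g \<noteq> []" "dl el1 g \<in> Q1" "length g = 9" if "(g, t) \<in> set ?G" for g t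
  proof -
    show g: "dl el1 g \<in> Q1" "length g = 9" using that Q1L_mem by auto
    have "Tr1 (dl el1 g) = Tr1 g0" using that Q1L_mem[of g t] Tr1_dl[of g] T by auto
    then have "\<exists>P\<subseteq>dl el1 g. bd P = bd p"
      using Tr1_props(3)[OF g(1), of "bd p"] p bd_sub[of p 0] q dl_el0_sub by metis
    then show "pick b g \<noteq> []" using pick_paths[OF b(1) g(2) b(2)] bdp by (metis empty_iff list.set(1))
  qed
  have h0: "h 0 = 0" using h by (simp add: eig_def)
  have "(\<Sum>g\<in>?N. offs h g (bd p)) = sum_list (map (\<lambda>x. offs h (dl el1 (fst x)) (bd p)) ?G)"
    unfolding N sum_list_distinct_conv_sum_set[OF dG(2), symmetric] by (simp add: comp_def)
  also have "\<dots> = sum_list (map (\<lambda>(g,t). sum_list (map h (tyc b g))) ?G)"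
    by (intro arg_cong[where f=sum_list] map_cong refl)
       (use offs_tyc(1)[OF _ _ b] pk bdp in \<open>auto simp: split_beta\<close>)
  also have "\<dots> = sum_list (map h ?R)" by (rule rows_sum[symmetric])
  also have "\<dots> = h 1 * real (length (filter (\<lambda>x. x = 1) ?R)) +
    h 2 * real (length (filter (\<lambda>x. x = 2) ?R)) + h 3 * real (length (filter (\<lambda>x. x = 3) ?R))"
  proof (rule sum_list_types[of h, OF h0])
    show "set ?R \<subseteq> {0,1,2,3}" unfolding rows_def
      using offs_tyc(2)[OF _ _ b] pk by (fastforce split: if_splits)
  qed
  finally have S: "(\<Sum>g\<in>?N. offs h g (bd p)) = h 1 * real (length (filter (\<lambda>x. x = 1) ?R)) +
    h 2 * real (length (filter (\<lambda>x. x = 2) ?R)) + h 3 * real (length (filter (\<lambda>x. x = 3) ?R))" .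
  have w: "wt h (Tr1 g0) p = h (ty s q)" unfolding T q(2) by (rule wt_dl[OF ls(1) q(1)])
  have tr: "ty s q \<in> {1,2,3}" using ne by auto
  have "(\<Sum>g\<in>?N. offs h g (bd p) - l * wt h (Tr1 g0) p) = (\<Sum>g\<in>?N. offs h g (bd p)) - real (length ?G) * (l * h (ty s q))"
    by (simp add: sum_subtractf card w)
  also have "\<dots> = 0"
  proof -
    consider "ty s q = 1" | "ty s q = 2" | "ty s q = 3" using tr by blast
    then show ?thesis
    proof cases
      case 1
      then show ?thesis using ck S h unfolding eig_def by (simp del: ty.simps add: algebra_simps)
    next
      case 2
      then show ?thesis using ck S h unfolding eig_def by (simp del: ty.simps add: algebra_simps)
    next
      case 3
      then show ?thesis using ck S h unfolding eig_def by (simp del: ty.simps add: algebra_simps)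
    qed
  qed
  finally show ?thesis .
qed

section \<open>Refinement of paths\<close>

lemma Tr_glue: "Tr n f = glue n (\<lambda>w. Tr1 (piw 1 w f))"
  by (simp add: Tr_def glue_def)

lemma Tr_cell:
  assumes f: "f \<in> trees (n + 1)" and w: "w \<in> words n"
  shows "piw 0 w (Tr n f) = Tr1 (piw 1 w f)"
  unfolding Tr_glue using Tr1_props(1)[OF cell_Q1[OF f]] w by (intro piw_glue) auto

text \<open>In every cell take the edge set in \<open>f\<close> with the boundary of the piece of
  the coarse path. The glued set lies in \<open>f\<close> and has boundary
  \<open>sd {a} {b}\<close>, so it is the path in \<open>f\<close>.\<close>

lemma path_refine:
  assumes f: "f \<in> trees (n + 1)" and t: "Tr n f \<in> trees n" and ab: "a \<in> VG n" "b \<in> VG n" and w: "w \<in> words n"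
  shows "piw 1 w (pth f a b) = bpath (piw 1 w f) (bd (piw 0 w (pth (Tr n f) a b)))"
    and "bd (piw 1 w (pth f a b)) = bd (piw 0 w (pth (Tr n f) a b))"
proof -
  let ?P = "pth (Tr n f) a b"
  have F: "f \<subseteq> EG (n + 1)" "stree (VG (n + 1)) f" using f by (auto simp only: trees_iff)
  have T: "Tr n f \<subseteq> EG n" "stree (VG n) (Tr n f)" using t by (auto simp only: trees_iff)
  note P = pth_props[OF streeD(1,2)[OF T(2)] streeD(3)[OF T(2) ab]]
  define R where "R = (\<lambda>w. bpath (piw 1 w f) (bd (piw 0 w ?P)))"
  have R: "R v \<subseteq> piw 1 v f" "bd (R v) = bd (piw 0 v ?P)" if v: "v \<in> words n" for v
  proof -
    note Q = cell_Q1[OF f v]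
    have sub: "piw 0 v ?P \<subseteq> Tr1 (piw 1 v f)" using piw_mono[OF P(1), of 0 v] Tr_cell[OF f v] by simp
    have D: "bd (piw 0 v ?P) \<subseteq> VG 0" by (rule bd_sub[OF piw_sub])
    have "\<exists>P'\<subseteq>piw 1 v f. bd P' = bd (piw 0 v ?P)"
      unfolding Tr1_props(3)[OF Q D] using sub by blast
    then obtain P' where P': "P' \<subseteq> piw 1 v f" "bd P' = bd (piw 0 v ?P)" by blast
    then have "R v = P'" unfolding R_def using bpath_eq[OF Q1D(2,3)[OF Q]] by blast
    then show "R v \<subseteq> piw 1 v f" "bd (R v) = bd (piw 0 v ?P)" using P' by auto
  qed
  have RE: "R v \<subseteq> EG 1" if "v \<in> words n" for v using R(1)[OF that] piw_sub by blast
  have "glue n R \<subseteq> f" using glue_mono[of n R "\<lambda>w. piw 1 w f"] R(1) glue_piw[OF F(1)] by simp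
  moreover have "bd (glue n R) = sd {a} {b}"
  proof -
    have "bd (glue n R) = bd (glue n (\<lambda>w. piw 0 w ?P))"
      using RE piw_sub R(2) by (rule bd_glue_cong)
    also have "glue n (\<lambda>w. piw 0 w ?P) = ?P" using glue_piw[of ?P n 0] P(1) T(1) by simp
    finally show ?thesis using P(2) by simp
  qed
  ultimately have "pth f a b = glue n R" by (rule pth_eq[OF streeD(1,2)[OF F(2)]])
  then have "piw 1 w (pth f a b) = R w" using piw_glue[OF RE w] by simp
  then show "piw 1 w (pth f a b) = bpath (piw 1 w f) (bd (piw 0 w ?P))"
    "bd (piw 1 w (pth f a b)) = bd (piw 0 w ?P)"
    using R(2)[OF w] unfolding R_def by auto
qed

text \<open>Weighted size of the \<open>n\<close>-th generation of the branching process, whose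
  individuals are the cells crossed by the path.\<close>

definition SS :: "(nat \<Rightarrow> real) \<Rightarrow> nat \<Rightarrow> complex set set \<Rightarrow> complex \<Rightarrow> complex \<Rightarrow> real" where
  "SS h n f a b = (\<Sum>w\<in>words n. wt h (piw 0 w f) (piw 0 w (pth f a b)))"

lemma SS_step:
  assumes f: "f \<in> trees (n + 1)" and t: "Tr n f \<in> trees n" and ab: "a \<in> VG n" "b \<in> VG n"
  shows "SS h (n + 1) f a b = (\<Sum>w\<in>words n. offs h (piw 1 w f) (bd (piw 0 w (pth (Tr n f) a b))))"
proof -
  let ?F = "\<lambda>v. wt h (piw 0 v f) (piw 0 v (pth f a b))"
  have inj: "inj_on (\<lambda>(w, c). w @ [c]) (words n \<times> {1,2,3::nat})" by (auto simp: inj_on_def)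
  have im: "words (n + 1) = (\<lambda>(w, c). w @ [c]) ` (words n \<times> {1,2,3})"
  proof
    show "words (n + 1) \<subseteq> (\<lambda>(w, c). w @ [c]) ` (words n \<times> {1,2,3})"
    proof
      fix v assume "v \<in> words (n + 1)"
      then obtain x y where "x \<in> words n" "y \<in> words 1" "v = x @ y" using words_split by blast
      moreover then obtain c where "y = [c]" "c \<in> {1,2,3}" by (auto simp: words_Suc)
      ultimately show "v \<in> (\<lambda>(w, c). w @ [c]) ` (words n \<times> {1,2,3})" by auto
    qed
    have "[c] \<in> words 1" if "c \<in> {1,2,3}" for c using that by (simp add: words_def)
    then show "(\<lambda>(w, c). w @ [c]) ` (words n \<times> {1,2,3}) \<subseteq> words (n + 1)" using words_append[of _ n _ 1] by auto
  qed
  have "SS h (n + 1) f a b = (\<Sum>(w, c)\<in>words n \<times> {1,2,3}. ?F (w @ [c]))"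
    unfolding SS_def im using sum.reindex[OF inj, of ?F] by (simp add: comp_def split_beta)
  also have "\<dots> = (\<Sum>w\<in>words n. \<Sum>c\<in>{1,2,3}. ?F (w @ [c]))"
    by (rule sum.cartesian_product[symmetric])
  also have "\<dots> = (\<Sum>w\<in>words n. offs h (piw 1 w f) (bd (piw 0 w (pth (Tr n f) a b))))"
  proof (rule sum.cong[OF refl])
    fix w assume w: "w \<in> words n"
    have "?F (w @ [c]) = wt h (piw 0 [c] (piw 1 w f)) (piw 0 [c] (piw 1 w (pth f a b)))" if c: "c \<in> {1,2,3}" for c
    proof -
      have "[c] \<in> words 1" using c by (simp add: words_def)
      then show ?thesis using piw_piw[of "[c]" 1 0 w] by simp
    qed
    then show "(\<Sum>c\<in>{1,2,3}. ?F (w @ [c])) = offs h (piw 1 w f) (bd (piw 0 w (pth (Tr n f) a b)))"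
      unfolding offs_def path_refine(1)[OF f t ab w, symmetric] by (intro sum.cong) auto
  qed
  finally show ?thesis .
qed

subsection \<open>Resampling one cell\<close>

text \<open>The piece of \<open>P\<close> in cell \<open>w\<close> has its boundary in the corners,
  because midpoints are excluded, and equal traces admit a piece of \<open>f'\<close> with the same
  boundary.\<close>

lemma swap_cell:
  assumes E: "f \<subseteq> EG (n + 1)" "f' \<subseteq> EG (n + 1)" and w: "w \<in> words n"
    and same: "\<forall>v\<in>words n. v \<noteq> w \<longrightarrow> piw 1 v f = piw 1 v f'"
    and Q: "piw 1 w f \<in> Q1" "piw 1 w f' \<in> Q1" "Tr1 (piw 1 w f) = Tr1 (piw 1 w f')"
    and P: "P \<subseteq> f" "\<forall>z\<in>VG 1 - VG 0. psiw w z \<notin> bd P"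
  shows "\<exists>P'\<subseteq>f'. bd P' = bd P \<and> (\<forall>v\<in>words n. v \<noteq> w \<longrightarrow> piw 1 v P' = piw 1 v P) \<and>
    bd (piw 1 w P') = bd (piw 1 w P)"
proof -
  have PE: "P \<subseteq> EG (n + 1)" using P(1) E(1) by blast
  have D: "bd (piw 1 w P) \<subseteq> VG 0"
  proof
    fix z assume z: "z \<in> bd (piw 1 w P)"
    then have z1: "z \<in> VG 1" using bd_sub[OF piw_sub] by blast
    show "z \<in> VG 0"
    proof (rule ccontr)
      assume nz: "z \<notin> VG 0"
      have "z \<in> Tri" using z1 VG_Tri by blast
      then show False using bd_local[OF _ nz w PE] z P(2) z1 nz by blast
    qed
  qed
  have "\<exists>Q\<subseteq>piw 1 w f'. bd Q = bd (piw 1 w P)"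
    using Tr1_props(3)[OF Q(1) D] Tr1_props(3)[OF Q(2) D] Q(3) piw_mono[OF P(1), of 1 w] by auto
  then obtain Q' where Q': "Q' \<subseteq> piw 1 w f'" "bd Q' = bd (piw 1 w P)" by blast
  let ?R = "(\<lambda>v. piw 1 v P)(w := Q')"
  have RE: "?R v \<subseteq> EG 1" if "v \<in> words n" for v using Q'(1) piw_sub[of 1] by (cases "v = w") auto
  have sub: "?R v \<subseteq> piw 1 v f'" if v: "v \<in> words n" for v
    using Q'(1) same v piw_mono[OF P(1), of 1 v] by (cases "v = w") auto
  show ?thesis
  proof (intro exI[of _ "glue n ?R"] conjI ballI impI)
    show "glue n ?R \<subseteq> f'" using glue_mono[of n ?R "\<lambda>v. piw 1 v f'"] sub glue_piw[OF E(2)] by simp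
    have "bd (glue n ?R) = bd (glue n (\<lambda>v. piw 1 v P))"
      by (rule bd_glue_cong[OF RE piw_sub]) (use Q'(2) in auto)
    then show "bd (glue n ?R) = bd P" using glue_piw[OF PE] by simp
    show "piw 1 v (glue n ?R) = piw 1 v P" if v: "v \<in> words n" "v \<noteq> w" for v
      using piw_glue[of n ?R 1 v] RE v by simp
    show "bd (piw 1 w (glue n ?R)) = bd (piw 1 w P)" using piw_glue[of n ?R 1 w] RE w Q'(2) by simp
  qed
qed

text \<open>Acyclicity and connectedness both speak about boundaries and are carried over by
  \<open>swap_cell\<close>, from \<open>f'\<close> to \<open>f\<close> and from \<open>f\<close> to
  \<open>f'\<close>. The midpoints of the cell, which it does not cover, reach a corner of the cell
  inside the new forest.\<close>

lemma swap_tree: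
  assumes f: "f \<in> trees (n + 1)" and E: "f' \<subseteq> EG (n + 1)" and w: "w \<in> words n"
    and same: "\<forall>v\<in>words n. v \<noteq> w \<longrightarrow> piw 1 v f = piw 1 v f'"
    and Q: "piw 1 w f' \<in> Q1" "Tr1 (piw 1 w f) = Tr1 (piw 1 w f')"
  shows "f' \<in> trees (n + 1)"
proof -
  have F: "f \<subseteq> EG (n + 1)" "stree (VG (n + 1)) f" using f by (auto simp only: trees_iff)
  note Qf = cell_Q1[OF f w]
  have same': "\<forall>v\<in>words n. v \<noteq> w \<longrightarrow> piw 1 v f' = piw 1 v f" using same by simp
  note sw = swap_cell[OF E F(1) w same' Q(1) Qf Q(2)[symmetric]]
  note sw' = swap_cell[OF F(1) E w same Qf Q]
  have e2: "edges2 f'" by (rule edges2_EG[OF E])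
  have ac: "acyc f'" unfolding acyc_def
  proof (intro allI impI)
    fix P assume P: "P \<subseteq> f'" "bd P = {}"
    obtain P' where P': "P' \<subseteq> f" "bd P' = bd P" "\<forall>v\<in>words n. v \<noteq> w \<longrightarrow> piw 1 v P' = piw 1 v P"
      "bd (piw 1 w P') = bd (piw 1 w P)"
      using sw[OF P(1)] P(2) by auto
    have "P' = {}" using streeD(2)[OF F(2)] P' P unfolding acyc_def by metis
    then have 1: "piw 1 v P = {}" if "v \<in> words n" "v \<noteq> w" for v using P'(3) that \<open>P' = {}\<close> by (simp add: piw_def)
    have "bd (piw 1 w P) = {}" using P'(4) \<open>P' = {}\<close> by (simp add: piw_def)
    \<comment> \<open>In cell \<open>w\<close> only the boundaries of the two pieces agree; the new
      forest being acyclic, a piece with empty boundary is empty.\<close>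
    then have "piw 1 w P = {}" using Q1D(3)[OF Q(1)] piw_mono[OF P(1), of 1 w] unfolding acyc_def by blast
    then have "glue n (\<lambda>v. piw 1 v P) = {}" using 1 unfolding glue_def by (metis (no_types, lifting) UN_E equals0I image_empty empty_iff)
    moreover have "P \<subseteq> EG (n + 1)" using P(1) E by blast
    ultimately show "P = {}" using glue_piw by blast
  qed
  define mids where "mids = psiw w ` (VG 1 - VG 0)"
  have c1: "conn f' a b" if ab: "a \<in> VG (n+1) - mids" "b \<in> VG (n+1) - mids" for a b
  proof -
    obtain P where P: "P \<subseteq> f" "bd P = sd {a} {b}" using streeD(3)[OF F(2), of a b] ab unfolding conn_def by blast
    have "\<forall>z\<in>VG 1 - VG 0. psiw w z \<notin> bd P"
    proof
      fix z assume "z \<in> VG 1 - VG 0"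
      then have "psiw w z \<in> mids" unfolding mids_def by blast
      then show "psiw w z \<notin> bd P" using ab unfolding P(2) in_sd by auto
    qed
    then obtain P' where "P' \<subseteq> f'" "bd P' = bd P" using sw'[OF P(1)] by blast
    then show ?thesis unfolding conn_def using P(2) by auto
  qed
  have c2: "\<exists>b\<in>VG (n+1) - mids. conn f' a b" if a: "a \<in> mids" for a
  proof -
    obtain z where z: "a = psiw w z" "z \<in> VG 1" using a by (auto simp: mids_def)
    obtain i where i: "i \<in> {1,2,3}" "conn (piw 1 w f') z (u i)" using Q1D(4)[OF Q(1) z(2)] by blast
    then obtain P where P: "P \<subseteq> piw 1 w f'" "bd P = sd {z} {u i}" by (auto simp: conn_def)
    have "bd (image (psiw w) ` P) = sd {a} {psiw w (u i)}"
      using bd_psiw[OF w, of P 1] P piw_sub[of 1 w f'] z(1) injD[OF psiw_inj, of w z "u i"]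
      by (auto simp: sd_def)
    moreover have "image (psiw w) ` P \<subseteq> f'" using P(1) by (auto simp: piw_def)
    ultimately have "conn f' a (psiw w (u i))" by (auto simp: conn_def)
    moreover have "psiw w (u i) \<notin> mids"
      using u_in_VG[of i 0] injD[OF psiw_inj, of w] by (auto simp: mids_def)
    moreover have "psiw w (u i) \<in> VG (n+1)" unfolding VG_add using w u_in_VG by blast
    ultimately show ?thesis by blast
  qed
  have c3: "\<exists>b\<in>VG (n+1) - mids. conn f' a b" if a: "a \<in> VG (n+1)" for a
    using c2[of a] a conn_refl[of f' a] by blast
  have "conn f' a b" if "a \<in> VG (n+1)" "b \<in> VG (n+1)" for a b
    using c3[OF that(1)] c3[OF that(2)] c1 conn_trans[OF e2] conn_sym[of f'] by meson
  moreover have "\<Union>f' \<subseteq> VG (n+1)" using E EG_sub_VG by blast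
  ultimately show ?thesis unfolding trees_iff stree_def using E e2 ac by simp
qed

definition Ext :: "nat \<Rightarrow> complex set set \<Rightarrow> complex set set set" where
  "Ext n t = {f \<in> trees (n + 1). Tr n f = t}"

definition rep :: "nat \<Rightarrow> nat list \<Rightarrow> complex set set \<Rightarrow> complex set set \<Rightarrow> complex set set" where
  "rep n w g f = glue n ((\<lambda>v. piw 1 v f)(w := g))"

lemma rep_cell:
  assumes "g \<subseteq> EG 1" "v \<in> words n" shows "piw 1 v (rep n w g f) = (if v = w then g else piw 1 v f)"
proof -
  have "((\<lambda>v. piw 1 v f)(w := g)) x \<subseteq> EG 1" for x using assms(1) piw_sub[of 1] by (cases "x = w") auto
  then show ?thesis unfolding rep_def using piw_glue[of n "(\<lambda>v. piw 1 v f)(w := g)" 1 v] assms(2) by auto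
qed

lemma rep_sub: "g \<subseteq> EG 1 \<Longrightarrow> rep n w g f \<subseteq> EG (n + 1)"
  unfolding rep_def using piw_sub[of 1] by (intro glue_sub) auto

lemma rep_rep:
  assumes "g \<subseteq> EG 1" "f \<subseteq> EG (n + 1)" shows "rep n w (piw 1 w f) (rep n w g f) = f"
proof -
  have "rep n w (piw 1 w f) (rep n w g f) = glue n (\<lambda>v. piw 1 v f)"
    unfolding rep_def[of n w "piw 1 w f"] glue_def
    using rep_cell[OF assms(1)] by (intro SUP_cong refl) auto
  then show ?thesis using glue_piw[OF assms(2)] by simp
qed

lemma rep_Ext:
  assumes f: "f \<in> Ext n t" and w: "w \<in> words n" and g: "g \<in> Q1" "Tr1 g = piw 0 w t"
  shows "rep n w g f \<in> Ext n t"
proof -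
  have ft: "f \<in> trees (n + 1)" "Tr n f = t" using f by (auto simp: Ext_def)
  have Tg: "Tr1 (piw 1 w f) = Tr1 g" using Tr_cell[OF ft(1) w] ft(2) g(2) by simp
  note gE = Q1D(1)[OF g(1)]
  have "rep n w g f \<in> trees (n + 1)"
    by (rule swap_tree[OF ft(1) rep_sub[OF gE] w]) (use rep_cell[OF gE] w g Tg in auto)
  moreover have "Tr n (rep n w g f) = Tr n f"
    unfolding Tr_glue glue_def using rep_cell[OF gE] Tg by (intro SUP_cong refl) auto
  ultimately show ?thesis using ft(2) by (simp add: Ext_def)
qed

lemma finite_Ext[simp]: "finite (Ext n t)" by (simp add: Ext_def)

text \<open>The involution \<open>(f, g) \<mapsto> (rep n w g f, piw 1 w f)\<close> expresses that, given the trace, the restriction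
  to the cell \<open>w\<close> is uniform and independent of the rest.\<close>

lemma Ext_sum_zero:
  fixes \<phi> \<psi> :: "complex set set \<Rightarrow> real"
  assumes w: "w \<in> words n" and z: "(\<Sum>g\<in>{g\<in>Q1. Tr1 g = piw 0 w t}. \<phi> g) = 0"
    and inv: "\<And>f g. f \<in> Ext n t \<Longrightarrow> g \<in> Q1 \<Longrightarrow> \<psi> (rep n w g f) = \<psi> f"
  shows "(\<Sum>f\<in>Ext n t. \<phi> (piw 1 w f) * \<psi> f) = 0"
proof (cases "Ext n t = {}")
  case False
  let ?N = "{g\<in>Q1. Tr1 g = piw 0 w t}"
  have fN: "finite ?N" by (rule finite_subset[of _ "Pow (EG 1)"]) (auto simp: Q1_def)
  have cell: "piw 1 w f \<in> ?N" if f: "f \<in> Ext n t" for f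
    using cell_Q1[of f n w] Tr_cell[of f n w] f w by (auto simp: Ext_def)
  have fE: "f \<subseteq> EG (n + 1)" if f: "f \<in> Ext n t" for f using f trees_iff by (auto simp: Ext_def)
  let ?T = "\<lambda>(f, g). (rep n w g f, piw 1 w f)"
  have T: "?T x \<in> Ext n t \<times> ?N" "?T (?T x) = x" if x: "x \<in> Ext n t \<times> ?N" for x
  proof -
    obtain f g where fg: "x = (f, g)" "f \<in> Ext n t" "g \<in> Q1" "Tr1 g = piw 0 w t" using x by auto
    show "?T x \<in> Ext n t \<times> ?N" using rep_Ext[OF fg(2) w fg(3,4)] cell[OF fg(2)] fg(1) by simp
    show "?T (?T x) = x"
      using rep_rep[OF Q1D(1)[OF fg(3)] fE[OF fg(2)], of w] rep_cell[OF Q1D(1)[OF fg(3)] w, of w f] fg(1) by simp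
  qed
  have "(\<Sum>x\<in>Ext n t \<times> ?N. \<phi> (piw 1 w (fst x)) * \<psi> (fst x)) = (\<Sum>x\<in>Ext n t \<times> ?N. \<phi> (snd x) * \<psi> (fst x))"
  proof (rule sum.reindex_bij_witness[of _ ?T ?T])
    fix x assume x: "x \<in> Ext n t \<times> ?N"
    show "?T (?T x) = x" "?T x \<in> Ext n t \<times> ?N" using T[OF x] by auto
    show "?T (?T x) = x" "?T x \<in> Ext n t \<times> ?N" using T[OF x] by auto
    obtain f g where fg: "x = (f, g)" "f \<in> Ext n t" "g \<in> Q1" using x by auto
    show "\<phi> (snd (?T x)) * \<psi> (fst (?T x)) = \<phi> (piw 1 w (fst x)) * \<psi> (fst x)"
      using inv[OF fg(2,3)] fg(1) by simp
  qed
  also have "\<dots> = (\<Sum>f\<in>Ext n t. \<Sum>g\<in>?N. \<phi> g * \<psi> f)"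
    unfolding sum.cartesian_product by (simp add: split_beta)
  also have "\<dots> = 0" unfolding sum_distrib_right[symmetric] z by simp
  finally have "(\<Sum>f\<in>Ext n t. \<Sum>g\<in>?N. \<phi> (piw 1 w f) * \<psi> f) = 0"
    unfolding sum.cartesian_product by (simp add: split_beta)
  then have "real (card ?N) * (\<Sum>f\<in>Ext n t. \<phi> (piw 1 w f) * \<psi> f) = 0"
    by (simp add: sum_distrib_left)
  moreover have "card ?N \<noteq> 0" using False cell fN by (metis (no_types, lifting) card_0_eq emptyE ex_in_conv)
  ultimately show ?thesis by simp
qed simp

subsection \<open>First and second moments of one refinement step\<close>

text \<open>Centred offspring of the crossing of cell \<open>w\<close>, if the finer tree restricts
  to \<open>g\<close> there; unrelated to the map \<open>xi\<close>.\<close>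

definition xi1 :: "real \<Rightarrow> (nat \<Rightarrow> real) \<Rightarrow> complex set set \<Rightarrow> complex \<Rightarrow> complex \<Rightarrow> nat list \<Rightarrow> complex set set \<Rightarrow> real" where
  "xi1 l h t a b w g = offs h g (bd (piw 0 w (pth t a b))) - l * wt h (piw 0 w t) (piw 0 w (pth t a b))"

lemma SS_diff:
  assumes f: "f \<in> Ext n t" and t: "t \<in> trees n" and ab: "a \<in> VG n" "b \<in> VG n"
  shows "SS h (n + 1) f a b - l * SS h n t a b = (\<Sum>w\<in>words n. xi1 l h t a b w (piw 1 w f))"
  using SS_step[of f n a b h] f t ab
  by (simp add: Ext_def xi1_def sum_subtractf SS_def sum_distrib_left)

lemma xi1_mean:
  assumes e: "eig l h" and E: "Ext n t \<noteq> {}" and t: "t \<in> trees n" and ab: "a \<in> VG n" "b \<in> VG n" and w: "w \<in> words n"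
  shows "(\<Sum>g\<in>{g\<in>Q1. Tr1 g = piw 0 w t}. xi1 l h t a b w g) = 0"
proof -
  obtain f where f: "f \<in> trees (n + 1)" "Tr n f = t" using E by (auto simp: Ext_def)
  have T: "stree (VG n) t" using t trees_iff by blast
  have g0: "piw 1 w f \<in> Q1" "Tr1 (piw 1 w f) = piw 0 w t" using cell_Q1[OF f(1) w] Tr_cell[OF f(1) w] f(2) by auto
  have "piw 0 w (pth t a b) \<subseteq> Tr1 (piw 1 w f)"
    unfolding g0(2) by (rule piw_mono[OF pth_props(1)[OF streeD(1,2)[OF T] streeD(3)[OF T ab]]])
  from offspring_mean[OF e g0(1) this] show ?thesis unfolding xi1_def g0(2) .
qed

definition hnorm :: "(nat \<Rightarrow> real) \<Rightarrow> real" where "hnorm h = \<bar>h 0\<bar> + \<bar>h 1\<bar> + \<bar>h 2\<bar> + \<bar>h 3\<bar>"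

lemma wt_bound: "\<bar>wt h s p\<bar> \<le> hnorm h"
  by (auto simp: wt_def hnorm_def)

lemma hnorm_nonneg: "hnorm h \<ge> 0" by (simp add: hnorm_def)

lemma xi1_bound: "\<bar>xi1 l h t a b w g\<bar> \<le> (3 + \<bar>l\<bar>) * hnorm h"
proof -
  have o: "\<bar>offs h g D\<bar> \<le> 3 * hnorm h" for D
  proof -
    have "\<bar>offs h g D\<bar> \<le> (\<Sum>c\<in>{1,2,3::nat}. \<bar>wt h (piw 0 [c] g) (piw 0 [c] (bpath g D))\<bar>)"
      unfolding offs_def by (rule sum_abs)
    also have "\<dots> \<le> (\<Sum>c\<in>{1,2,3::nat}. hnorm h)" by (rule sum_mono) (rule wt_bound)
    finally show ?thesis by simp
  qed
  have x: "\<bar>l * wt h (piw 0 w t) (piw 0 w (pth t a b))\<bar> \<le> \<bar>l\<bar> * hnorm h"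
    unfolding abs_mult by (rule mult_left_mono[OF wt_bound]) simp
  have "(3 + \<bar>l\<bar>) * hnorm h = 3 * hnorm h + \<bar>l\<bar> * hnorm h" by (simp add: distrib_right)
  then show ?thesis unfolding xi1_def
    using order_trans[OF abs_triangle_ineq4 add_mono[OF o x]] by simp
qed

lemma xi1_empty:
  assumes e: "eig l h" and g: "g \<in> Q1" and p: "piw 0 w (pth t a b) = {}" shows "xi1 l h t a b w g = 0"
proof -
  have "bpath g {} = {}" using bpath_eq[OF Q1D(2,3)[OF g], of "{}"] by simp
  moreover have "h 0 = 0" using e by (simp add: eig_def)
  moreover have "piw 0 [c] {} = {}" for c by (simp add: piw_def)
  ultimately show ?thesis by (simp add: xi1_def offs_def p wt_def)
qed

definition crossed :: "nat \<Rightarrow> complex set set \<Rightarrow> complex \<Rightarrow> complex \<Rightarrow> nat list set" where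
  "crossed n t a b = {w\<in>words n. piw 0 w (pth t a b) \<noteq> {}}"

text \<open>The martingale property as a finite sum over the extensions of \<open>t\<close>: every
  cell contributes mean zero.\<close>

lemma step_mean:
  assumes e: "eig l h" and t: "t \<in> trees n" and ab: "a \<in> VG n" "b \<in> VG n"
  shows "(\<Sum>f\<in>Ext n t. SS h (n + 1) f a b - l * SS h n t a b) = 0"
proof (cases "Ext n t = {}")
  case False
  have "(\<Sum>f\<in>Ext n t. SS h (n + 1) f a b - l * SS h n t a b) = (\<Sum>f\<in>Ext n t. \<Sum>w\<in>words n. xi1 l h t a b w (piw 1 w f))"
    using SS_diff[OF _ t ab] by (intro sum.cong) auto
  also have "\<dots> = (\<Sum>w\<in>words n. \<Sum>f\<in>Ext n t. xi1 l h t a b w (piw 1 w f))" by (rule sum.swap)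
  also have "\<dots> = 0"
  proof (rule sum.neutral, rule ballI)
    fix w assume w: "w \<in> words n"
    show "(\<Sum>f\<in>Ext n t. xi1 l h t a b w (piw 1 w f)) = 0"
      using Ext_sum_zero[OF w xi1_mean[OF e False t ab w], of "\<lambda>_. 1"] by simp
  qed
  finally show ?thesis .
qed simp

text \<open>Resampling cell \<open>w\<close> leaves the term of another cell \<open>v\<close>
  unchanged, so mixed terms vanish. On the diagonal only crossed cells contribute, each by a bounded
  amount.\<close>

lemma step_square:
  assumes e: "eig l h" and t: "t \<in> trees n" and ab: "a \<in> VG n" "b \<in> VG n"
  shows "(\<Sum>f\<in>Ext n t. (SS h (n + 1) f a b - l * SS h n t a b)\<^sup>2)
     \<le> real (card (Ext n t)) * (((3 + \<bar>l\<bar>) * hnorm h)\<^sup>2 * real (card (crossed n t a b)))"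
proof (cases "Ext n t = {}")
  case False
  let ?x = "\<lambda>w f. xi1 l h t a b w (piw 1 w f)"
  have cr: "(\<Sum>f\<in>Ext n t. ?x w f * ?x v f) = 0" if w: "w \<in> words n" "v \<in> words n" "w \<noteq> v" for w v
    by (rule Ext_sum_zero[OF w(1) xi1_mean[OF e False t ab w(1)]])
       (use rep_cell[OF Q1D(1) w(2)] w(3) in auto)
  have "(\<Sum>f\<in>Ext n t. (SS h (n + 1) f a b - l * SS h n t a b)\<^sup>2) = (\<Sum>f\<in>Ext n t. (\<Sum>w\<in>words n. ?x w f)\<^sup>2)"
    using SS_diff[OF _ t ab] by (intro sum.cong) auto
  also have "\<dots> = (\<Sum>f\<in>Ext n t. \<Sum>w\<in>words n. \<Sum>v\<in>words n. ?x w f * ?x v f)"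
    by (simp add: power2_eq_square sum_product)
  also have "\<dots> = (\<Sum>w\<in>words n. \<Sum>v\<in>words n. \<Sum>f\<in>Ext n t. ?x w f * ?x v f)"
    by (subst sum.swap, rule sum.cong[OF refl], subst sum.swap) simp
  also have "\<dots> = (\<Sum>w\<in>words n. \<Sum>v\<in>words n. if v = w then \<Sum>f\<in>Ext n t. (?x w f)\<^sup>2 else 0)"
    using cr by (intro sum.cong refl) (auto simp: power2_eq_square)
  also have "\<dots> = (\<Sum>w\<in>words n. \<Sum>f\<in>Ext n t. (?x w f)\<^sup>2)" by simp
  also have "\<dots> = (\<Sum>w\<in>crossed n t a b. \<Sum>f\<in>Ext n t. (?x w f)\<^sup>2)"
  proof (rule sum.mono_neutral_right)
    show "\<forall>w\<in>words n - crossed n t a b. (\<Sum>f\<in>Ext n t. (?x w f)\<^sup>2) = 0"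
    proof
      fix w assume w: "w \<in> words n - crossed n t a b"
      have "?x w f = 0" if f: "f \<in> Ext n t" for f
        using xi1_empty[OF e cell_Q1[of f n w]] f w by (auto simp: Ext_def crossed_def)
      then show "(\<Sum>f\<in>Ext n t. (?x w f)\<^sup>2) = 0" by simp
    qed
  qed (auto simp: crossed_def)
  also have "\<dots> \<le> (\<Sum>w\<in>crossed n t a b. \<Sum>f\<in>Ext n t. ((3 + \<bar>l\<bar>) * hnorm h)\<^sup>2)"
  proof (intro sum_mono)
    fix w f
    have "\<bar>?x w f\<bar> \<le> \<bar>(3 + \<bar>l\<bar>) * hnorm h\<bar>" using xi1_bound[of l h t a b w "piw 1 w f"] by linarith
    then show "(?x w f)\<^sup>2 \<le> ((3 + \<bar>l\<bar>) * hnorm h)\<^sup>2" by (simp add: abs_le_square_iff)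
  qed
  finally show ?thesis by (simp add: mult_ac)
qed simp

lemma SS_lower:
  assumes h: "h 0 = 0" "\<And>i. i \<in> {1,2,3} \<Longrightarrow> m \<le> h i"
  shows "m * real (card (crossed n t a b)) \<le> SS h n t a b"
proof -
  have "SS h n t a b = (\<Sum>w\<in>crossed n t a b. wt h (piw 0 w t) (piw 0 w (pth t a b)))"
    unfolding SS_def by (rule sum.mono_neutral_right) (auto simp: crossed_def wt_def h)
  moreover have "(\<Sum>w\<in>crossed n t a b. m) \<le> (\<Sum>w\<in>crossed n t a b. wt h (piw 0 w t) (piw 0 w (pth t a b)))"
    by (rule sum_mono) (auto simp: crossed_def wt_def h(2))
  ultimately show ?thesis by (simp add: mult_ac)
qed

lemma SS_upper:
  assumes h: "h 0 = 0"
  shows "\<bar>SS h n t a b\<bar> \<le> hnorm h * real (card (crossed n t a b))"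
proof -
  have "SS h n t a b = (\<Sum>w\<in>crossed n t a b. wt h (piw 0 w t) (piw 0 w (pth t a b)))"
    unfolding SS_def by (rule sum.mono_neutral_right) (auto simp: crossed_def wt_def h)
  also have "\<bar>\<dots>\<bar> \<le> (\<Sum>w\<in>crossed n t a b. hnorm h)"
    by (rule order_trans[OF sum_abs]) (intro sum_mono wt_bound)
  finally show ?thesis by (simp add: mult_ac)
qed

text \<open>With these weights \<open>SS\<close> counts the edges of a path.\<close>

definition hlen :: "nat \<Rightarrow> real" where "hlen i = (if i = 0 then 0 else if i = 3 then 2 else 1)"

lemma piw_card_sum:
  assumes "P \<subseteq> EG n" shows "card P = (\<Sum>w\<in>words n. card (piw 0 w P))"
proof -
  have fin: "finite (piw 0 w P)" for w using finite_subset[OF piw_sub finite_EG] .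
  have "P = (\<Union>w\<in>words n. image (psiw w) ` piw 0 w P)"
    using glue_piw[of P n 0] assms by (simp add: glue_def)
  then have "card P = card (\<Union>w\<in>words n. image (psiw w) ` piw 0 w P)" by simp
  also have "\<dots> = (\<Sum>w\<in>words n. card (image (psiw w) ` piw 0 w P))"
  proof (rule card_UN_disjoint)
    show "\<forall>i\<in>words n. \<forall>k\<in>words n. i \<noteq> k \<longrightarrow> image (psiw i) ` piw 0 i P \<inter> image (psiw k) ` piw 0 k P = {}"
    proof (intro ballI impI)
      fix i k assume ik: "i \<in> words n" "k \<in> words n" "i \<noteq> k"
      show "image (psiw i) ` piw 0 i P \<inter> image (psiw k) ` piw 0 k P = {}"
      proof (rule ccontr)
        assume "\<not> ?thesis"
        then obtain e e' where "e \<in> piw 0 i P" "e' \<in> piw 0 k P" "psiw i ` e = psiw k ` e'" by auto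
        then show False using edge_cell_unique[of e 0 e' i n k] ik piw_sub by blast
      qed
    qed
  qed (use fin in auto)
  also have "\<dots> = (\<Sum>w\<in>words n. card (piw 0 w P))"
    by (intro sum.cong refl card_image) (simp add: inj_on_def psiw_image_eq)
  finally show ?thesis .
qed

text \<open>The three edges of a cell would form a cycle.\<close>

lemma cell_card:
  assumes t: "t \<in> trees n" and w: "w \<in> words n" shows "card (piw 0 w t) \<le> 2"
proof (rule ccontr)
  assume "\<not> ?thesis"
  then have c: "card (piw 0 w t) \<ge> card (EG 0)" by (simp add: EG0_el0 el0_def card_insert_if)
  have "piw 0 w t = EG 0" using card_seteq[OF finite_EG piw_sub c] .
  moreover have "bd (EG 0) = {}"
    using bd_el0[of "[True,True,True]"] by (simp add: EG0_el0 el0_def vl_def)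
  ultimately have "bd (image (psiw w) ` EG 0) = {}" "image (psiw w) ` EG 0 \<subseteq> t"
    using bd_psiw[OF w subset_refl, of 0] by (auto simp: piw_def)
  then show False using t streeD(2) unfolding trees_iff acyc_def
    by (metis EG0_el0 el0_def empty_is_image list.set(2) insert_not_empty)
qed

text \<open>A cell of a tree has at most two edges, so a crossing of type 3 has two edges and every
  other crossing one.\<close>

lemma tdist_SS:
  assumes t: "t \<in> trees n" and ab: "a \<in> VG n" "b \<in> VG n"
  shows "real (tdist t a b) = SS hlen n t a b"
proof -
  have T: "stree (VG n) t" "t \<subseteq> EG n" using t by (auto simp only: trees_iff)
  note tp = tree_path_props[OF streeD(1,2)[OF T(1)] streeD(3)[OF T(1) ab]]
  note P = pth_props[OF streeD(1,2)[OF T(1)] streeD(3)[OF T(1) ab]]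
  have "real (card (piw 0 w (pth t a b))) = wt hlen (piw 0 w t) (piw 0 w (pth t a b))" if w: "w \<in> words n" for w
  proof -
    let ?p = "piw 0 w (pth t a b)" and ?s = "piw 0 w t"
    have sub: "?p \<subseteq> ?s" by (rule piw_mono[OF P(1)])
    have fs: "finite ?s" using finite_subset[OF piw_sub finite_EG] .
    have le: "card ?p \<le> card ?s" "card ?s \<le> 2" using card_mono[OF fs sub] cell_card[OF t w] by auto
    have "card ?p = 0 \<longleftrightarrow> ?p = {}" using finite_subset[OF sub fs] by simp
    then show ?thesis using le by (auto simp: wt_def hlen_def)
  qed
  then have "(\<Sum>w\<in>words n. real (card (piw 0 w (pth t a b)))) = SS hlen n t a b"
    unfolding SS_def by (rule sum.cong[OF refl])
  moreover have "pth t a b \<subseteq> EG n" using P(1) T(2) by blast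
  ultimately show ?thesis unfolding tp(7) using piw_card_sum by simp
qed

section \<open>Moments of the path lengths\<close>

locale ust = prob_space M for M :: "'w measure" +
  fixes T :: "nat \<Rightarrow> 'w \<Rightarrow> complex set set"
  assumes meas: "\<And>n. T n \<in> measurable M (count_space UNIV)"
    and unif: "\<And>n t. t \<in> trees n \<Longrightarrow> measure M {\<omega> \<in> space M. T n \<omega> = t} = 1 / real (card (trees n))"
    and cons: "\<And>n \<omega>. \<omega> \<in> space M \<Longrightarrow> Tr n (T (Suc n) \<omega>) = T n \<omega>"
begin

lemma meas_fun[measurable]: "(\<lambda>\<omega>. F (T n \<omega>) :: real) \<in> borel_measurable M"
  by (rule measurable_compose[OF meas]) simp

lemma ev_meas: "{\<omega> \<in> space M. T n \<omega> = t} \<in> events"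
proof -
  have "{\<omega> \<in> space M. T n \<omega> = t} = T n -` {t} \<inter> space M" by auto
  then show ?thesis using measurable_sets[OF meas, of "{t}" n] by simp
qed

lemma card_trees_pos: "card (trees n) > 0"
  using trees_nonempty finite_trees by (simp add: card_gt_0_iff)

text \<open>The values in \<open>trees n\<close> already carry total mass 1, since this set is not
  empty.\<close>

lemma AE_tree: "AE \<omega> in M. T n \<omega> \<in> trees n"
proof -
  have "prob (\<Union>t\<in>trees n. {\<omega> \<in> space M. T n \<omega> = t}) = (\<Sum>t\<in>trees n. prob {\<omega> \<in> space M. T n \<omega> = t})"
    by (rule finite_measure_finite_Union) (use ev_meas in \<open>auto simp: disjoint_family_on_def\<close>)
  also have "\<dots> = 1" using unif card_trees_pos[of n] trees_nonempty[of n] by simp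
  finally have "AE \<omega> in M. \<omega> \<in> (\<Union>t\<in>trees n. {\<omega> \<in> space M. T n \<omega> = t})"
    by (rule AE_prob_1)
  then show ?thesis by (rule AE_mp) auto
qed

text \<open>Through this, moments at a fixed level become finite averages, and the counting lemmas
  apply to them.\<close>

lemma expect:
  fixes \<phi> :: "complex set set \<Rightarrow> real"
  shows "integrable M (\<lambda>\<omega>. \<phi> (T n \<omega>))"
    and "expectation (\<lambda>\<omega>. \<phi> (T n \<omega>)) = (\<Sum>t\<in>trees n. \<phi> t) / real (card (trees n))"
proof -
  let ?ev = "\<lambda>t. {\<omega> \<in> space M. T n \<omega> = t}"
  let ?F = "\<lambda>\<omega>. \<Sum>t\<in>trees n. \<phi> t * indicator (?ev t) \<omega>"
  have eq: "AE \<omega> in M. \<phi> (T n \<omega>) = ?F \<omega>"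
    using AE_tree[of n]
  proof (rule AE_mp, intro AE_I2 impI)
    fix \<omega> assume w: "\<omega> \<in> space M" "T n \<omega> \<in> trees n"
    have "?F \<omega> = (\<Sum>t\<in>trees n. if t = T n \<omega> then \<phi> t else 0)"
      by (rule sum.cong) (use w in \<open>auto simp: indicator_def\<close>)
    then show "\<phi> (T n \<omega>) = ?F \<omega>" using w by simp
  qed
  have int1: "integrable M (\<lambda>\<omega>. \<phi> t * indicator (?ev t) \<omega>)" for t
    using ev_meas by (intro integrable_mult_right integrable_real_indicator) (auto simp: emeasure_eq_measure)
  then have intF: "integrable M ?F" by (intro Bochner_Integration.integrable_sum)
  have mF: "?F \<in> borel_measurable M" using intF by (rule borel_measurable_integrable)
  show "integrable M (\<lambda>\<omega>. \<phi> (T n \<omega>))"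
    using integrable_cong_AE[OF meas_fun mF eq] intF by simp
  have "expectation (\<lambda>\<omega>. \<phi> (T n \<omega>)) = expectation ?F"
    by (rule integral_cong_AE[OF meas_fun mF eq])
  also have "\<dots> = (\<Sum>t\<in>trees n. expectation (\<lambda>\<omega>. \<phi> t * indicator (?ev t) \<omega>))"
    by (rule Bochner_Integration.integral_sum) (rule int1)
  also have "\<dots> = (\<Sum>t\<in>trees n. \<phi> t / real (card (trees n)))"
  proof (rule sum.cong[OF refl])
    fix t assume "t \<in> trees n"
    then show "expectation (\<lambda>\<omega>. \<phi> t * indicator (?ev t) \<omega>) = \<phi> t / real (card (trees n))"
      using unif[of t n] ev_meas[of n t] Int_absorb2[of "?ev t" "space M"] by (simp add: subset_iff)
  qed
  finally show "expectation (\<lambda>\<omega>. \<phi> (T n \<omega>)) = (\<Sum>t\<in>trees n. \<phi> t) / real (card (trees n))"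
    by (simp add: sum_divide_distrib)
qed

text \<open>Every spanning tree is a value of \<open>T (n + 1)\<close> with positive probability,
  while the trace of \<open>T (n + 1)\<close> is \<open>T n\<close>, almost surely a spanning tree;
  so the claim follows from the existence of a consistent sequence.\<close>

lemma Tr_trees: assumes "f \<in> trees (n + 1)" shows "Tr n f \<in> trees n"
proof (rule ccontr)
  assume n: "Tr n f \<notin> trees n"
  have "AE \<omega> in M. \<not> (T (n+1) \<omega> = f)"
    using AE_tree[of n] by (rule AE_mp) (use cons n in \<open>auto intro!: AE_I2\<close>)
  then have "prob {\<omega> \<in> space M. T (n+1) \<omega> = f} = 0"
    using prob_Collect_eq_0[OF ev_meas[of "n+1" f, simplified]] by auto
  then show False using unif[OF assms] card_trees_pos[of "n+1"] by simp
qed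

lemma sum_Ext: "(\<Sum>f\<in>trees (n+1). F f) = (\<Sum>t\<in>trees n. \<Sum>f\<in>Ext n t. F f)" for F :: "complex set set \<Rightarrow> real"
proof -
  have "Tr n ` trees (n+1) \<subseteq> trees n" using Tr_trees by blast
  from sum.group[OF finite_trees finite_trees this, of F] show ?thesis by (simp add: Ext_def)
qed

section \<open>Increments and moments along an eigenvector\<close>

definition Del :: "real \<Rightarrow> (nat \<Rightarrow> real) \<Rightarrow> complex \<Rightarrow> complex \<Rightarrow> nat \<Rightarrow> complex set set \<Rightarrow> real" where
  "Del l h a b m f = SS h (m + 1) f a b - l * SS h m (Tr m f) a b"

text \<open>The factor \<open>G (T m \<omega>)\<close> makes this the conditional statement given
  \<open>T m\<close>; grouping the trees of level \<open>m + 1\<close> by their trace reduces it to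
  \<open>step_mean\<close>.\<close>

lemma Del_mean:
  assumes e: "eig l h" and ab: "a \<in> VG m" "b \<in> VG m"
  shows "expectation (\<lambda>\<omega>. G (T m \<omega>) * Del l h a b m (T (m+1) \<omega>)) = 0"
proof -
  have "expectation (\<lambda>\<omega>. G (T m \<omega>) * Del l h a b m (T (m+1) \<omega>))
      = expectation (\<lambda>\<omega>. (\<lambda>f. G (Tr m f) * Del l h a b m f) (T (m+1) \<omega>))"
    by (rule Bochner_Integration.integral_cong) (simp_all add: cons)
  also have "\<dots> = (\<Sum>t\<in>trees m. \<Sum>f\<in>Ext m t. G (Tr m f) * Del l h a b m f) / real (card (trees (m+1)))"
    by (rule expect(2)[of "\<lambda>f. G (Tr m f) * Del l h a b m f" "m+1", unfolded sum_Ext])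
  also have "(\<Sum>t\<in>trees m. \<Sum>f\<in>Ext m t. G (Tr m f) * Del l h a b m f)
     = (\<Sum>t\<in>trees m. G t * (\<Sum>f\<in>Ext m t. SS h (m + 1) f a b - l * SS h m t a b))"
    unfolding sum_distrib_left by (intro sum.cong refl) (simp add: Ext_def Del_def)
  also have "\<dots> = 0" using step_mean[OF e _ ab] by simp
  finally show ?thesis by simp
qed

definition KK :: "real \<Rightarrow> (nat \<Rightarrow> real) \<Rightarrow> real" where "KK l h = ((3 + \<bar>l\<bar>) * hnorm h)\<^sup>2"

lemma KK_nonneg: "KK l h \<ge> 0" by (simp add: KK_def)

lemma Del_square:
  assumes e: "eig l h" and ab: "a \<in> VG m" "b \<in> VG m" and G: "\<And>t. G t \<ge> 0"
  shows "expectation (\<lambda>\<omega>. G (T m \<omega>) * (Del l h a b m (T (m+1) \<omega>))\<^sup>2)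
     \<le> expectation (\<lambda>\<omega>. G (T m \<omega>) * (KK l h * real (card (crossed m (T m \<omega>) a b))))"
proof -
  have "expectation (\<lambda>\<omega>. G (T m \<omega>) * (Del l h a b m (T (m+1) \<omega>))\<^sup>2)
      = expectation (\<lambda>\<omega>. (\<lambda>f. G (Tr m f) * (Del l h a b m f)\<^sup>2) (T (m+1) \<omega>))"
    by (rule Bochner_Integration.integral_cong) (simp_all add: cons)
  also have "\<dots> = (\<Sum>t\<in>trees m. \<Sum>f\<in>Ext m t. G (Tr m f) * (Del l h a b m f)\<^sup>2) / real (card (trees (m+1)))"
    by (rule expect(2)[of "\<lambda>f. G (Tr m f) * (Del l h a b m f)\<^sup>2" "m+1", unfolded sum_Ext])
  also have "\<dots> \<le> (\<Sum>t\<in>trees m. \<Sum>f\<in>Ext m t. G (Tr m f) * (KK l h * real (card (crossed m (Tr m f) a b)))) / real (card (trees (m+1)))"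
  proof (rule divide_right_mono[OF sum_mono])
    fix t assume t: "t \<in> trees m"
    have "(\<Sum>f\<in>Ext m t. G (Tr m f) * (Del l h a b m f)\<^sup>2)
       = G t * (\<Sum>f\<in>Ext m t. (SS h (m + 1) f a b - l * SS h m t a b)\<^sup>2)"
      unfolding sum_distrib_left by (intro sum.cong refl) (simp add: Ext_def Del_def)
    also have "\<dots> \<le> G t * (real (card (Ext m t)) * (KK l h * real (card (crossed m t a b))))"
      unfolding KK_def by (rule mult_left_mono[OF step_square[OF e t ab] G])
    also have "\<dots> = (\<Sum>f\<in>Ext m t. G t * (KK l h * real (card (crossed m t a b))))" by simp
    also have "\<dots> = (\<Sum>f\<in>Ext m t. G (Tr m f) * (KK l h * real (card (crossed m (Tr m f) a b))))"
      by (intro sum.cong refl) (simp add: Ext_def)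
    finally show "(\<Sum>f\<in>Ext m t. G (Tr m f) * (Del l h a b m f)\<^sup>2)
       \<le> (\<Sum>f\<in>Ext m t. G (Tr m f) * (KK l h * real (card (crossed m (Tr m f) a b))))" .
  qed simp
  also have "\<dots> =
     expectation (\<lambda>\<omega>. (\<lambda>f. G (Tr m f) * (KK l h * real (card (crossed m (Tr m f) a b)))) (T (m+1) \<omega>))"
    by (rule expect(2)[of "\<lambda>f. G (Tr m f) * (KK l h * real (card (crossed m (Tr m f) a b)))" "m+1", unfolded sum_Ext, symmetric])
  also have "\<dots> = expectation (\<lambda>\<omega>. G (T m \<omega>) * (KK l h * real (card (crossed m (T m \<omega>) a b))))"
    by (rule Bochner_Integration.integral_cong) (simp_all add: cons)
  finally show ?thesis .
qed

text \<open>Iterated trace. It exhibits \<open>T n\<close> as a function of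
  \<open>T (n + k)\<close>, so that \<open>expect\<close> covers functions of both.\<close>

fun bck :: "nat \<Rightarrow> nat \<Rightarrow> complex set set \<Rightarrow> complex set set" where
  "bck n 0 f = f"
| "bck n (Suc k) f = bck n k (Tr (n + k) f)"

lemma T_back: "\<omega> \<in> space M \<Longrightarrow> bck n k (T (n + k) \<omega>) = T n \<omega>"
  by (induction k) (simp_all add: cons)

lemma int_two: "integrable M (\<lambda>\<omega>. F (T n \<omega>) (T (n + k) \<omega>) :: real)"
proof -
  have "integrable M (\<lambda>\<omega>. (\<lambda>f. F (bck n k f) f) (T (n + k) \<omega>))" by (rule expect(1))
  also have "?this \<longleftrightarrow> ?thesis" by (rule Bochner_Integration.integrable_cong) (simp_all add: T_back)
  finally show ?thesis .
qed

lemma Del_mean':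
  assumes e: "eig l h" and ab: "a \<in> VG n" "b \<in> VG n"
  shows "expectation (\<lambda>\<omega>. G (T n \<omega>) (T (n+k) \<omega>) * Del l h a b (n+k) (T (n+k+1) \<omega>)) = 0"
proof -
  have "expectation (\<lambda>\<omega>. (\<lambda>f. G (bck n k f) f) (T (n+k) \<omega>) * Del l h a b (n+k) (T (n+k+1) \<omega>)) = 0"
    using ab VG_mono[of n "n+k"] by (intro Del_mean[OF e]) auto
  also have "expectation (\<lambda>\<omega>. (\<lambda>f. G (bck n k f) f) (T (n+k) \<omega>) * Del l h a b (n+k) (T (n+k+1) \<omega>))
      = expectation (\<lambda>\<omega>. G (T n \<omega>) (T (n+k) \<omega>) * Del l h a b (n+k) (T (n+k+1) \<omega>))"
    by (rule Bochner_Integration.integral_cong) (simp_all add: T_back)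
  finally show ?thesis .
qed

lemma Del_square':
  assumes e: "eig l h" and ab: "a \<in> VG n" "b \<in> VG n" and G: "\<And>t. G t \<ge> 0"
  shows "expectation (\<lambda>\<omega>. G (T n \<omega>) * (Del l h a b (n+k) (T (n+k+1) \<omega>))\<^sup>2)
     \<le> expectation (\<lambda>\<omega>. G (T n \<omega>) * (KK l h * real (card (crossed (n+k) (T (n+k) \<omega>) a b))))"
proof -
  have "expectation (\<lambda>\<omega>. G (T n \<omega>) * (Del l h a b (n+k) (T (n+k+1) \<omega>))\<^sup>2)
     = expectation (\<lambda>\<omega>. (\<lambda>f. G (bck n k f)) (T (n+k) \<omega>) * (Del l h a b (n+k) (T (n+k+1) \<omega>))\<^sup>2)"
    by (rule Bochner_Integration.integral_cong) (simp_all add: T_back)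
  also have "\<dots> \<le> expectation (\<lambda>\<omega>. (\<lambda>f. G (bck n k f)) (T (n+k) \<omega>) * (KK l h * real (card (crossed (n+k) (T (n+k) \<omega>) a b))))"
    using ab VG_mono[of n "n+k"] by (intro Del_square[OF e] G) auto
  also have "\<dots> = expectation (\<lambda>\<omega>. G (T n \<omega>) * (KK l h * real (card (crossed (n+k) (T (n+k) \<omega>) a b))))"
    by (rule Bochner_Integration.integral_cong) (simp_all add: T_back)
  finally show ?thesis .
qed

definition Z :: "(nat \<Rightarrow> real) \<Rightarrow> complex \<Rightarrow> complex \<Rightarrow> nat \<Rightarrow> 'w \<Rightarrow> real" where
  "Z h a b m \<omega> = SS h m (T m \<omega>) a b"

lemma Z_Suc: "\<omega> \<in> space M \<Longrightarrow> Z h a b (Suc m) \<omega> = l * Z h a b m \<omega> + Del l h a b m (T (m+1) \<omega>)"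
  by (simp add: Z_def Del_def cons)

lemma Z_mean:
  assumes e: "eig l h" and ab: "a \<in> VG n" "b \<in> VG n"
  shows "expectation (\<lambda>\<omega>. G (T n \<omega>) * Z h a b (n+k) \<omega>) = l ^ k * expectation (\<lambda>\<omega>. G (T n \<omega>) * Z h a b n \<omega>)"
proof (induction k)
  case (Suc k)
  have "expectation (\<lambda>\<omega>. G (T n \<omega>) * Z h a b (n + Suc k) \<omega>)
     = expectation (\<lambda>\<omega>. l * (G (T n \<omega>) * Z h a b (n+k) \<omega>) + G (T n \<omega>) * Del l h a b (n+k) (T (n+k+1) \<omega>))"
    by (rule Bochner_Integration.integral_cong) (simp_all add: Z_Suc[where l=l] algebra_simps)
  also have "\<dots> = expectation (\<lambda>\<omega>. l * (G (T n \<omega>) * Z h a b (n+k) \<omega>)) + expectation (\<lambda>\<omega>. G (T n \<omega>) * Del l h a b (n+k) (T (n+k+1) \<omega>))"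
    using int_two[of "\<lambda>t f. l * (G t * SS h (n+k) f a b)" n k] int_two[of "\<lambda>t f. G t * Del l h a b (n+k) f" n "k+1"]
    by (intro Bochner_Integration.integral_add) (simp_all add: Z_def add.assoc)
  finally show ?case using Suc Del_mean'[OF e ab, of "\<lambda>t f. G t" k] by simp
qed simp

text \<open>A sum of \<open>\<alpha>\<^sup>k\<close> many uncorrelated bounded terms is added in step \<open>k\<close>, and \<open>1 \<le> \<alpha> (\<alpha> - 1)\<close>.\<close>

lemma Z_square:
  assumes e: "eig l h" and ab: "a \<in> VG n" "b \<in> VG n" and G: "\<And>t. G t \<ge> 0"
    and h: "m > 0" "\<And>i. i \<in> {1,2,3} \<Longrightarrow> m \<le> h i" and l: "l \<ge> 2"
  shows "expectation (\<lambda>\<omega>. G (T n \<omega>) * (Z h a b (n+k) \<omega>)\<^sup>2)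
    \<le> l ^ (2 * k) * (expectation (\<lambda>\<omega>. G (T n \<omega>) * (Z h a b n \<omega>)\<^sup>2)
        + KK l h / m * expectation (\<lambda>\<omega>. G (T n \<omega>) * Z h a b n \<omega>) * (1 - (1/l)^k))"
proof (induction k)
  case (Suc k)
  let ?A = "expectation (\<lambda>\<omega>. G (T n \<omega>) * (Z h a b n \<omega>)\<^sup>2)" and ?B = "expectation (\<lambda>\<omega>. G (T n \<omega>) * Z h a b n \<omega>)"
  let ?D = "\<lambda>\<omega>. Del l h a b (n+k) (T (n+k+1) \<omega>)"
  have h0: "h 0 = 0" using e by (simp add: eig_def)
  have low: "m * real (card (crossed j t a b)) \<le> SS h j t a b" for j t
    by (rule SS_lower) (use h0 h(2) in auto)
  have B: "?B \<ge> 0"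
    by (rule integral_nonneg_AE) (use G low order_trans[OF _ low] h(1) in \<open>auto intro!: AE_I2 mult_nonneg_nonneg simp: Z_def\<close>)
  have "expectation (\<lambda>\<omega>. G (T n \<omega>) * (Z h a b (n + Suc k) \<omega>)\<^sup>2)
     = expectation (\<lambda>\<omega>. l\<^sup>2 * (G (T n \<omega>) * (Z h a b (n+k) \<omega>)\<^sup>2) +
        ((G (T n \<omega>) * 2 * l * Z h a b (n+k) \<omega>) * ?D \<omega> + G (T n \<omega>) * (?D \<omega>)\<^sup>2))"
    by (rule Bochner_Integration.integral_cong) (simp_all add: Z_Suc[where l=l] algebra_simps power2_eq_square)
  also have "\<dots> = expectation (\<lambda>\<omega>. l\<^sup>2 * (G (T n \<omega>) * (Z h a b (n+k) \<omega>)\<^sup>2)) +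
        (expectation (\<lambda>\<omega>. (G (T n \<omega>) * 2 * l * Z h a b (n+k) \<omega>) * ?D \<omega>) + expectation (\<lambda>\<omega>. G (T n \<omega>) * (?D \<omega>)\<^sup>2))"
  proof -
    have 1: "integrable M (\<lambda>\<omega>. l\<^sup>2 * (G (T n \<omega>) * (Z h a b (n+k) \<omega>)\<^sup>2))"
      using int_two[of "\<lambda>t f. l\<^sup>2 * (G t * (SS h (n+k) f a b)\<^sup>2)" n k] by (simp add: Z_def)
    have 2: "integrable M (\<lambda>\<omega>. G (T n \<omega>) * (?D \<omega>)\<^sup>2)"
      using int_two[of "\<lambda>t f. G t * (Del l h a b (n+k) f)\<^sup>2" n "k+1"] by (simp add: add.assoc)
    have 3: "integrable M (\<lambda>\<omega>. (G (T n \<omega>) * 2 * l * Z h a b (n+k) \<omega>) * ?D \<omega>)"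
    proof -
      have "integrable M (\<lambda>\<omega>. (\<lambda>f. G (bck n (k+1) f) * 2 * l * SS h (n+k) (Tr (n+k) f) a b * Del l h a b (n+k) f) (T (n+k+1) \<omega>))"
        by (rule expect(1))
      also have "?this \<longleftrightarrow> ?thesis"
        by (rule Bochner_Integration.integrable_cong) (simp_all add: T_back Z_def cons)
      finally show ?thesis .
    qed
    show ?thesis
      by (subst Bochner_Integration.integral_add[OF 1 Bochner_Integration.integrable_add[OF 3 2]],
          subst Bochner_Integration.integral_add[OF 3 2]) simp
  qed
  \<comment> \<open>The mixed term has mean zero. The squared increment is bounded by the number of
    crossed cells, hence by a multiple of \<open>Z\<close>, whose mean grows like
    \<open>l ^ k\<close>.\<close>
  also have "\<dots> \<le> l\<^sup>2 * expectation (\<lambda>\<omega>. G (T n \<omega>) * (Z h a b (n+k) \<omega>)\<^sup>2) + KK l h / m * (l ^ k * ?B)"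
  proof -
    have x1: "expectation (\<lambda>\<omega>. (G (T n \<omega>) * 2 * l * Z h a b (n+k) \<omega>) * ?D \<omega>) = 0"
      using Del_mean'[OF e ab, of "\<lambda>t f. G t * 2 * l * SS h (n+k) f a b" k] by (simp add: Z_def)
    have x2: "expectation (\<lambda>\<omega>. G (T n \<omega>) * (?D \<omega>)\<^sup>2) \<le>
        expectation (\<lambda>\<omega>. G (T n \<omega>) * (KK l h * real (card (crossed (n+k) (T (n+k) \<omega>) a b))))"
      by (rule Del_square'[OF e ab G])
    have x3: "expectation (\<lambda>\<omega>. G (T n \<omega>) * (KK l h * real (card (crossed (n+k) (T (n+k) \<omega>) a b))))
        \<le> expectation (\<lambda>\<omega>. KK l h / m * (G (T n \<omega>) * Z h a b (n+k) \<omega>))"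
    proof (rule integral_mono)
      show "integrable M (\<lambda>\<omega>. G (T n \<omega>) * (KK l h * real (card (crossed (n+k) (T (n+k) \<omega>) a b))))"
        using int_two[of "\<lambda>t f. G t * (KK l h * real (card (crossed (n+k) f a b)))" n k] by simp
      show "integrable M (\<lambda>\<omega>. KK l h / m * (G (T n \<omega>) * Z h a b (n+k) \<omega>))"
        using int_two[of "\<lambda>t f. KK l h / m * (G t * SS h (n+k) f a b)" n k] by (simp add: Z_def)
      fix \<omega>
      have "real (card (crossed (n+k) (T (n+k) \<omega>) a b)) \<le> Z h a b (n+k) \<omega> / m"
        using low[of "n+k" "T (n+k) \<omega>"] h(1) by (simp add: Z_def field_simps)
      then have "G (T n \<omega>) * (KK l h * real (card (crossed (n+k) (T (n+k) \<omega>) a b))) \<le> G (T n \<omega>) * (KK l h * (Z h a b (n+k) \<omega> / m))"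
        by (intro mult_left_mono G KK_nonneg)
      then show "G (T n \<omega>) * (KK l h * real (card (crossed (n+k) (T (n+k) \<omega>) a b))) \<le> KK l h / m * (G (T n \<omega>) * Z h a b (n+k) \<omega>)"
        by (simp add: mult_ac)
    qed
    have x4: "expectation (\<lambda>\<omega>. KK l h / m * (G (T n \<omega>) * Z h a b (n+k) \<omega>)) = KK l h / m * (l ^ k * ?B)"
      by (simp only: integral_mult_right_zero Z_mean[OF e ab, of G k])
    have "expectation (\<lambda>\<omega>. l\<^sup>2 * (G (T n \<omega>) * (Z h a b (n+k) \<omega>)\<^sup>2)) = l\<^sup>2 * expectation (\<lambda>\<omega>. G (T n \<omega>) * (Z h a b (n+k) \<omega>)\<^sup>2)"
      by (rule integral_mult_right_zero)
    then show ?thesis using x1 order_trans[OF x2 order_trans[OF x3 eq_refl[OF x4]]] by linarith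
  qed
  also have "\<dots> \<le> l\<^sup>2 * (l ^ (2 * k) * (?A + KK l h / m * ?B * (1 - (1/l)^k))) + KK l h / m * (l ^ k * ?B)"
    using Suc by (intro add_right_mono mult_left_mono) auto
  also have "\<dots> \<le> l ^ (2 * Suc k) * (?A + KK l h / m * ?B * (1 - (1/l)^Suc k))"
  proof -
    define C where "C = KK l h / m * ?B"
    have C: "C \<ge> 0" unfolding C_def using KK_nonneg B h(1) by (intro mult_nonneg_nonneg divide_nonneg_pos) auto
    have l0: "l > 0" using l by simp
    have p: "l ^ (2 * Suc k) * (1/l)^k = l ^ k * l\<^sup>2" "l ^ (2 * Suc k) * (1/l)^Suc k = l ^ k * l" 
      using l0 by (simp_all add: power_one_over field_simps power2_eq_square power_mult_distrib mult_2 mult_2_right power_add)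
    have "l ^ k * C \<le> l ^ k * C * (l * (l - 1))"
    proof -
      have "1 \<le> l * (l - 1)" using mult_mono[of 1 l 1 "l - 1"] l by simp
      then have "l ^ k * C * 1 \<le> l ^ k * C * (l * (l - 1))" using C l0 by (intro mult_left_mono) auto
      then show ?thesis by simp
    qed
    then have 1: "l ^ k * C \<le> C * (l ^ k * l\<^sup>2) - C * (l ^ k * l)" by (simp add: algebra_simps power2_eq_square)
    have "l\<^sup>2 * (l ^ (2 * k) * (?A + C * (1 - (1/l)^k))) + C * l ^ k
       = l ^ (2 * Suc k) * ?A + C * l ^ (2 * Suc k) - C * (l ^ (2 * Suc k) * (1/l)^k) + l ^ k * C"
      by (simp add: algebra_simps power2_eq_square)
    also have "\<dots> \<le> l ^ (2 * Suc k) * ?A + C * l ^ (2 * Suc k) - C * (l ^ (2 * Suc k) * (1/l)^Suc k)"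
      unfolding p using 1 by simp
    also have "\<dots> = l ^ (2 * Suc k) * (?A + C * (1 - (1/l)^Suc k))" by (simp add: algebra_simps)
    finally show ?thesis unfolding C_def by (simp add: mult_ac)
  qed
  finally show ?case .
qed simp

end

section \<open>Almost sure convergence\<close>

text \<open>\<open>alpha_bar\<close> and \<open>beta_bar\<close> are the roots of 15 l^2 - 40 l +
  13, the factor of the characteristic polynomial of the mean matrix that remains besides l.\<close>

lemma alpha_quad: "15 * alpha_bar\<^sup>2 = 40 * alpha_bar - 13"
  by (simp add: alpha_bar_def power2_eq_square field_simps)

lemma sqrt205: "14 < sqrt 205" "sqrt 205 < 15"
proof -
  show "14 < sqrt 205" by (rule real_less_rsqrt) simp
  show "sqrt 205 < 15" by (rule real_less_lsqrt) simp_all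
qed

lemma alpha_bounds: "2 < alpha_bar" "alpha_bar < 3"
  using sqrt205 by (simp_all add: alpha_bar_def)

definition beta_bar :: real where "beta_bar = 4/3 - sqrt 205 / 15"

lemma beta_quad: "15 * beta_bar\<^sup>2 = 40 * beta_bar - 13"
  by (simp add: beta_bar_def power2_eq_square field_simps)

lemma beta_bounds: "0 < beta_bar" "beta_bar < 1"
  using sqrt205 by (simp_all add: beta_bar_def)

text \<open>Right eigenvectors of the offspring mean matrix; \<open>y = (2 h 2 + h 3) / 3\<close> is the mean weight of
  a crossing of a cell whose state is a uniform spanning tree.\<close>

definition mkh :: "real \<Rightarrow> nat \<Rightarrow> real" where
  "mkh l i = (let y = (l - 1) * 5 / 6 in
     if i = 0 then 0 else if i = 1 then 1 else if i = 2 then (1/2 + 3/2 * y) / l else (1 + 2 * y) / l)"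

lemma mkh_simps: "mkh l 0 = 0" "mkh l 1 = 1" "mkh l (Suc 0) = 1" "mkh l 2 = (1/2 + 3/2 * ((l - 1) * 5 / 6)) / l"
   "mkh l 3 = (1 + 2 * ((l - 1) * 5 / 6)) / l"
  by (simp_all add: mkh_def Let_def)

text \<open>In \<open>mkh\<close> the values at 2 and 3 come from the second and third equation of
  \<open>eig\<close>, and \<open>y\<close> from the first; the quadratic equation is the condition
  that they fit together.\<close>

lemma mkh_sum: assumes "15 * l\<^sup>2 = 40 * l - 13" "l \<noteq> 0" shows "2 * mkh l 2 + mkh l 3 = (l - 1) * 5 / 2"
proof -
  have "l * (2 * mkh l 2 + mkh l 3) = 2 * (l * mkh l 2) + l * mkh l 3" by (simp add: algebra_simps)
  also have "\<dots> = 2 * (1/2 + 3/2 * ((l - 1) * 5 / 6)) + (1 + 2 * ((l - 1) * 5 / 6))" 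
    using assms(2) by (simp add: mkh_simps)
  also have "\<dots> = l * ((l - 1) * 5 / 2)" using assms(1) by (simp add: field_simps power2_eq_square)
  finally show ?thesis using assms(2) by simp
qed

lemma eig_mkh: assumes "15 * l\<^sup>2 = 40 * l - 13" "l \<noteq> 0" shows "eig l (mkh l)"
proof -
  note s = mkh_sum[OF assms]
  have 1: "mkh l 1 = 1" "mkh l 0 = 0" by (simp_all add: mkh_simps)
  have 2: "l * mkh l 2 = 1/2 + 3/2 * ((l - 1) * 5 / 6)" "l * mkh l 3 = 1 + 2 * ((l - 1) * 5 / 6)"
    using assms(2) by (simp_all add: mkh_simps)
  have "30 * 1 + 24 * mkh l 2 + 12 * mkh l 3 = 30 * l" using s by (simp add: field_simps)
  moreover have "9 * 1 + 18 * mkh l 2 + 9 * mkh l 3 = 18 * (l * mkh l 2)" unfolding 2 using s by (simp add: field_simps)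
  moreover have "18 * 1 + 24 * mkh l 2 + 12 * mkh l 3 = 18 * (l * mkh l 3)" unfolding 2 using s by (simp add: field_simps)
  ultimately show ?thesis unfolding eig_def 1 by (simp add: mult.assoc)
qed

text \<open>Eigenvector for the eigenvalue 0, read off from the ratio 2 : 1 of the last two columns
  of the mean matrix.\<close>

definition h3 :: "nat \<Rightarrow> real" where "h3 i = (if i = 2 then 1 else if i = 3 then - 2 else 0)"

lemma eig_h3: "eig 0 h3" by (simp add: eig_def h3_def)

abbreviation "h1 \<equiv> mkh alpha_bar"
abbreviation "h2 \<equiv> mkh beta_bar"

lemma eig_h1: "eig alpha_bar h1" using eig_mkh[OF alpha_quad] alpha_bounds by simp
lemma eig_h2: "eig beta_bar h2" using eig_mkh[OF beta_quad] beta_bounds by simp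

lemma h1_pos: "i \<in> {1,2,3} \<Longrightarrow> 1/10 \<le> h1 i"
proof -
  assume i: "i \<in> {1,2,3}"
  have "1/10 * alpha_bar \<le> 1/2 + 3/2 * ((alpha_bar - 1) * 5 / 6)"
    "1/10 * alpha_bar \<le> 1 + 2 * ((alpha_bar - 1) * 5 / 6)" using alpha_bounds by argo+
  then have "1/10 \<le> h1 2" "1/10 \<le> h1 3" using alpha_bounds by (simp_all add: mkh_simps le_divide_eq)
  then show ?thesis using i by (auto simp: mkh_simps)
qed

text \<open>The three eigenvectors span all weights that vanish at 0, so the length obeys the
  asymptotics of the dominant one.\<close>

lemma hlen_decomp: "\<exists>c1 c2 c3. \<forall>i\<in>{0,1,2,3}. hlen i = c1 * h1 i + c2 * h2 i + c3 * h3 i"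
proof -
  have a0: "alpha_bar \<noteq> 0" and b0: "beta_bar \<noteq> 0" using alpha_bounds beta_bounds by auto
  define y1 where "y1 = (alpha_bar - 1) * 5 / 6"
  define y2 where "y2 = (beta_bar - 1) * 5 / 6"
  have ne: "y1 - y2 \<noteq> 0" using alpha_bounds beta_bounds by (simp add: field_simps y1_def y2_def)
  \<comment> \<open>Type 1 forces \<open>c1 + c2 = 1\<close>. The mean length over types 2 and 3 in
    the proportion 2 : 1 is 4/3 and fixes \<open>c1\<close>. Finally \<open>h3\<close>, which has
    mean zero in this proportion, adjusts the single values.\<close>
  define c1 where "c1 = (4/3 - y2) / (y1 - y2)"
  define c2 where "c2 = 1 - c1"
  define c3 where "c3 = 1 - c1 * h1 2 - c2 * h2 2"
  have "c1 * (y1 - y2) = 4/3 - y2" using ne by (simp add: c1_def)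
  then have cy: "c1 * y1 + c2 * y2 = 4/3" by (simp add: c2_def algebra_simps)
  have a: "h1 3 = 3 * y1 - 2 * h1 2" using mkh_sum[OF alpha_quad a0] unfolding y1_def by argo
  have b: "h2 3 = 3 * y2 - 2 * h2 2" using mkh_sum[OF beta_quad b0] unfolding y2_def by argo
  have "c1 * h1 3 + c2 * h2 3 = 3 * (c1 * y1 + c2 * y2) - 2 * (c1 * h1 2 + c2 * h2 2)"
    unfolding a b by (simp only: algebra_simps)
  then have 3: "hlen 3 = c1 * h1 3 + c2 * h2 3 + c3 * h3 3" unfolding cy by (simp add: hlen_def h3_def c3_def)
  have 2: "hlen 2 = c1 * h1 2 + c2 * h2 2 + c3 * h3 2" by (simp add: hlen_def h3_def c3_def)
  have 1: "hlen 1 = c1 * h1 1 + c2 * h2 1 + c3 * h3 1" by (simp add: hlen_def h3_def c2_def mkh_simps del: One_nat_def)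
  have 0: "hlen 0 = c1 * h1 0 + c2 * h2 0 + c3 * h3 0" by (simp add: hlen_def h3_def mkh_simps)
  show ?thesis using 0 1 2 3 by (intro exI[of _ c1] exI[of _ c2] exI[of _ c3]) blast
qed

lemma recursion_converges:
  fixes x \<epsilon> :: "nat \<Rightarrow> real"
  assumes "\<And>k. x (Suc k) = x k + \<epsilon> k" "summable \<epsilon>" shows "convergent x"
proof -
  have "x = (\<lambda>k. x 0 + sum \<epsilon> {..<k})"
  proof
    fix k show "x k = x 0 + sum \<epsilon> {..<k}" using assms(1) by (induction k) auto
  qed
  moreover have "(\<lambda>k. x 0 + sum \<epsilon> {..<k}) \<longlonglongrightarrow> x 0 + suminf \<epsilon>"
    using summable_LIMSEQ[OF assms(2)] by (intro tendsto_intros)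
  ultimately show ?thesis unfolding convergent_def by metis
qed

text \<open>Summing the recursion bounds the partial sums of \<open>\<bar>x k\<bar>\<close> in terms
  of the errors; hence \<open>x\<close> is absolutely summable.\<close>

lemma recursion_vanishes:
  fixes x \<epsilon> :: "nat \<Rightarrow> real"
  assumes x: "\<And>k. x (Suc k) = r * x k + \<epsilon> k" and e: "summable (\<lambda>k. \<bar>\<epsilon> k\<bar>)" and r: "\<bar>r\<bar> < 1"
  shows "x \<longlonglongrightarrow> 0"
proof -
  have b: "(\<Sum>k<n. \<bar>x k\<bar>) \<le> (\<bar>x 0\<bar> + (\<Sum>k. \<bar>\<epsilon> k\<bar>)) / (1 - \<bar>r\<bar>)" for n
  proof -
    have "(\<Sum>k<n. \<bar>x k\<bar>) \<le> (\<Sum>k<Suc n. \<bar>x k\<bar>)" by simp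
    also have "\<dots> = \<bar>x 0\<bar> + (\<Sum>k<n. \<bar>x (Suc k)\<bar>)" by (rule sum.lessThan_Suc_shift)
    also have "(\<Sum>k<n. \<bar>x (Suc k)\<bar>) \<le> (\<Sum>k<n. \<bar>r\<bar> * \<bar>x k\<bar> + \<bar>\<epsilon> k\<bar>)"
      by (intro sum_mono) (simp add: x abs_mult[symmetric] abs_triangle_ineq)
    also have "\<dots> = \<bar>r\<bar> * (\<Sum>k<n. \<bar>x k\<bar>) + (\<Sum>k<n. \<bar>\<epsilon> k\<bar>)" by (simp add: sum.distrib sum_distrib_left)
    also have "(\<Sum>k<n. \<bar>\<epsilon> k\<bar>) \<le> (\<Sum>k. \<bar>\<epsilon> k\<bar>)" by (rule sum_le_suminf[OF e]) auto
    finally have "(1 - \<bar>r\<bar>) * (\<Sum>k<n. \<bar>x k\<bar>) \<le> \<bar>x 0\<bar> + (\<Sum>k. \<bar>\<epsilon> k\<bar>)" by (simp add: algebra_simps)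
    then show ?thesis using r by (simp add: pos_le_divide_eq mult.commute)
  qed
  have "summable (\<lambda>k. \<bar>x k\<bar>)" by (rule summableI_nonneg_bounded[OF _ b]) simp
  then show ?thesis using summable_LIMSEQ_zero tendsto_rabs_zero_iff by blast
qed

context ust begin

text \<open>\<open>h1\<close> is at least 1/10 on every type, so \<open>10 * Z h1\<close> dominates
  the number of crossings, and its mean grows exactly by the factor
  \<open>alpha_bar\<close>.\<close>

lemma crossed_mean:
  assumes ab: "a \<in> VG n" "b \<in> VG n"
  shows "expectation (\<lambda>\<omega>. real (card (crossed (n+k) (T (n+k) \<omega>) a b))) \<le> alpha_bar ^ k * (10 * expectation (Z h1 a b n))"
proof -
  have "expectation (\<lambda>\<omega>. real (card (crossed (n+k) (T (n+k) \<omega>) a b))) \<le> expectation (\<lambda>\<omega>. 10 * Z h1 a b (n+k) \<omega>)"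
  proof (rule integral_mono)
    show "integrable M (\<lambda>\<omega>. real (card (crossed (n+k) (T (n+k) \<omega>) a b)))" by (rule expect(1))
    show "integrable M (\<lambda>\<omega>. 10 * Z h1 a b (n+k) \<omega>)" unfolding Z_def by (rule expect(1))
    show "real (card (crossed (n+k) (T (n+k) \<omega>) a b)) \<le> 10 * Z h1 a b (n+k) \<omega>" for \<omega>
      using SS_lower[of h1 "1/10" "n+k" "T (n+k) \<omega>" a b] h1_pos by (simp add: Z_def mkh_simps)
  qed
  also have "\<dots> = 10 * (alpha_bar ^ k * expectation (Z h1 a b n))"
    using Z_mean[OF eig_h1 ab, of "\<lambda>_. 1" k] by simp
  finally show ?thesis by simp
qed

text \<open>The second moments of the increments are of order \<open>alpha_bar ^ k\<close> for every
  eigenvalue \<open>l\<close>, so the first moments divided by \<open>alpha_bar ^ k\<close> decay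
  geometrically. A series with summable first moments converges absolutely almost surely.\<close>

lemma Del_summable:
  assumes e: "eig l h" and ab: "a \<in> VG n" "b \<in> VG n"
  shows "AE \<omega> in M. summable (\<lambda>k. \<bar>Del l h a b (n+k) (T (n+k+1) \<omega>)\<bar> / alpha_bar ^ k)"
proof -
  let ?D = "\<lambda>k \<omega>. Del l h a b (n+k) (T (n+k+1) \<omega>)"
  let ?f = "\<lambda>k \<omega>. \<bar>?D k \<omega>\<bar> / alpha_bar ^ k"
  define C where "C = KK l h * (10 * expectation (Z h1 a b n))"
  have a0: "alpha_bar > 0" using alpha_bounds by simp
  have fi: "integrable M (?f k)" for k
    using expect(1)[of "\<lambda>f. \<bar>Del l h a b (n+k) f\<bar> / alpha_bar ^ k" "n+k+1"] by simp
  have bound: "expectation (?f k) \<le> ((3/2) / alpha_bar) ^ k + C * (2/3) ^ k" for k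
  proof -
    have sq: "expectation (\<lambda>\<omega>. (?D k \<omega>)\<^sup>2) \<le> C * alpha_bar ^ k"
    proof -
      have "expectation (\<lambda>\<omega>. (?D k \<omega>)\<^sup>2) \<le> KK l h * expectation (\<lambda>\<omega>. real (card (crossed (n+k) (T (n+k) \<omega>) a b)))"
        using Del_square'[OF e ab, of "\<lambda>_. 1" k] by simp
      also have "\<dots> \<le> KK l h * (alpha_bar ^ k * (10 * expectation (Z h1 a b n)))"
        by (rule mult_left_mono[OF crossed_mean[OF ab] KK_nonneg])
      finally show ?thesis by (simp add: C_def mult_ac)
    qed
    \<comment> \<open>With A = (3/2)^k, either |x| is at most A or it is at most x^2 / A. A base
      strictly between 1 and \<open>alpha_bar\<close> makes both resulting geometric series
      converge.\<close>
    have pw: "\<bar>x\<bar> / alpha_bar ^ k \<le> ((3/2) / alpha_bar) ^ k + x\<^sup>2 * ((2/3)^k / alpha_bar ^ k)" for x :: real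
    proof -
      have "\<bar>x\<bar> \<le> (3/2)^k + x\<^sup>2 * (2/3)^k"
      proof (cases "\<bar>x\<bar> \<le> (3/2)^k")
        case True then show ?thesis by (simp add: add_increasing2)
      next
        case False
        have one: "(3/2)^k * (2/3)^k = (1::real)" by (simp flip: power_mult_distrib)
        have "\<bar>x\<bar> * ((3/2)^k * (2/3)^k) \<le> \<bar>x\<bar> * (\<bar>x\<bar> * (2/3)^k)"
          using False by (intro mult_left_mono mult_right_mono) auto
        also have "\<dots> = x\<^sup>2 * (2/3)^k" by (simp add: power2_eq_square flip: mult.assoc abs_mult)
        finally have "\<bar>x\<bar> \<le> x\<^sup>2 * (2/3)^k" unfolding one by simp
        moreover have "0 \<le> (3/2::real)^k" by simp
        ultimately show ?thesis by (rule add_increasing[rotated])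
      qed
      then have "\<bar>x\<bar> / alpha_bar ^ k \<le> ((3/2)^k + x\<^sup>2 * (2/3)^k) / alpha_bar ^ k"
        using a0 by (intro divide_right_mono) auto
      then show ?thesis by (simp add: power_divide add_divide_distrib)
    qed
    have "expectation (?f k) \<le> expectation (\<lambda>\<omega>. ((3/2) / alpha_bar) ^ k + (?D k \<omega>)\<^sup>2 * ((2/3)^k / alpha_bar ^ k))"
    proof (rule integral_mono[OF fi])
      show "integrable M (\<lambda>\<omega>. ((3/2) / alpha_bar) ^ k + (?D k \<omega>)\<^sup>2 * ((2/3)^k / alpha_bar ^ k))"
        using expect(1)[of "\<lambda>f. ((3/2) / alpha_bar) ^ k + (Del l h a b (n+k) f)\<^sup>2 * ((2/3)^k / alpha_bar ^ k)" "n+k+1"] by simp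
    qed (rule pw)
    also have "\<dots> = ((3/2) / alpha_bar) ^ k + expectation (\<lambda>\<omega>. (?D k \<omega>)\<^sup>2) * ((2/3)^k / alpha_bar ^ k)"
      using expect(1)[of "\<lambda>f. (Del l h a b (n+k) f)\<^sup>2 * ((2/3)^k / alpha_bar ^ k)" "n+k+1"]
      by (subst Bochner_Integration.integral_add) (simp_all add: prob_space)
    also have "\<dots> \<le> ((3/2) / alpha_bar) ^ k + (C * alpha_bar ^ k) * ((2/3)^k / alpha_bar ^ k)"
      using sq a0 by (intro add_left_mono mult_right_mono) auto
    finally show ?thesis using a0 by simp
  qed
  have s: "summable (\<lambda>k. expectation (?f k))"
  proof (rule summable_comparison_test'[where N=0])
    show "summable (\<lambda>k. ((3/2) / alpha_bar) ^ k + C * (2/3) ^ k)"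
      using alpha_bounds by (intro summable_add summable_mult summable_geometric) auto
    show "norm (expectation (?f k)) \<le> ((3/2) / alpha_bar) ^ k + C * (2/3) ^ k" for k
      using bound[of k] a0 by (simp add: abs_of_nonneg integral_nonneg_AE)
  qed
  have "(\<integral>\<^sup>+\<omega>. (\<Sum>k. ennreal (?f k \<omega>)) \<partial>M) = (\<Sum>k. \<integral>\<^sup>+\<omega>. ennreal (?f k \<omega>) \<partial>M)"
    using fi by (intro nn_integral_suminf) (auto intro: borel_measurable_integrable)
  also have "\<dots> = (\<Sum>k. ennreal (expectation (?f k)))"
    using a0 by (intro suminf_cong nn_integral_eq_integral fi) auto
  also have "\<dots> = ennreal (\<Sum>k. expectation (?f k))"
    using a0 by (intro suminf_ennreal2 s integral_nonneg_AE) auto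
  finally have "(\<integral>\<^sup>+\<omega>. (\<Sum>k. ennreal (?f k \<omega>)) \<partial>M) \<noteq> \<infinity>" by simp
  then have "AE \<omega> in M. (\<Sum>k. ennreal (?f k \<omega>)) \<noteq> \<infinity>"
    using fi by (intro nn_integral_PInf_AE borel_measurable_suminf_order) (auto intro!: borel_measurable_integrable measurable_compose[OF _ measurable_ennreal])
  then show ?thesis
  proof (rule AE_mp, intro AE_I2 impI)
    fix \<omega> assume "(\<Sum>k. ennreal (?f k \<omega>)) \<noteq> \<infinity>"
    then show "summable (\<lambda>k. ?f k \<omega>)" using a0 by (intro summable_suminf_not_top) auto
  qed
qed

text \<open>The martingale limit, comparable to \<open>dstar\<close> up to constant factors by
  \<open>tdist_lim\<close>.\<close>

definition W :: "complex \<Rightarrow> complex \<Rightarrow> 'w \<Rightarrow> real" where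
  "W a b \<omega> = lim (\<lambda>m. Z h1 a b m \<omega> / alpha_bar ^ m)"

lemma AE_space2: "AE \<omega> in M. \<omega> \<in> space M" by (rule AE_space)

lemma lim_shift: "(\<lambda>k. F (n + k)) \<longlonglongrightarrow> L \<Longrightarrow> F \<longlonglongrightarrow> L" for F :: "nat \<Rightarrow> real"
  by (rule LIMSEQ_offset[of _ n]) (simp add: add.commute)

lemma W_lim:
  assumes ab: "a \<in> VG n" "b \<in> VG n"
  shows "AE \<omega> in M. (\<lambda>m. Z h1 a b m \<omega> / alpha_bar ^ m) \<longlonglongrightarrow> W a b \<omega>"
  using Del_summable[OF eig_h1 ab] AE_space2
proof eventually_elim
  case (elim \<omega>)
  have a0: "alpha_bar > 0" using alpha_bounds by simp
  let ?x = "\<lambda>k. Z h1 a b (n+k) \<omega> / alpha_bar ^ k"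
  have "summable (\<lambda>k. Del alpha_bar h1 a b (n+k) (T (n+k+1) \<omega>) / alpha_bar ^ k)"
    by (rule summable_rabs_cancel) (use elim(1) a0 in \<open>simp add: abs_divide\<close>)
  then have "summable (\<lambda>k. Del alpha_bar h1 a b (n+k) (T (n+k+1) \<omega>) / alpha_bar ^ k / alpha_bar)"
    by (rule summable_divide)
  moreover have "?x (Suc k) = ?x k + Del alpha_bar h1 a b (n+k) (T (n+k+1) \<omega>) / alpha_bar ^ k / alpha_bar" for k
    using Z_Suc[OF elim(2), of h1 a b "n+k" alpha_bar] a0 by (simp add: field_simps)
  ultimately have "convergent ?x" by (rule recursion_converges[of ?x, rotated])
  then obtain L where "?x \<longlonglongrightarrow> L" by (auto simp: convergent_def)
  then have "(\<lambda>k. ?x k / alpha_bar ^ n) \<longlonglongrightarrow> L / alpha_bar ^ n" using a0 by (intro tendsto_intros) auto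
  then have "(\<lambda>k. Z h1 a b (n+k) \<omega> / alpha_bar ^ (n+k)) \<longlonglongrightarrow> L / alpha_bar ^ n"
    by (simp add: power_add mult.commute)
  then have "(\<lambda>m. Z h1 a b m \<omega> / alpha_bar ^ m) \<longlonglongrightarrow> L / alpha_bar ^ n" by (rule lim_shift)
  then show ?case unfolding W_def by (simp add: limI)
qed

text \<open>After normalisation the recursion contracts by the factor \<open>l / alpha_bar\<close>,
  with summable errors.\<close>

lemma Z_vanish:
  assumes e: "eig l h" and l: "\<bar>l\<bar> < alpha_bar" and ab: "a \<in> VG n" "b \<in> VG n"
  shows "AE \<omega> in M. (\<lambda>m. Z h a b m \<omega> / alpha_bar ^ m) \<longlonglongrightarrow> 0"
  using Del_summable[OF e ab] AE_space2
proof eventually_elim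
  case (elim \<omega>)
  have a0: "alpha_bar > 0" using alpha_bounds by simp
  let ?x = "\<lambda>k. Z h a b (n+k) \<omega> / alpha_bar ^ k"
  let ?e = "\<lambda>k. Del l h a b (n+k) (T (n+k+1) \<omega>) / alpha_bar ^ k / alpha_bar"
  have "summable (\<lambda>k. \<bar>Del l h a b (n+k) (T (n+k+1) \<omega>)\<bar> / alpha_bar ^ k / alpha_bar)"
    using elim(1) by (rule summable_divide)
  then have s: "summable (\<lambda>k. \<bar>?e k\<bar>)" using a0 by (simp add: abs_divide)
  have r: "?x (Suc k) = (l / alpha_bar) * ?x k + ?e k" for k
    using Z_Suc[OF elim(2), of h a b "n+k" l] a0 by (simp add: field_simps)
  have "\<bar>l / alpha_bar\<bar> < 1" using l a0 by (simp add: abs_divide)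
  then have "?x \<longlonglongrightarrow> 0" by (rule recursion_vanishes[of ?x, OF r s])
  then have "(\<lambda>k. ?x k / alpha_bar ^ n) \<longlonglongrightarrow> 0 / alpha_bar ^ n" using a0 by (intro tendsto_intros) auto
  then have "(\<lambda>k. Z h a b (n+k) \<omega> / alpha_bar ^ (n+k)) \<longlonglongrightarrow> 0"
    by (simp add: power_add mult.commute)
  then show ?case by (rule lim_shift)
qed

text \<open>By \<open>hlen_decomp\<close> the distance is a combination of three eigenvector
  weights, of which only the one for \<open>alpha_bar\<close> survives. The two comparisons carry
  positivity and smallness from \<open>W\<close> over to \<open>dstar\<close>; the constant 40 is
  \<open>hnorm hlen = 4\<close> divided by the lower bound 1/10 of \<open>h1\<close>.\<close>

lemma tdist_lim:
  assumes ab: "a \<in> VG n" "b \<in> VG n"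
  shows "AE \<omega> in M. (\<lambda>m. real (tdist (T m \<omega>) a b) / alpha_bar ^ m) \<longlonglongrightarrow> dstar T \<omega> a b \<and>
    W a b \<omega> \<le> hnorm h1 * dstar T \<omega> a b \<and> dstar T \<omega> a b \<le> 40 * W a b \<omega>"
proof -
  have all: "AE \<omega> in M. \<forall>m. T m \<omega> \<in> trees m" using AE_tree by (simp add: AE_all_countable)
  have b: "\<bar>beta_bar\<bar> < alpha_bar" "\<bar>0\<bar> < alpha_bar" using alpha_bounds beta_bounds by auto
  show ?thesis
    using W_lim[OF ab] Z_vanish[OF eig_h2 b(1) ab] Z_vanish[OF eig_h3 b(2) ab] all
  proof eventually_elim
    case (elim \<omega>)
    obtain c1 c2 c3 where c: "\<And>i. i \<in> {0,1,2,3} \<Longrightarrow> hlen i = c1 * h1 i + c2 * h2 i + c3 * h3 i"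
      using hlen_decomp by blast
    have ev: "eventually (\<lambda>m. m \<ge> n) sequentially" by (rule eventually_ge_at_top)
    have td: "real (tdist (T m \<omega>) a b) = Z hlen a b m \<omega>" if "m \<ge> n" for m
      using tdist_SS[of "T m \<omega>" m a b] elim(4) ab VG_mono[OF that] by (auto simp: Z_def)
    have wl: "wt hlen s p = c1 * wt h1 s p + c2 * wt h2 s p + c3 * wt h3 s p" for s p
      unfolding wt_def by (rule c) auto
    have Zl: "Z hlen a b m \<omega> = c1 * Z h1 a b m \<omega> + c2 * Z h2 a b m \<omega> + c3 * Z h3 a b m \<omega>" for m
      unfolding Z_def SS_def wl by (simp add: sum.distrib sum_distrib_left)
    have "(\<lambda>m. c1 * (Z h1 a b m \<omega> / alpha_bar ^ m) + c2 * (Z h2 a b m \<omega> / alpha_bar ^ m) + c3 * (Z h3 a b m \<omega> / alpha_bar ^ m))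
       \<longlonglongrightarrow> c1 * W a b \<omega> + c2 * 0 + c3 * 0"
      by (intro tendsto_intros elim)
    then have "(\<lambda>m. Z hlen a b m \<omega> / alpha_bar ^ m) \<longlonglongrightarrow> c1 * W a b \<omega>"
      unfolding Zl by (simp add: add_divide_distrib)
    then have L: "(\<lambda>m. real (tdist (T m \<omega>) a b) / alpha_bar ^ m) \<longlonglongrightarrow> c1 * W a b \<omega>"
    proof (rule Lim_transform_eventually)
      show "\<forall>\<^sub>F m in sequentially. Z hlen a b m \<omega> / alpha_bar ^ m = real (tdist (T m \<omega>) a b) / alpha_bar ^ m"
        by (rule eventually_mono[OF ev]) (simp add: td)
    qed
    then have d: "dstar T \<omega> a b = c1 * W a b \<omega>" unfolding dstar_def by (rule limI)
    have a0: "alpha_bar > 0" using alpha_bounds by simp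
    have lo: "SS h1 m (T m \<omega>) a b \<le> hnorm h1 * SS hlen m (T m \<omega>) a b" for m
    proof -
      have "SS h1 m (T m \<omega>) a b \<le> hnorm h1 * real (card (crossed m (T m \<omega>) a b))"
        using SS_upper[of h1 m "T m \<omega>" a b] by (simp add: mkh_simps)
      also have "\<dots> \<le> hnorm h1 * SS hlen m (T m \<omega>) a b"
      proof (rule mult_left_mono[OF _ hnorm_nonneg])
        have "1 * real (card (crossed m (T m \<omega>) a b)) \<le> SS hlen m (T m \<omega>) a b"
          by (rule SS_lower) (auto simp: hlen_def)
        then show "real (card (crossed m (T m \<omega>) a b)) \<le> SS hlen m (T m \<omega>) a b" by simp
      qed
      finally show ?thesis .
    qed
    have hi: "SS hlen m (T m \<omega>) a b \<le> 40 * SS h1 m (T m \<omega>) a b" for m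
    proof -
      have "hnorm hlen = 4" by (simp add: hnorm_def hlen_def)
      then have "SS hlen m (T m \<omega>) a b \<le> 4 * real (card (crossed m (T m \<omega>) a b))"
        using SS_upper[of hlen m "T m \<omega>" a b] by (simp add: hlen_def)
      then show ?thesis
        using SS_lower[of h1 "1/10" m "T m \<omega>" a b] h1_pos by (simp add: mkh_simps)
    qed
    have "W a b \<omega> \<le> hnorm h1 * dstar T \<omega> a b"
    proof (rule LIMSEQ_le[OF elim(1)])
      show "(\<lambda>m. hnorm h1 * (real (tdist (T m \<omega>) a b) / alpha_bar ^ m)) \<longlonglongrightarrow> hnorm h1 * dstar T \<omega> a b"
        unfolding d by (intro tendsto_intros L)
      show "\<exists>N. \<forall>m\<ge>N. Z h1 a b m \<omega> / alpha_bar ^ m \<le> hnorm h1 * (real (tdist (T m \<omega>) a b) / alpha_bar ^ m)"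
        using lo td a0 by (intro exI[of _ n]) (auto simp: Z_def divide_right_mono)
    qed
    moreover have "dstar T \<omega> a b \<le> 40 * W a b \<omega>"
    proof (rule LIMSEQ_le[OF L[folded d]])
      show "(\<lambda>m. 40 * (Z h1 a b m \<omega> / alpha_bar ^ m)) \<longlonglongrightarrow> 40 * W a b \<omega>"
        by (intro tendsto_intros elim)
      show "\<exists>N. \<forall>m\<ge>N. real (tdist (T m \<omega>) a b) / alpha_bar ^ m \<le> 40 * (Z h1 a b m \<omega> / alpha_bar ^ m)"
        using hi td a0 by (intro exI[of _ n]) (auto simp: Z_def divide_right_mono)
    qed
    ultimately show ?case using L d by simp
  qed
qed

end

section \<open>Positivity and small gaps\<close>

lemma crossed_card:
  assumes t: "t \<in> trees n" and ab: "a \<in> VG n" "b \<in> VG n"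
  shows "card (crossed n t a b) \<le> card (pth t a b)" "a \<noteq> b \<Longrightarrow> card (crossed n t a b) \<ge> 1"
proof -
  have T: "stree (VG n) t" "t \<subseteq> EG n" using t by (auto simp only: trees_iff)
  have sub: "pth t a b \<subseteq> EG n" using pth_props(1)[OF streeD(1,2)[OF T(1)] streeD(3)[OF T(1) ab]] T(2) by blast
  have fin: "finite (piw 0 w (pth t a b))" for w using finite_subset[OF piw_sub finite_EG] .
  have fc: "finite (crossed n t a b)" by (simp add: crossed_def)
  have s: "card (pth t a b) = (\<Sum>w\<in>crossed n t a b. card (piw 0 w (pth t a b)))"
    unfolding piw_card_sum[OF sub] by (rule sum.mono_neutral_right) (auto simp: crossed_def)
  have "(\<Sum>w\<in>crossed n t a b. 1) \<le> (\<Sum>w\<in>crossed n t a b. card (piw 0 w (pth t a b)))"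
  proof (rule sum_mono)
    fix w assume "w \<in> crossed n t a b"
    then show "1 \<le> card (piw 0 w (pth t a b))" using fin[of w] by (simp add: crossed_def Suc_le_eq card_gt_0_iff)
  qed
  then show "card (crossed n t a b) \<le> card (pth t a b)" using s by simp
  assume "a \<noteq> b"
  then have "pth t a b \<noteq> {}" using tdist_pos[OF T(1) ab] by blast
  moreover have "finite (pth t a b)" using finite_subset[OF sub finite_EG] .
  ultimately have "card (pth t a b) \<noteq> 0" by simp
  then have "crossed n t a b \<noteq> {}" using s by auto
  then show "card (crossed n t a b) \<ge> 1" using fc by (simp add: Suc_le_eq card_gt_0_iff)
qed

lemma SS_h1_nonneg: "SS h1 n t a b \<ge> 0"
  using SS_lower[of h1 "1/10" n t a b] h1_pos by (simp add: mkh_simps order_trans[of 0 "real _ / 10"])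

lemma SS_h1_lower:
  assumes t: "t \<in> trees n" and ab: "a \<in> VG n" "b \<in> VG n" "a \<noteq> b" shows "SS h1 n t a b \<ge> 1/10"
proof -
  have "1/10 * 1 \<le> 1/10 * real (card (crossed n t a b))" using crossed_card(2)[OF t ab(1,2,3)] by simp
  also have "\<dots> \<le> SS h1 n t a b" by (rule SS_lower) (use h1_pos in \<open>auto simp: mkh_simps\<close>)
  finally show ?thesis by simp
qed

text \<open>An arbitrary ordering of the two points of an edge: \<open>W\<close> takes ordered
  pairs, whereas paths are sets of edges.\<close>

definition ends :: "complex set \<Rightarrow> complex \<times> complex" where
  "ends e = (SOME p. e = {fst p, snd p} \<and> fst p \<noteq> snd p)"

lemma ends_edge: assumes "a \<noteq> b" shows "ends {a,b} = (a,b) \<or> ends {a,b} = (b,a)"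
proof -
  have "{a,b} = {fst (ends {a,b}), snd (ends {a,b})} \<and> fst (ends {a,b}) \<noteq> snd (ends {a,b})"
    unfolding ends_def by (rule someI[of "\<lambda>p. {a,b} = {fst p, snd p} \<and> fst p \<noteq> snd p" "(a,b)"]) (use assms in simp)
  then show ?thesis by (metis doubleton_eq_iff prod.collapse)
qed

context ust begin

text \<open>Bounds the second moment by the squared mean, given the tree at level \<open>m\<close>.
  One factor 10 comes from the lower bound of the weights in \<open>Z_square\<close>, the other from
  \<open>SS_h1_lower\<close>, which turns the first power of the mean into its square.\<close>

definition C1 :: real where "C1 = 1 + 100 * KK alpha_bar h1"
lemma C1_pos: "C1 \<ge> 1" by (simp add: C1_def KK_nonneg)

lemma W_meas[measurable]: "W a b \<in> borel_measurable M"
  unfolding W_def[abs_def] Z_def by (intro borel_measurable_lim_metric) measurable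

definition at_t :: "nat \<Rightarrow> complex set set \<Rightarrow> 'w \<Rightarrow> real" where
  "at_t m t \<omega> = of_bool (T m \<omega> = t)"

lemma at_meas[measurable]: "at_t m t \<in> borel_measurable M"
  unfolding at_t_def[abs_def] by (rule meas_fun)

lemma at_mean: "t \<in> trees m \<Longrightarrow> expectation (at_t m t) = 1 / real (card (trees m))"
  using expect(2)[of "\<lambda>s. of_bool (s = t)" m] unfolding at_t_def[abs_def] of_bool_def by simp

definition MM :: "complex \<Rightarrow> complex \<Rightarrow> nat \<Rightarrow> 'w \<Rightarrow> real" where
  "MM a b m \<omega> = Z h1 a b m \<omega> / alpha_bar ^ m"

lemma MM_meas[measurable]: "MM a b m \<in> borel_measurable M"
  unfolding MM_def[abs_def] Z_def by (rule meas_fun)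

lemma MM_lim: "a \<in> VG n \<Longrightarrow> b \<in> VG n \<Longrightarrow> AE \<omega> in M. (\<lambda>m. MM a b m \<omega>) \<longlonglongrightarrow> W a b \<omega>"
  using W_lim[of a n b] by (simp add: MM_def)

lemma MM_nonneg: "MM a b m \<omega> \<ge> 0"
  using alpha_bounds SS_h1_nonneg by (simp add: MM_def Z_def)

text \<open>Estimates are made for bounded continuous functions of \<open>MM\<close>, because these
  pass to the limit \<open>W\<close> by dominated convergence.\<close>

lemma dct:
  fixes F :: "real \<Rightarrow> real"
  assumes ab: "a \<in> VG n" "b \<in> VG n" and G: "G \<in> borel_measurable M" "\<And>\<omega>. \<bar>G \<omega>\<bar> \<le> 1"
    and F: "continuous_on UNIV F" "\<And>x. \<bar>F x\<bar> \<le> B"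
  shows "(\<lambda>j. expectation (\<lambda>\<omega>. G \<omega> * F (MM a b (m + j) \<omega>))) \<longlonglongrightarrow> expectation (\<lambda>\<omega>. G \<omega> * F (W a b \<omega>))"
    and "integrable M (\<lambda>\<omega>. G \<omega> * F (W a b \<omega>))"
proof -
  have mF[measurable]: "F \<in> borel_measurable borel" by (rule borel_measurable_continuous_onI[OF F(1)])
  have mG[measurable]: "G \<in> borel_measurable M" by (rule G(1))
  have B: "B \<ge> 0" using F(2)[of 0] by simp
  have bd: "norm (G \<omega> * F x) \<le> B" for \<omega> x
    using mult_mono[OF G(2)[of \<omega>] F(2)[of x]] by (simp add: abs_mult)
  have lim: "AE \<omega> in M. (\<lambda>j. G \<omega> * F (MM a b (m + j) \<omega>)) \<longlonglongrightarrow> G \<omega> * F (W a b \<omega>)"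
    using MM_lim[OF ab]
  proof eventually_elim
    case (elim \<omega>)
    have "(\<lambda>j. MM a b (m + j) \<omega>) \<longlonglongrightarrow> W a b \<omega>"
      using LIMSEQ_ignore_initial_segment[OF elim, of m] by (simp add: add.commute)
    then have "(\<lambda>j. F (MM a b (m + j) \<omega>)) \<longlonglongrightarrow> F (W a b \<omega>)"
      using continuous_on_tendsto_compose[OF F(1)] by auto
    then show ?case by (intro tendsto_intros)
  qed
  show "(\<lambda>j. expectation (\<lambda>\<omega>. G \<omega> * F (MM a b (m + j) \<omega>))) \<longlonglongrightarrow> expectation (\<lambda>\<omega>. G \<omega> * F (W a b \<omega>))"
    by (rule integral_dominated_convergence[where w="\<lambda>_. B", OF _ _ _ lim]) (use bd in auto)
  show "integrable M (\<lambda>\<omega>. G \<omega> * F (W a b \<omega>))"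
    by (rule integrable_const_bound[of _ B]) (use bd in auto)
qed

lemma at_moments:
  assumes t: "t \<in> trees m" and ab: "a \<in> VG m" "b \<in> VG m" "a \<noteq> b"
  defines "c \<equiv> SS h1 m t a b / alpha_bar ^ m" and "p \<equiv> expectation (at_t m t)"
  shows "expectation (\<lambda>\<omega>. at_t m t \<omega> * MM a b (m+j) \<omega>) = c * p"
    "expectation (\<lambda>\<omega>. at_t m t \<omega> * (MM a b (m+j) \<omega>)\<^sup>2) \<le> C1 * c\<^sup>2 * p"
    "integrable M (\<lambda>\<omega>. at_t m t \<omega> * MM a b (m+j) \<omega>)"
    "integrable M (\<lambda>\<omega>. at_t m t \<omega> * (MM a b (m+j) \<omega>)\<^sup>2)"
    "c > 0" "p \<ge> 0" "integrable M (at_t m t)"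
proof -
  have a0: "alpha_bar > 0" using alpha_bounds by simp
  define s where "s = SS h1 m t a b"
  have s: "s \<ge> 1/10" unfolding s_def by (rule SS_h1_lower[OF t ab])
  then show c: "c > 0" using a0 by (simp add: c_def s_def[symmetric])
  show ip: "integrable M (at_t m t)" unfolding at_t_def[abs_def] by (rule expect(1))
  show p0: "p \<ge> 0" unfolding p_def by (rule integral_nonneg_AE) (simp add: at_t_def)
  show "integrable M (\<lambda>\<omega>. at_t m t \<omega> * MM a b (m+j) \<omega>)"
    using int_two[of "\<lambda>x f. of_bool (x = t) * (SS h1 (m+j) f a b / alpha_bar ^ (m+j))" m j] by (simp add: at_t_def MM_def Z_def)
  show "integrable M (\<lambda>\<omega>. at_t m t \<omega> * (MM a b (m+j) \<omega>)\<^sup>2)"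
    using int_two[of "\<lambda>x f. of_bool (x = t) * (SS h1 (m+j) f a b / alpha_bar ^ (m+j))\<^sup>2" m j] by (simp add: at_t_def MM_def Z_def)
  have z1: "expectation (\<lambda>\<omega>. at_t m t \<omega> * Z h1 a b m \<omega>) = s * p"
  proof -
    have "(\<lambda>\<omega>. at_t m t \<omega> * Z h1 a b m \<omega>) = (\<lambda>\<omega>. s * at_t m t \<omega>)" by (auto simp: at_t_def Z_def s_def)
    then show ?thesis by (simp add: p_def)
  qed
  have z2: "expectation (\<lambda>\<omega>. at_t m t \<omega> * (Z h1 a b m \<omega>)\<^sup>2) = s\<^sup>2 * p"
  proof -
    have "(\<lambda>\<omega>. at_t m t \<omega> * (Z h1 a b m \<omega>)\<^sup>2) = (\<lambda>\<omega>. s\<^sup>2 * at_t m t \<omega>)" by (auto simp: at_t_def Z_def s_def)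
    then show ?thesis by (simp add: p_def)
  qed
  have "expectation (\<lambda>\<omega>. at_t m t \<omega> * MM a b (m+j) \<omega>) = expectation (\<lambda>\<omega>. at_t m t \<omega> * Z h1 a b (m+j) \<omega> / alpha_bar ^ (m+j))"
    by (simp add: MM_def)
  also have "\<dots> = expectation (\<lambda>\<omega>. at_t m t \<omega> * Z h1 a b (m+j) \<omega>) / alpha_bar ^ (m+j)"
    by (rule integral_divide_zero)
  also have "expectation (\<lambda>\<omega>. at_t m t \<omega> * Z h1 a b (m+j) \<omega>) = alpha_bar ^ j * (s * p)"
    using Z_mean[OF eig_h1 ab(1,2), of "\<lambda>x. of_bool (x = t)" j] z1 by (simp add: at_t_def)
  finally show "expectation (\<lambda>\<omega>. at_t m t \<omega> * MM a b (m+j) \<omega>) = c * p"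
    using a0 by (simp add: c_def s_def power_add)
  have "expectation (\<lambda>\<omega>. at_t m t \<omega> * (Z h1 a b (m+j) \<omega>)\<^sup>2)
    \<le> alpha_bar ^ (2 * j) * (s\<^sup>2 * p + KK alpha_bar h1 / (1/10) * (s * p) * (1 - (1/alpha_bar)^j))"
    using Z_square[OF eig_h1 ab(1,2), of "\<lambda>x. of_bool (x = t)" "1/10" j] h1_pos alpha_bounds z1 z2
    by (simp add: at_t_def)
  also have "\<dots> \<le> alpha_bar ^ (2 * j) * (C1 * s\<^sup>2 * p)"
  proof (rule mult_left_mono)
    have "KK alpha_bar h1 / (1/10) * (s * p) * (1 - (1/alpha_bar)^j) \<le> KK alpha_bar h1 / (1/10) * (s * p) * 1"
      using s p0 a0 KK_nonneg by (intro mult_left_mono mult_nonneg_nonneg) auto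
    also have "\<dots> \<le> 100 * KK alpha_bar h1 * (s\<^sup>2 * p)"
    proof -
      have "s * p \<le> 10 * (s\<^sup>2 * p)"
      proof -
        have "s * 1 \<le> s * (10 * s)" using s by (intro mult_left_mono) auto
        then have "s * p \<le> (10 * s\<^sup>2) * p" using p0 by (intro mult_right_mono) (auto simp: power2_eq_square)
        then show ?thesis by simp
      qed
      then have "(10 * KK alpha_bar h1) * (s * p) \<le> (10 * KK alpha_bar h1) * (10 * (s\<^sup>2 * p))"
        using KK_nonneg by (intro mult_left_mono) auto
      then show ?thesis by simp
    qed
    finally show "s\<^sup>2 * p + KK alpha_bar h1 / (1/10) * (s * p) * (1 - (1/alpha_bar)^j) \<le> C1 * s\<^sup>2 * p"
      by (simp add: C1_def algebra_simps)
  qed (use a0 in auto)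
  finally have q: "expectation (\<lambda>\<omega>. at_t m t \<omega> * (Z h1 a b (m+j) \<omega>)\<^sup>2) \<le> alpha_bar ^ (2 * j) * (C1 * s\<^sup>2 * p)" .
  have "expectation (\<lambda>\<omega>. at_t m t \<omega> * (MM a b (m+j) \<omega>)\<^sup>2) = expectation (\<lambda>\<omega>. at_t m t \<omega> * (Z h1 a b (m+j) \<omega>)\<^sup>2 / (alpha_bar ^ (m+j))\<^sup>2)"
    by (simp add: MM_def power_divide)
  also have "\<dots> = expectation (\<lambda>\<omega>. at_t m t \<omega> * (Z h1 a b (m+j) \<omega>)\<^sup>2) / (alpha_bar ^ (m+j))\<^sup>2"
    by (rule integral_divide_zero)
  also have "\<dots> \<le> alpha_bar ^ (2 * j) * (C1 * s\<^sup>2 * p) / (alpha_bar ^ (m+j))\<^sup>2"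
    by (rule divide_right_mono[OF q]) simp
  also have "\<dots> = C1 * c\<^sup>2 * p"
    using a0 by (simp add: c_def s_def[symmetric] power_add power_mult_distrib power_divide power_mult power2_eq_square mult_ac
        flip: power_mult)
      (simp add: field_simps power_mult power2_eq_square power_mult_distrib)
  finally show "expectation (\<lambda>\<omega>. at_t m t \<omega> * (MM a b (m+j) \<omega>)\<^sup>2) \<le> C1 * c\<^sup>2 * p" .
qed

text \<open>Continuous substitute for the indicator of 0 on the half-line: equal to 1 at 0 and, for
  positive \<open>k\<close>, zero from \<open>1 / k\<close> on.\<close>

definition clip :: "real \<Rightarrow> real \<Rightarrow> real" where "clip k x = max 0 (min 1 (1 - k * x))"

lemma clip_props: "continuous_on UNIV (clip k)" "\<bar>clip k x\<bar> \<le> 1" "clip k x \<ge> 0" "clip k 0 = 1" "clip k x \<le> 1"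
  unfolding clip_def by (auto intro!: continuous_intros)

text \<open>The square lies above its tangent \<open>1 - 2 * \<beta> * x\<close> at 0 and above 0;
  thus first and second moments bound the mass near 0.\<close>

lemma clip_square: "clip (2 * \<beta>) x \<le> (1 - \<beta> * x)\<^sup>2"
proof -
  have "(1 - \<beta> * x)\<^sup>2 = 1 - 2 * \<beta> * x + (\<beta> * x)\<^sup>2" by (simp add: power2_diff)
  moreover have "0 \<le> (\<beta> * x)\<^sup>2" "0 \<le> (1 - \<beta> * x)\<^sup>2" by simp_all
  ultimately show ?thesis unfolding clip_def by linarith
qed

text \<open>Second moment argument: conditionally on the tree at level \<open>m\<close>, the limit is positive with
  probability at least \<open>1 / C1\<close>.\<close>

lemma zero_at:
  assumes t: "t \<in> trees m" and ab: "a \<in> VG m" "b \<in> VG m" "a \<noteq> b"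
  shows "expectation (\<lambda>\<omega>. at_t m t \<omega> * indicator {\<omega> \<in> space M. W a b \<omega> = 0} \<omega>) \<le> (1 - 1 / C1) * expectation (at_t m t)"
proof -
  define c where "c = SS h1 m t a b / alpha_bar ^ m"
  define p where "p = expectation (at_t m t)"
  note mo = at_moments[OF t ab, folded c_def p_def]
  \<comment> \<open>This value minimises \<open>1 - 2 * \<beta> * c + C1 * (\<beta> * c)^2\<close>,
    and the minimum is \<open>1 - 1 / C1\<close>.\<close>
  define \<beta> where "\<beta> = 1 / (C1 * c)"
  have G: "\<And>\<omega>. \<bar>at_t m t \<omega>\<bar> \<le> 1" by (simp add: at_t_def)
  note d1 = dct(1)[where G="at_t m t" and F="clip (2 * \<beta>)" and B=1 and m=m, OF ab(1,2) at_meas G clip_props(1,2)]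
  note d2 = dct(2)[where G="at_t m t" and F="clip (2 * \<beta>)" and B=1, OF ab(1,2) at_meas G clip_props(1,2)]
  have A[measurable]: "{\<omega> \<in> space M. W a b \<omega> = 0} \<in> events" by measurable
  have "expectation (\<lambda>\<omega>. at_t m t \<omega> * indicator {\<omega> \<in> space M. W a b \<omega> = 0} \<omega>)
     \<le> expectation (\<lambda>\<omega>. at_t m t \<omega> * clip (2 * \<beta>) (W a b \<omega>))"
  proof (rule integral_mono[OF _ d2])
    show "integrable M (\<lambda>\<omega>. at_t m t \<omega> * indicator {\<omega> \<in> space M. W a b \<omega> = 0} \<omega>)"
      by (rule integrable_const_bound[of _ 1]) (auto simp: at_t_def indicator_def)
    show "at_t m t \<omega> * indicator {\<omega> \<in> space M. W a b \<omega> = 0} \<omega> \<le> at_t m t \<omega> * clip (2 * \<beta>) (W a b \<omega>)" for \<omega>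
      using clip_props(3,4) by (auto simp: at_t_def indicator_def)
  qed
  also have "\<dots> \<le> (1 - 1 / C1) * p"
  proof (rule LIMSEQ_le_const2[OF d1], intro exI allI impI)
    fix j :: nat
    have "expectation (\<lambda>\<omega>. at_t m t \<omega> * clip (2 * \<beta>) (MM a b (m+j) \<omega>))
       \<le> expectation (\<lambda>\<omega>. (at_t m t \<omega> - 2 * \<beta> * (at_t m t \<omega> * MM a b (m+j) \<omega>)) + \<beta>\<^sup>2 * (at_t m t \<omega> * (MM a b (m+j) \<omega>)\<^sup>2))"
    proof (rule integral_mono)
      have cm[measurable]: "clip (2 * \<beta>) \<in> borel_measurable borel"
        by (rule borel_measurable_continuous_onI[OF clip_props(1)])
      show "integrable M (\<lambda>\<omega>. at_t m t \<omega> * clip (2 * \<beta>) (MM a b (m+j) \<omega>))"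
      proof (rule integrable_const_bound[of _ 1])
        show "AE \<omega> in M. norm (at_t m t \<omega> * clip (2 * \<beta>) (MM a b (m+j) \<omega>)) \<le> 1"
          using clip_props(2) by (auto simp: at_t_def)
      qed measurable
      show "integrable M (\<lambda>\<omega>. (at_t m t \<omega> - 2 * \<beta> * (at_t m t \<omega> * MM a b (m+j) \<omega>)) + \<beta>\<^sup>2 * (at_t m t \<omega> * (MM a b (m+j) \<omega>)\<^sup>2))"
        by (intro Bochner_Integration.integrable_add Bochner_Integration.integrable_diff integrable_mult_right mo)
      fix \<omega>
      have "at_t m t \<omega> * clip (2 * \<beta>) (MM a b (m+j) \<omega>) \<le> at_t m t \<omega> * (1 - \<beta> * MM a b (m+j) \<omega>)\<^sup>2"
        by (rule mult_left_mono[OF clip_square]) (simp add: at_t_def)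
      also have "\<dots> = (at_t m t \<omega> - 2 * \<beta> * (at_t m t \<omega> * MM a b (m+j) \<omega>)) + \<beta>\<^sup>2 * (at_t m t \<omega> * (MM a b (m+j) \<omega>)\<^sup>2)"
        by (simp add: power2_eq_square algebra_simps)
      finally show "at_t m t \<omega> * clip (2 * \<beta>) (MM a b (m+j) \<omega>) \<le> \<dots>" .
    qed
    also have "\<dots> = (p - 2 * \<beta> * (c * p)) + \<beta>\<^sup>2 * expectation (\<lambda>\<omega>. at_t m t \<omega> * (MM a b (m+j) \<omega>)\<^sup>2)"
      using mo by (simp add: p_def[symmetric])
    also have "\<dots> \<le> (p - 2 * \<beta> * (c * p)) + \<beta>\<^sup>2 * (C1 * c\<^sup>2 * p)"
      using mo(2) by (intro add_left_mono mult_left_mono) auto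
    also have "\<dots> = (1 - 1 / C1) * p"
    proof -
      have 1: "\<beta> * c = 1 / C1" using mo(5) by (simp add: \<beta>_def)
      have "\<beta>\<^sup>2 * (C1 * c\<^sup>2 * p) = (\<beta> * c)\<^sup>2 * C1 * p" by (simp add: power_mult_distrib)
      also have "\<dots> = 1 / C1 * p" using C1_pos by (simp add: 1 power2_eq_square)
      finally have 2: "\<beta>\<^sup>2 * (C1 * c\<^sup>2 * p) = 1 / C1 * p" .
      have "2 * \<beta> * (c * p) = 2 * (\<beta> * c) * p" by simp
      then show ?thesis unfolding 2 1 by (simp add: algebra_simps)
    qed
    finally show "expectation (\<lambda>\<omega>. at_t m t \<omega> * clip (2 * \<beta>) (MM a b (m+j) \<omega>)) \<le> (1 - 1 / C1) * p" .
  qed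
  finally show ?thesis unfolding p_def .
qed

text \<open>Sums \<open>zero_at\<close> over the values of \<open>T m\<close>. The constant does not
  depend on the level, on which \<open>W_positive\<close> rests.\<close>

lemma zero_fun:
  assumes ab: "a \<in> VG m" "b \<in> VG m" "a \<noteq> b" and g: "\<And>t. 0 \<le> g t"
  shows "expectation (\<lambda>\<omega>. indicator {\<omega> \<in> space M. W a b \<omega> = 0} \<omega> * g (T m \<omega>)) \<le> (1 - 1 / C1) * expectation (\<lambda>\<omega>. g (T m \<omega>))"
proof -
  let ?A = "{\<omega> \<in> space M. W a b \<omega> = 0}"
  have A[measurable]: "?A \<in> events" by measurable
  have mg[measurable]: "(\<lambda>\<omega>. g (T m \<omega>)) \<in> borel_measurable M" by (rule meas_fun)
  have i: "integrable M (\<lambda>\<omega>. g t * (at_t m t \<omega> * indicator ?A \<omega>))" for t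
    by (intro integrable_mult_right, rule integrable_const_bound[of _ 1]) (auto simp: at_t_def indicator_def)
  have "expectation (\<lambda>\<omega>. indicator ?A \<omega> * g (T m \<omega>)) = expectation (\<lambda>\<omega>. \<Sum>t\<in>trees m. g t * (at_t m t \<omega> * indicator ?A \<omega>))"
  proof (rule integral_cong_AE)
    show "AE \<omega> in M. indicator ?A \<omega> * g (T m \<omega>) = (\<Sum>t\<in>trees m. g t * (at_t m t \<omega> * indicator ?A \<omega>))"
      using AE_tree[of m]
    proof eventually_elim
      case (elim \<omega>)
      have "(\<Sum>t\<in>trees m. g t * (at_t m t \<omega> * indicator ?A \<omega>)) = (\<Sum>t\<in>trees m. if t = T m \<omega> then g t * indicator ?A \<omega> else 0)"
        by (rule sum.cong) (auto simp: at_t_def)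
      then show ?case using elim by (simp add: mult.commute)
    qed
  qed measurable
  also have "\<dots> = (\<Sum>t\<in>trees m. g t * expectation (\<lambda>\<omega>. at_t m t \<omega> * indicator ?A \<omega>))"
    using i by (subst Bochner_Integration.integral_sum) simp_all
  also have "\<dots> \<le> (\<Sum>t\<in>trees m. g t * ((1 - 1 / C1) * expectation (at_t m t)))"
    by (intro sum_mono mult_left_mono zero_at[OF _ ab] g)
  also have "\<dots> = (1 - 1 / C1) * (\<Sum>t\<in>trees m. g t / real (card (trees m)))"
    unfolding sum_distrib_left by (intro sum.cong refl) (simp add: at_mean)
  also have "\<dots> = (1 - 1 / C1) * expectation (\<lambda>\<omega>. g (T m \<omega>))"
    unfolding expect sum_divide_distrib ..
  finally show ?thesis .
qed

text \<open>A zero-one argument: take for \<open>g\<close> the function \<open>clip k\<close> of the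
  normalised size at level \<open>n + j\<close> and let first \<open>j\<close>, then
  \<open>k\<close> tend to infinity. Both sides become the probability of
  \<open>W a b \<omega> = 0\<close>, the right one with the factor \<open>1 - 1 / C1\<close>, so
  this probability is 0.\<close>

lemma W_positive:
  assumes ab: "a \<in> VG n" "b \<in> VG n" "a \<noteq> b"
  shows "AE \<omega> in M. W a b \<omega> > 0"
proof -
  let ?A = "{\<omega> \<in> space M. W a b \<omega> = 0}"
  have A[measurable]: "?A \<in> events" by measurable
  have W0: "AE \<omega> in M. W a b \<omega> \<ge> 0"
    using MM_lim[OF ab(1,2)] by eventually_elim (rule LIMSEQ_le_const, auto simp: MM_nonneg)
  have k: "prob ?A \<le> (1 - 1 / C1) * expectation (\<lambda>\<omega>. clip (real k) (W a b \<omega>))" for k :: nat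
  proof -
    have G: "\<And>\<omega>. \<bar>indicator ?A \<omega> :: real\<bar> \<le> 1" "\<And>\<omega>::'w. \<bar>1::real\<bar> \<le> 1" by (auto simp: indicator_def)
    have "(\<lambda>j. expectation (\<lambda>\<omega>. indicator ?A \<omega> * clip (real k) (MM a b (n + j) \<omega>)))
       \<longlonglongrightarrow> expectation (\<lambda>\<omega>. indicator ?A \<omega> * clip (real k) (W a b \<omega>))"
      by (rule dct(1)[OF ab(1,2) _ G(1) clip_props(1,2)]) measurable
    also have "(\<lambda>\<omega>. indicator ?A \<omega> * clip (real k) (W a b \<omega>)) = (\<lambda>\<omega>. indicator ?A \<omega>)"
      by (auto simp: indicator_def clip_props)
    finally have 1: "(\<lambda>j. expectation (\<lambda>\<omega>. indicator ?A \<omega> * clip (real k) (MM a b (n + j) \<omega>))) \<longlonglongrightarrow> prob ?A"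
      using A by (simp add: Int_absorb2 subset_iff)
    have "(\<lambda>j. expectation (\<lambda>\<omega>. 1 * clip (real k) (MM a b (n + j) \<omega>))) \<longlonglongrightarrow> expectation (\<lambda>\<omega>. 1 * clip (real k) (W a b \<omega>))"
      by (rule dct(1)[OF ab(1,2) _ G(2) clip_props(1,2)]) measurable
    then have 2: "(\<lambda>j. (1 - 1 / C1) * expectation (\<lambda>\<omega>. clip (real k) (MM a b (n + j) \<omega>)))
        \<longlonglongrightarrow> (1 - 1 / C1) * expectation (\<lambda>\<omega>. clip (real k) (W a b \<omega>))"
      by (intro tendsto_intros) simp
    show ?thesis
    proof (rule LIMSEQ_le[OF 1 2], intro exI allI impI)
      fix j :: nat
      have "a \<in> VG (n+j)" "b \<in> VG (n+j)" using ab VG_mono[of n "n+j"] by auto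
      from zero_fun[OF this ab(3), of "\<lambda>f. clip (real k) (SS h1 (n+j) f a b / alpha_bar ^ (n+j))"]
      show "expectation (\<lambda>\<omega>. indicator ?A \<omega> * clip (real k) (MM a b (n + j) \<omega>))
         \<le> (1 - 1 / C1) * expectation (\<lambda>\<omega>. clip (real k) (MM a b (n + j) \<omega>))"
        by (simp add: MM_def Z_def clip_props)
    qed
  qed
  have "(\<lambda>k. expectation (\<lambda>\<omega>. clip (real k) (W a b \<omega>))) \<longlonglongrightarrow> expectation (\<lambda>\<omega>. indicator ?A \<omega>)"
  proof (rule integral_dominated_convergence[where w="\<lambda>_. 1"])
    have cm[measurable]: "clip (real k) \<in> borel_measurable borel" for k :: nat
      by (rule borel_measurable_continuous_onI[OF clip_props(1)])
    show "(\<lambda>\<omega>. clip (real k) (W a b \<omega>)) \<in> borel_measurable M" for k :: nat by measurable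
    show "AE \<omega> in M. (\<lambda>k. clip (real k) (W a b \<omega>)) \<longlonglongrightarrow> indicator ?A \<omega>"
      using W0 AE_space2
    proof eventually_elim
      case (elim \<omega>)
      show ?case
      proof (cases "W a b \<omega> = 0")
        case True then show ?thesis using elim by (simp add: clip_props indicator_def)
      next
        case False
        then have w: "W a b \<omega> > 0" using elim by simp
        obtain N :: nat where N: "1 / W a b \<omega> < real N" using reals_Archimedean2 by blast
        have "clip (real k) (W a b \<omega>) = 0" if "k \<ge> N" for k
        proof -
          have "1 < real N * W a b \<omega>" using N w by (simp add: divide_less_eq)
          also have "\<dots> \<le> real k * W a b \<omega>" using that w by (intro mult_right_mono) auto
          finally show ?thesis by (simp add: clip_def)
        qed
        then have "\<forall>\<^sub>F k in sequentially. clip (real k) (W a b \<omega>) = 0" by (auto simp: eventually_sequentially)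
        then show ?thesis using False by (simp add: indicator_def tendsto_eventually)
      qed
    qed
  qed (use clip_props in auto)
  then have "(\<lambda>k. (1 - 1 / C1) * expectation (\<lambda>\<omega>. clip (real k) (W a b \<omega>))) \<longlonglongrightarrow> (1 - 1 / C1) * prob ?A"
    using A by (intro tendsto_intros) (simp add: Int_absorb2 subset_iff)
  then have "prob ?A \<le> (1 - 1 / C1) * prob ?A" by (rule LIMSEQ_le_const) (use k in auto)
  then have "1 / C1 * prob ?A \<le> 0" by (simp add: algebra_simps)
  then have "prob ?A = 0" using C1_pos measure_nonneg[of M ?A] by (simp add: mult_le_0_iff divide_le_0_iff)
  then have "AE \<omega> in M. \<not> W a b \<omega> = 0" using prob_Collect_eq_0[OF A] by simp
  then show ?thesis using W0 by eventually_elim auto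
qed

subsection \<open>Edges of the path become short\<close>

text \<open>Chebyshev's inequality with the second moment from \<open>at_moments\<close>. For a
  single edge the weight is bounded, so its normalised second moment is of order
  \<open>1 / alpha_bar ^ (2 * n)\<close>.\<close>

lemma gap_one:
  assumes t: "t \<in> trees n" and ab: "a \<in> VG n" "b \<in> VG n" "a \<noteq> b" and e: "\<epsilon> > 0"
    and s: "SS h1 n t a b \<le> hnorm h1"
  shows "prob {\<omega> \<in> space M. T n \<omega> = t \<and> W a b \<omega> \<ge> \<epsilon>} \<le> C1 * (hnorm h1)\<^sup>2 / \<epsilon>\<^sup>2 / (alpha_bar ^ n)\<^sup>2 * (1 / real (card (trees n)))"
proof -
  define c where "c = SS h1 n t a b / alpha_bar ^ n"
  define p where "p = expectation (at_t n t)"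
  note mo = at_moments[OF t ab, folded c_def p_def]
  have a0: "alpha_bar > 0" using alpha_bounds by simp
  \<comment> \<open>The truncation makes the function bounded, as \<open>dct\<close>
    requires.\<close>
  let ?F = "\<lambda>x::real. min (\<epsilon>\<^sup>2) (x\<^sup>2)"
  have F: "continuous_on UNIV ?F" "\<And>x. \<bar>?F x\<bar> \<le> \<epsilon>\<^sup>2" by (auto intro!: continuous_intros)
  have G: "\<And>\<omega>. \<bar>at_t n t \<omega>\<bar> \<le> 1" by (simp add: at_t_def)
  note d1 = dct(1)[where G="at_t n t" and F="?F" and B="\<epsilon>\<^sup>2" and m=n, OF ab(1,2) at_meas G F]
  note d2 = dct(2)[where G="at_t n t" and F="?F" and B="\<epsilon>\<^sup>2", OF ab(1,2) at_meas G F]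
  let ?E = "{\<omega> \<in> space M. T n \<omega> = t \<and> W a b \<omega> \<ge> \<epsilon>}"
  have E: "?E \<in> events"
  proof -
    have "?E = {\<omega> \<in> space M. T n \<omega> = t} \<inter> {\<omega> \<in> space M. W a b \<omega> \<ge> \<epsilon>}" by auto
    moreover have "{\<omega> \<in> space M. W a b \<omega> \<ge> \<epsilon>} \<in> events" by measurable
    ultimately show ?thesis using ev_meas by auto
  qed
  have "\<epsilon>\<^sup>2 * prob ?E = expectation (\<lambda>\<omega>. \<epsilon>\<^sup>2 * indicator ?E \<omega>)"
    using E by (simp add: Int_absorb2 subset_iff)
  also have "\<dots> \<le> expectation (\<lambda>\<omega>. at_t n t \<omega> * ?F (W a b \<omega>))"
  proof (rule integral_mono[OF _ d2])
    show "integrable M (\<lambda>\<omega>. \<epsilon>\<^sup>2 * indicator ?E \<omega>)"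
      using E by (intro integrable_mult_right integrable_real_indicator) (auto simp: emeasure_eq_measure)
    show "\<epsilon>\<^sup>2 * indicator ?E \<omega> \<le> at_t n t \<omega> * ?F (W a b \<omega>)" for \<omega>
      using e by (auto simp: indicator_def at_t_def power_mono)
  qed
  also have "\<dots> \<le> C1 * c\<^sup>2 * p"
  proof (rule LIMSEQ_le_const2[OF d1], intro exI allI impI)
    fix j :: nat
    have "expectation (\<lambda>\<omega>. at_t n t \<omega> * ?F (MM a b (n+j) \<omega>)) \<le> expectation (\<lambda>\<omega>. at_t n t \<omega> * (MM a b (n+j) \<omega>)\<^sup>2)"
    proof (rule integral_mono[OF _ mo(4)])
      show "integrable M (\<lambda>\<omega>. at_t n t \<omega> * ?F (MM a b (n+j) \<omega>))"
        by (rule Bochner_Integration.integrable_bound[OF mo(4)[of j]]) (auto simp: at_t_def)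
    qed (auto simp: at_t_def)
    then show "expectation (\<lambda>\<omega>. at_t n t \<omega> * ?F (MM a b (n+j) \<omega>)) \<le> C1 * c\<^sup>2 * p" using mo(2)[of j] by simp
  qed
  also have "\<dots> \<le> C1 * (hnorm h1 / alpha_bar ^ n)\<^sup>2 * p"
    using C1_pos mo(5,6) s a0 unfolding c_def
    by (intro mult_right_mono mult_left_mono power_mono divide_right_mono SS_h1_nonneg divide_nonneg_pos) auto
  finally have "prob ?E \<le> C1 * (hnorm h1 / alpha_bar ^ n)\<^sup>2 * p / \<epsilon>\<^sup>2" using e by (simp add: pos_le_divide_eq mult.commute)
  then show ?thesis unfolding p_def at_mean[OF t] by (simp add: power_divide mult_ac)
qed

text \<open>Written as a finite union over trees and edges, so that measurability and the union
  bound are immediate.\<close>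

definition bad :: "nat \<Rightarrow> real \<Rightarrow> 'w set" where
  "bad n \<epsilon> = (\<Union>t\<in>trees n. \<Union>e\<in>pth t u1 u2. {\<omega> \<in> space M. T n \<omega> = t \<and> W (fst (ends e)) (snd (ends e)) \<omega> \<ge> \<epsilon>})"

lemma u12_VG: "u1 \<in> VG n" "u2 \<in> VG n" using u_in_VG[of 1 n] u_in_VG[of 2 n] by (simp_all add: u_simps)

lemma pth_u12: assumes "t \<in> trees n" shows "pth t u1 u2 \<subseteq> t" "finite (pth t u1 u2)" "t \<subseteq> EG n" "stree (VG n) t"
proof -
  show T: "stree (VG n) t" "t \<subseteq> EG n" using assms by (auto simp only: trees_iff)
  show "pth t u1 u2 \<subseteq> t" by (rule pth_props(1)[OF streeD(1,2)[OF T(1)] streeD(3)[OF T(1) u12_VG]])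
  then show "finite (pth t u1 u2)" using finite_subset[OF _ finite_EG] T(2) by blast
qed

lemma bad_events: "bad n \<epsilon> \<in> events"
proof -
  have "{\<omega> \<in> space M. T n \<omega> = t \<and> W a b \<omega> \<ge> \<epsilon>} \<in> events" for t a b
  proof -
    have "{\<omega> \<in> space M. T n \<omega> = t \<and> W a b \<omega> \<ge> \<epsilon>} = {\<omega> \<in> space M. T n \<omega> = t} \<inter> {\<omega> \<in> space M. W a b \<omega> \<ge> \<epsilon>}" by auto
    moreover have "{\<omega> \<in> space M. W a b \<omega> \<ge> \<epsilon>} \<in> events" by measurable
    ultimately show ?thesis using ev_meas by auto
  qed
  then show ?thesis unfolding bad_def using pth_u12(2) by (intro sets.finite_UN) auto
qed

text \<open>Union bound: the expected number of edges of the path is of order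
  \<open>alpha_bar ^ n\<close>, and each of them is long with probability of order
  \<open>1 / alpha_bar ^ (2 * n)\<close>.\<close>

lemma bad_prob:
  assumes e: "\<epsilon> > 0"
  shows "prob (bad n \<epsilon>) \<le> (C1 * (hnorm h1)\<^sup>2 / \<epsilon>\<^sup>2 * 40 * expectation (Z h1 u1 u2 0)) * (1 / alpha_bar) ^ n"
proof -
  let ?S = "\<lambda>t e. {\<omega> \<in> space M. T n \<omega> = t \<and> W (fst (ends e)) (snd (ends e)) \<omega> \<ge> \<epsilon>}"
  define K where "K = C1 * (hnorm h1)\<^sup>2 / \<epsilon>\<^sup>2"
  have K0: "K \<ge> 0" using C1_pos by (simp add: K_def)
  have a0: "alpha_bar > 0" using alpha_bounds by simp
  let ?N = "real (card (trees n))"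
  have me: "?S t e \<in> events" for t e
  proof -
    have "?S t e = {\<omega> \<in> space M. T n \<omega> = t} \<inter> {\<omega> \<in> space M. W (fst (ends e)) (snd (ends e)) \<omega> \<ge> \<epsilon>}" by auto
    moreover have "{\<omega> \<in> space M. W (fst (ends e)) (snd (ends e)) \<omega> \<ge> \<epsilon>} \<in> events" by measurable
    ultimately show ?thesis using ev_meas by auto
  qed
  have one: "prob (?S t e) \<le> K / (alpha_bar ^ n)\<^sup>2 * (1 / ?N)" if t: "t \<in> trees n" and ee: "e \<in> pth t u1 u2" for t e
  proof -
    note P = pth_u12[OF t]
    have "e \<in> EG n" using ee P by blast
    then obtain x y where xy: "x \<in> VG n" "y \<in> VG n" "x \<noteq> y" "e = {x,y}" using EG_edge by blast
    define a where "a = fst (ends e)"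
    define b where "b = snd (ends e)"
    have ab: "a \<in> VG n" "b \<in> VG n" "a \<noteq> b" "e = {a,b}" using ends_edge[OF xy(3)] xy by (auto simp: a_def b_def)
    have "pth t a b = {e}"
      by (rule pth_eq[OF streeD(1,2)[OF P(4)]]) (use ee P(1) ab sd_pair[of a b] in auto)
    then have "card (crossed n t a b) \<le> 1" using crossed_card(1)[OF t ab(1,2)] by simp
    then have "hnorm h1 * real (card (crossed n t a b)) \<le> hnorm h1 * 1" by (intro mult_left_mono hnorm_nonneg) auto
    then have "SS h1 n t a b \<le> hnorm h1" using SS_upper[of h1 n t a b] by (simp add: mkh_simps)
    from gap_one[OF t ab(1-3) e this] show ?thesis by (simp add: a_def b_def K_def)
  qed
  have "prob (bad n \<epsilon>) \<le> (\<Sum>t\<in>trees n. prob (\<Union>e\<in>pth t u1 u2. ?S t e))"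
    unfolding bad_def using me pth_u12(2) by (intro finite_measure_subadditive_finite) auto
  also have "\<dots> \<le> (\<Sum>t\<in>trees n. \<Sum>e\<in>pth t u1 u2. prob (?S t e))"
    using me pth_u12(2) by (intro sum_mono finite_measure_subadditive_finite) auto
  also have "\<dots> \<le> (\<Sum>t\<in>trees n. \<Sum>e\<in>pth t u1 u2. K / (alpha_bar ^ n)\<^sup>2 * (1 / ?N))"
    by (intro sum_mono one)
  also have "\<dots> = K / (alpha_bar ^ n)\<^sup>2 * ((\<Sum>t\<in>trees n. real (card (pth t u1 u2))) / ?N)"
    by (simp add: sum_distrib_left sum_divide_distrib mult_ac)
  also have "\<dots> \<le> K / (alpha_bar ^ n)\<^sup>2 * ((\<Sum>t\<in>trees n. 4 * real (card (crossed n t u1 u2))) / ?N)"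
  proof (intro mult_left_mono divide_right_mono sum_mono)
    fix t assume t: "t \<in> trees n"
    have T: "stree (VG n) t" using pth_u12(4)[OF t] .
    have "real (card (pth t u1 u2)) = SS hlen n t u1 u2"
      using tdist_SS[OF t u12_VG] tree_path_props(7)[OF streeD(1,2)[OF T] streeD(3)[OF T u12_VG]] by simp
    moreover have "hnorm hlen = 4" by (simp add: hnorm_def hlen_def)
    ultimately show "real (card (pth t u1 u2)) \<le> 4 * real (card (crossed n t u1 u2))"
      using SS_upper[of hlen n t u1 u2] by (simp add: hlen_def)
  qed (use K0 in auto)
  also have "(\<Sum>t\<in>trees n. 4 * real (card (crossed n t u1 u2))) / ?N = 4 * expectation (\<lambda>\<omega>. real (card (crossed n (T n \<omega>) u1 u2)))"
    using expect(2)[of "\<lambda>t. real (card (crossed n t u1 u2))" n] by (simp add: sum_distrib_left)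
  also have "K / (alpha_bar ^ n)\<^sup>2 * \<dots> \<le> K / (alpha_bar ^ n)\<^sup>2 * (4 * (alpha_bar ^ n * (10 * expectation (Z h1 u1 u2 0))))"
    using crossed_mean[OF u12_VG[of 0], of n] K0 by (intro mult_left_mono) auto
  also have "\<dots> = (K * 40 * expectation (Z h1 u1 u2 0)) * (1 / alpha_bar) ^ n"
    using a0 by (simp add: power2_eq_square power_one_over field_simps)
  finally show ?thesis unfolding K_def .
qed

text \<open>The intersection is at most as probable as each \<open>bad n \<epsilon>\<close>, and
  these probabilities tend to 0.\<close>

lemma not_always_bad: assumes e: "\<epsilon> > 0" shows "AE \<omega> in M. \<exists>n. \<omega> \<notin> bad n \<epsilon>"
proof -
  let ?I = "\<Inter>n. bad n \<epsilon>"
  have I: "?I \<in> events" using bad_events by (intro sets.countable_INT) auto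
  let ?c = "C1 * (hnorm h1)\<^sup>2 / \<epsilon>\<^sup>2 * 40 * expectation (Z h1 u1 u2 0)"
  have le: "prob ?I \<le> ?c * (1 / alpha_bar) ^ n" for n
    using finite_measure_mono[of ?I "bad n \<epsilon>"] bad_events bad_prob[OF e, of n] by (auto intro: order_trans)
  have "(\<lambda>n. (1 / alpha_bar) ^ n) \<longlonglongrightarrow> 0" by (rule LIMSEQ_realpow_zero) (use alpha_bounds in auto)
  then have "(\<lambda>n. ?c * (1 / alpha_bar) ^ n) \<longlonglongrightarrow> ?c * 0" by (rule tendsto_mult_left)
  then have "prob ?I \<le> ?c * 0" by (rule LIMSEQ_le_const) (use le in auto)
  then have "prob ?I = 0" using measure_nonneg[of M ?I] by simp
  then have "?I \<in> null_sets M" using I by (simp add: null_sets_def emeasure_eq_measure)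
  then show ?thesis by (rule AE_I') auto
qed

text \<open>Collects what the deterministic part uses about a sample, as the assumptions of
  \<open>good_path\<close>.\<close>

lemma good:
  "AE \<omega> in M. (\<forall>n. T n \<omega> \<in> trees n) \<and> (\<forall>n. Tr n (T (Suc n) \<omega>) = T n \<omega>) \<and>
     (\<forall>n. \<forall>a\<in>VG n. \<forall>b\<in>VG n. (\<lambda>m. real (tdist (T m \<omega>) a b) / alpha_bar ^ m) \<longlonglongrightarrow> dstar T \<omega> a b) \<and>
     (\<forall>n. \<forall>a\<in>VG n. \<forall>b\<in>VG n. a \<noteq> b \<longrightarrow> dstar T \<omega> a b > 0) \<and>
     (\<forall>\<epsilon>>0. \<exists>n. \<forall>a b. {a,b} \<in> pth (T n \<omega>) u1 u2 \<longrightarrow> a \<noteq> b \<longrightarrow> dstar T \<omega> a b < \<epsilon>)"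
proof -
  have t1: "AE \<omega> in M. \<forall>n. T n \<omega> \<in> trees n" using AE_tree by (simp add: AE_all_countable)
  have t2: "AE \<omega> in M. \<forall>n. Tr n (T (Suc n) \<omega>) = T n \<omega>" using cons by (intro AE_I2) auto
  have t3: "AE \<omega> in M. \<forall>n. \<forall>a\<in>VG n. \<forall>b\<in>VG n. (\<lambda>m. real (tdist (T m \<omega>) a b) / alpha_bar ^ m) \<longlonglongrightarrow> dstar T \<omega> a b \<and>
    W a b \<omega> \<le> hnorm h1 * dstar T \<omega> a b \<and> dstar T \<omega> a b \<le> 40 * W a b \<omega>"
    using tdist_lim by (simp add: AE_all_countable AE_finite_all)
  have t4: "AE \<omega> in M. \<forall>n. \<forall>a\<in>VG n. \<forall>b\<in>VG n. a \<noteq> b \<longrightarrow> W a b \<omega> > 0"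
  proof -
    have "AE \<omega> in M. a \<noteq> b \<longrightarrow> W a b \<omega> > 0" if "a \<in> VG n" "b \<in> VG n" for a b n
      using W_positive[OF that] by (cases "a = b") auto
    then show ?thesis by (simp add: AE_all_countable AE_finite_all)
  qed
  have t5: "AE \<omega> in M. \<forall>i::nat. \<exists>n. \<omega> \<notin> bad n (1 / real (Suc i))"
    using not_always_bad by (simp add: AE_all_countable)
  show ?thesis
    using t1 t2 t3 t4 t5 AE_space2
  proof eventually_elim
    case (elim \<omega>)
    have pos: "dstar T \<omega> a b > 0" if "a \<in> VG n" "b \<in> VG n" "a \<noteq> b" for n a b
    proof -
      have "0 < hnorm h1 * dstar T \<omega> a b" using elim(3,4) that by (meson order.strict_trans2)
      then show ?thesis using hnorm_nonneg[of h1] by (simp add: zero_less_mult_iff)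
    qed
    have sym: "dstar T \<omega> a b = dstar T \<omega> b a" if "a \<in> VG n" "b \<in> VG n" for n a b
    proof -
      have L1: "(\<lambda>m. real (tdist (T m \<omega>) a b) / alpha_bar ^ m) \<longlonglongrightarrow> dstar T \<omega> a b"
        and L2: "(\<lambda>m. real (tdist (T m \<omega>) b a) / alpha_bar ^ m) \<longlonglongrightarrow> dstar T \<omega> b a"
        using elim(3) that by blast+
      have "real (tdist (T m \<omega>) b a) / alpha_bar ^ m = real (tdist (T m \<omega>) a b) / alpha_bar ^ m" if m: "m \<ge> n" for m
      proof -
        have "stree (VG m) (T m \<omega>)" using elim(1) trees_iff by blast
        moreover have "a \<in> VG m" "b \<in> VG m" using VG_mono[OF m] \<open>a \<in> VG n\<close> \<open>b \<in> VG n\<close> by blast+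
        ultimately show ?thesis using tdist_sym[of "VG m" "T m \<omega>" a b] by simp
      qed
      then have "\<forall>\<^sub>F m in sequentially. real (tdist (T m \<omega>) b a) / alpha_bar ^ m = real (tdist (T m \<omega>) a b) / alpha_bar ^ m"
        unfolding eventually_sequentially by blast
      from Lim_transform_eventually[OF L2 this] show ?thesis using LIMSEQ_unique[OF L1] by blast
    qed
    have gap: "\<exists>n. \<forall>a b. {a,b} \<in> pth (T n \<omega>) u1 u2 \<longrightarrow> a \<noteq> b \<longrightarrow> dstar T \<omega> a b < \<epsilon>" if e: "\<epsilon> > 0" for \<epsilon>
    proof -
      \<comment> \<open>The 40 is the constant in the comparison of \<open>dstar\<close> with
        \<open>W\<close>.\<close>
      obtain i :: nat where i: "40 / \<epsilon> < real i" using reals_Archimedean2 by blast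
      then have i2: "40 * (1 / real (Suc i)) < \<epsilon>" using e by (simp add: field_simps)
      obtain n where n: "\<omega> \<notin> bad n (1 / real (Suc i))" using elim(5) by blast
      note P = pth_u12[OF elim(1)[rule_format, of n]]
      show ?thesis
      proof (intro exI[of _ n] allI impI)
        fix a b assume ab: "{a,b} \<in> pth (T n \<omega>) u1 u2" "a \<noteq> b"
        then have "{a,b} \<in> EG n" using P by blast
        then have V: "a \<in> VG n" "b \<in> VG n" using EG_sub_VG by blast+
        have "W (fst (ends {a,b})) (snd (ends {a,b})) \<omega> < 1 / real (Suc i)"
          using n ab(1) elim(1,6) unfolding bad_def by force
        then have "dstar T \<omega> (fst (ends {a,b})) (snd (ends {a,b})) < \<epsilon>"
          using ends_edge[OF ab(2)] elim(3)[rule_format, of a n b] elim(3)[rule_format, of b n a] V i2 by fastforce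
        then show "dstar T \<omega> a b < \<epsilon>" using ends_edge[OF ab(2)] sym[OF V] by auto
      qed
    qed
    show ?case using elim(1-3) pos gap by blast
  qed
qed

end

section \<open>The limit curve\<close>

subsection \<open>Interpolated walks\<close>

text \<open>Each edge contributes its increment times the clamped time spent on it; in this form
  continuity is visible.\<close>

lemma LI_sum:
  assumes "x \<noteq> []" "t \<ge> 0"
  shows "LI x t = x ! 0 + (\<Sum>k<length x - 1. of_real (max 0 (min 1 (t - real k))) * (x ! Suc k - x ! k))"
proof -
  let ?r = "length x - 1"
  let ?c = "\<lambda>k. of_real (max 0 (min 1 (t - real k))) :: complex"
  let ?f = "\<lambda>k. ?c k * (x ! Suc k - x ! k)"
  show ?thesis
  proof (cases "t \<ge> real ?r")
    case True
    have "(\<Sum>k<?r. ?f k) = (\<Sum>k<?r. x ! Suc k - x ! k)"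
    proof (rule sum.cong[OF refl])
      fix k assume "k \<in> {..<?r}"
      then have "real k + 1 \<le> real ?r" by simp
      then have "t - real k \<ge> 1" using True by linarith
      then show "?f k = x ! Suc k - x ! k" by simp
    qed
    also have "\<dots> = x ! ?r - x ! 0" by (rule sum_lessThan_telescope)
    finally show ?thesis using True assms by (simp add: LI_def last_conv_nth)
  next
    case False
    define j where "j = nat \<lfloor>t\<rfloor>"
    have j: "real j \<le> t" "t < real j + 1" using assms(2) by (auto simp: j_def)
    have jr: "j < ?r" using j(1) False by simp
    have "(\<Sum>k<?r. ?f k) = (\<Sum>k<Suc j. ?f k) + (\<Sum>k\<in>{Suc j..<?r}. ?f k)"
      unfolding lessThan_atLeast0 by (rule sum.atLeastLessThan_concat[symmetric]) (use jr in auto)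
    also have "(\<Sum>k\<in>{Suc j..<?r}. ?f k) = 0"
    proof (rule sum.neutral, rule ballI)
      fix k assume "k \<in> {Suc j..<?r}"
      then have "real j + 1 \<le> real k" by simp
      then show "?f k = 0" using j by simp
    qed
    also have "(\<Sum>k<Suc j. ?f k) = (\<Sum>k<j. ?f k) + ?f j" by simp
    also have "(\<Sum>k<j. ?f k) = (\<Sum>k<j. x ! Suc k - x ! k)"
    proof (rule sum.cong[OF refl])
      fix k assume "k \<in> {..<j}"
      then have "real k + 1 \<le> real j" by simp
      then have "t - real k \<ge> 1" using j by linarith
      then show "?f k = x ! Suc k - x ! k" by simp
    qed
    also have "\<dots> = x ! j - x ! 0" by (rule sum_lessThan_telescope)
    also have "?c j = of_real (t - real j)" using j by simp
    finally show ?thesis using False by (simp add: LI_def j_def[symmetric] Let_def algebra_simps)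
  qed
qed

lemma LI_continuous: assumes "x \<noteq> []" shows "continuous_on {0..} (LI x)"
proof -
  have "continuous_on {0..} (\<lambda>t. x ! 0 + (\<Sum>k<length x - 1. of_real (max 0 (min 1 (t - real k))) * (x ! Suc k - x ! k)))"
    by (intro continuous_intros)
  then show ?thesis using continuous_on_cong[of "{0..}" "{0..}" "LI x"] LI_sum[OF assms] by simp
qed

lemma LI_vertex: "LI (xs @ v # ys) (real (length xs)) = v"
  by (cases ys) (simp_all add: LI_def Let_def)

lemma tree_path_split:
  assumes T: "stree V E" and p: "tree_path E a b = xs @ v # ys" and ab: "a \<in> V" "b \<in> V"
  shows "pth E a v = pe (xs @ [v])" "pth E v b = pe (v # ys)"
proof -
  note tp = tree_path_props[OF streeD(1,2)[OF T] streeD(3)[OF T ab]]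
  have s: "pe (xs @ [v]) \<subseteq> E" "pe (v # ys) \<subseteq> E" using tp(5) unfolding p by (subst (asm) pe_glue, simp)+
  have d: "distinct (xs @ [v])" "distinct (v # ys)" using tp(4) unfolding p by auto
  have "hd (xs @ [v]) = a" using tp(2) unfolding p by (cases xs) auto
  then show "pth E a v = pe (xs @ [v])" using pth_eq[OF streeD(1,2)[OF T] s(1)] bd_pe[OF d(1)] by simp
  have "last (v # ys) = b" using tp(3) unfolding p by simp
  then show "pth E v b = pe (v # ys)" using pth_eq[OF streeD(1,2)[OF T] s(2)] bd_pe[OF d(2)] by simp
qed

text \<open>Go from \<open>x\<close> to \<open>y\<close> through the projections to the path between
  \<open>a\<close> and \<open>b\<close>. Twice the distance to the projection is the excess in the
  triangle inequality for \<open>a\<close>, \<open>x\<close>, \<open>b\<close>, and the absolute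
  value is twice the distance of the projections. Since no projection occurs in the inequality, it
  passes to the limit metric.\<close>

lemma tree_four_point:
  assumes T: "stree V E" and ab: "a \<in> V" "b \<in> V" and xy: "x \<in> V" "y \<in> V"
  shows "2 * real (tdist E x y) \<le> \<bar>(real (tdist E a x) - real (tdist E x b)) - (real (tdist E a y) - real (tdist E y b))\<bar>
    + (real (tdist E a x) + real (tdist E x b) - real (tdist E a b)) + (real (tdist E a y) + real (tdist E y b) - real (tdist E a b))"
proof -
  obtain v xs ys where v: "tree_path E a b = xs @ v # ys" "v \<in> V"
    "tdist E a x = tdist E a v + tdist E v x" "tdist E x b = tdist E x v + tdist E v b"
    "tdist E a b = tdist E a v + tdist E v b" "tdist E a v = length xs"
    using tree_projection[OF T ab xy(1)] .
  obtain w xs' ys' where w: "tree_path E a b = xs' @ w # ys'" "w \<in> V"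
    "tdist E a y = tdist E a w + tdist E w y" "tdist E y b = tdist E y w + tdist E w b"
    "tdist E a b = tdist E a w + tdist E w b" "tdist E a w = length xs'"
    using tree_projection[OF T ab xy(2)] .
  have vw: "real (tdist E v w) = \<bar>real (tdist E a v) - real (tdist E a w)\<bar>"
  proof (cases "length xs \<le> length xs'")
    case True
    then show ?thesis using tdist_on_path[OF T v(1) w(1) ab True] v(6) w(6) by simp
  next
    case False
    then have "length xs' \<le> length xs" by simp
    then show ?thesis using tdist_on_path[OF T w(1) v(1) ab] tdist_sym[OF T v(2) w(2)] v(6) w(6) by simp
  qed
  have "tdist E x y \<le> tdist E x v + tdist E v y" "tdist E v y \<le> tdist E v w + tdist E w y"
    using tdist_triangle[OF T] xy v(2) w(2) by auto
  then have "real (tdist E x y) \<le> real (tdist E x v) + real (tdist E v w) + real (tdist E w y)" by linarith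
  moreover have "tdist E v x = tdist E x v" "tdist E w y = tdist E y w" using tdist_sym[OF T] xy v(2) w(2) by auto
  ultimately show ?thesis unfolding vw using v(3-5) w(3-5) by linarith
qed

lemma scaled_four_point:
  fixes A :: real
  assumes A: "A > 0" and h: "2 * t \<le> \<bar>(a - b) - (c - e)\<bar> + (a + b - f) + (c + e - f)"
  shows "2 * (t / A) \<le> \<bar>(a / A - b / A) - (c / A - e / A)\<bar> + (a / A + b / A - f / A) + (c / A + e / A - f / A)"
proof -
  have "(a / A - b / A) - (c / A - e / A) = ((a - b) - (c - e)) / A" by (simp add: diff_divide_distrib)
  then have 1: "\<bar>(a / A - b / A) - (c / A - e / A)\<bar> = \<bar>(a - b) - (c - e)\<bar> / A" using A by (simp add: abs_divide)
  have "2 * t / A \<le> (\<bar>(a - b) - (c - e)\<bar> + (a + b - f) + (c + e - f)) / A" using h A by (simp add: divide_right_mono)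
  then show ?thesis unfolding 1 by (simp add: add_divide_distrib diff_divide_distrib)
qed

section \<open>Vertices that stay on the path under refinement\<close>

text \<open>Stronger than disjointness of the two edge sets, and chosen because refinement inherits
  it: a refined path has edges only in cells that the coarse path crosses.\<close>

definition celldisj :: "nat \<Rightarrow> complex set set \<Rightarrow> complex \<Rightarrow> complex \<Rightarrow> complex \<Rightarrow> bool" where
  "celldisj n E a v b \<longleftrightarrow> (\<forall>w\<in>words n. piw 0 w (pth E a v) = {} \<or> piw 0 w (pth E v b) = {})"

lemma celldisj_add:
  assumes t: "t \<in> trees n" and V: "a \<in> VG n" "v \<in> VG n" "b \<in> VG n" and c: "celldisj n t a v b"
  shows "tdist t a b = tdist t a v + tdist t v b"
proof -
  have T: "stree (VG n) t" "t \<subseteq> EG n" using t by (auto simp only: trees_iff)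
  note P = pth_props(1)[OF streeD(1,2)[OF T(1)] streeD(3)[OF T(1)]]
  note tp = tree_path_props(7)[OF streeD(1,2)[OF T(1)] streeD(3)[OF T(1)]]
  have sub: "pth t a v \<subseteq> EG n" "pth t v b \<subseteq> EG n" using P V T(2) by blast+
  have dis: "pth t a v \<inter> pth t v b = {}"
  proof (rule ccontr)
    assume "\<not> ?thesis"
    then obtain e where e: "e \<in> pth t a v" "e \<in> pth t v b" by blast
    then have "e \<in> EG (n + 0)" using sub by auto
    then obtain w e0 where w: "w \<in> words n" "e0 \<in> EG 0" "e = psiw w ` e0" unfolding EG_add by blast
    then have "e0 \<in> piw 0 w (pth t a v)" "e0 \<in> piw 0 w (pth t v b)" using e by (auto simp: piw_def)
    then show False using c w(1) unfolding celldisj_def by blast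
  qed
  have fin: "finite (pth t a v)" "finite (pth t v b)" using finite_subset[OF _ finite_EG] sub by blast+
  show ?thesis
    using pth_sd[OF T(1) V] sd_disjoint[OF dis] card_Un_disjoint[OF fin dis] tp V by metis
qed

lemma celldisj_Suc:
  assumes f: "f \<in> trees (n + 1)" and t: "Tr n f \<in> trees n" and V: "a \<in> VG n" "v \<in> VG n" "b \<in> VG n"
    and c: "celldisj n (Tr n f) a v b"
  shows "celldisj (n + 1) f a v b"
  unfolding celldisj_def
proof
  fix y assume "y \<in> words (n + 1)"
  then obtain w z where w: "w \<in> words n" "z \<in> words 1" "y = w @ z" using words_split by blast
  have e: "bpath (piw 1 w f) {} = {}"
    using bpath_eq[OF Q1D(2,3)[OF cell_Q1[OF f w(1)]], of "{}"] by simp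
  have p: "piw 0 z {} = {}" by (simp add: piw_def)
  have "piw 1 w (pth f a v) = {} \<or> piw 1 w (pth f v b) = {}"
    using c w(1) path_refine(1)[OF f t V(1,2) w(1)] path_refine(1)[OF f t V(2,3) w(1)] e
    unfolding celldisj_def by (metis bd_empty)
  moreover have "piw 0 y P = piw 0 z (piw 1 w P)" for P using piw_piw[OF w(2), of 0 w P] w(3) by simp
  ultimately show "piw 0 y (pth f a v) = {} \<or> piw 0 y (pth f v b) = {}" using p by metis
qed

text \<open>Two edges of one cell share a vertex, so on a simple path they are consecutive.\<close>

lemma cell_edges_meet:
  assumes "e0 \<in> EG 0" "e1 \<in> EG 0" shows "psiw w ` e0 \<inter> psiw w ` e1 \<noteq> {}"
proof -
  have "e0 \<inter> e1 \<noteq> {}" using assms by (auto simp: EG0_el0 el0_def)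
  then show ?thesis by blast
qed

lemma not_celldisj:
  assumes T: "stree (VG n) t" "t \<subseteq> EG n" and ab: "a \<in> VG n" "b \<in> VG n" and p: "p = tree_path t a b" and k: "k < length p"
    and c: "\<not> celldisj n t a (p ! k) b"
  shows "0 < k \<and> Suc k < length p \<and> (\<exists>w\<in>words n. \<exists>e0\<in>EG 0. \<exists>e1\<in>EG 0. {p ! (k-1), p ! k} = psiw w ` e0 \<and> {p ! k, p ! Suc k} = psiw w ` e1)"
proof -
  note tp = tree_path_props[OF streeD(1,2)[OF T(1)] streeD(3)[OF T(1) ab]]
  have d: "distinct p" using tp(4) p by simp
  have sp: "tree_path t a b = take k p @ p ! k # drop (Suc k) p" using id_take_nth_drop[OF k] p by simp
  note s = tree_path_split[OF T(1) sp ab]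
  obtain w e0 e1 where w: "w \<in> words n" "e0 \<in> piw 0 w (pth t a (p ! k))" "e1 \<in> piw 0 w (pth t (p ! k) b)"
    using c unfolding celldisj_def by blast
  have e: "e0 \<in> EG 0" "e1 \<in> EG 0" "psiw w ` e0 \<in> pe (take k p @ [p ! k])" "psiw w ` e1 \<in> pe (p ! k # drop (Suc k) p)"
    using w s by (auto simp: piw_def)
  have q: "take k p @ [p ! k] = take (Suc k) p" "p ! k # drop (Suc k) p = drop k p"
    using k by (simp_all add: take_Suc_conv_app_nth Cons_nth_drop_Suc)
  obtain i where i: "Suc i < Suc k" "psiw w ` e0 = {p ! i, p ! Suc i}"
    using e(3) k unfolding q pe_conv by auto
  obtain j where j: "Suc (k + j) < length p" "psiw w ` e1 = {p ! (k + j), p ! Suc (k + j)}"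
  proof -
    from e(4) obtain j where "psiw w ` e1 = {drop k p ! j, drop k p ! Suc j}" "Suc j < length (drop k p)"
      unfolding q pe_conv by blast
    then show ?thesis by (intro that[of j]) (use k in simp_all)
  qed
  have "{p ! i, p ! Suc i} \<inter> {p ! (k + j), p ! Suc (k + j)} \<noteq> {}"
    using cell_edges_meet[OF e(1,2), of w] i(2) j(2) by simp
  then have eqs: "p ! i = p ! (k + j) \<or> p ! i = p ! Suc (k + j) \<or> p ! Suc i = p ! (k + j) \<or> p ! Suc i = p ! Suc (k + j)"
    by blast
  have b: "i < length p" "Suc i < length p" "k + j < length p" "Suc (k + j) < length p" using i(1) j(1) k by simp_all
  from eqs have "i = k + j \<or> i = Suc (k + j) \<or> Suc i = k + j \<or> Suc i = Suc (k + j)"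
    unfolding nth_eq_iff_index_eq[OF d b(1,3)] nth_eq_iff_index_eq[OF d b(1,4)]
      nth_eq_iff_index_eq[OF d b(2,3)] nth_eq_iff_index_eq[OF d b(2,4)] .
  then have ij: "k = Suc i" "j = 0" using i(1) by auto
  have "{p ! (k-1), p ! k} = psiw w ` e0" "{p ! k, p ! Suc k} = psiw w ` e1" "Suc k < length p" "0 < k"
    using i(2) j unfolding ij by simp_all
  then show ?thesis using w(1) e(1,2) by blast
qed

text \<open>If both vertices failed, three consecutive path edges would lie in one cell; the first
  and the third of them have no common vertex, while any two edges of a cell do.\<close>

lemma celldisj_alternate:
  assumes T: "stree (VG n) t" "t \<subseteq> EG n" and ab: "a \<in> VG n" "b \<in> VG n" and p: "p = tree_path t a b" and k: "Suc k < length p"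
  shows "celldisj n t a (p ! k) b \<or> celldisj n t a (p ! Suc k) b"
proof (rule ccontr)
  assume n: "\<not> ?thesis"
  note tp = tree_path_props[OF streeD(1,2)[OF T(1)] streeD(3)[OF T(1) ab]]
  have d: "distinct p" using tp(4) p by simp
  obtain w e0 e1 where 1: "0 < k" "w \<in> words n" "e0 \<in> EG 0" "e1 \<in> EG 0" "{p ! (k-1), p ! k} = psiw w ` e0" "{p ! k, p ! Suc k} = psiw w ` e1"
    using not_celldisj[OF T ab p, of k] n k by auto
  obtain w' e2 e3 where 2: "Suc (Suc k) < length p" "w' \<in> words n" "e2 \<in> EG 0" "e3 \<in> EG 0" "{p ! k, p ! Suc k} = psiw w' ` e2" "{p ! Suc k, p ! Suc (Suc k)} = psiw w' ` e3"
    using not_celldisj[OF T ab p, of "Suc k"] n k by auto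
  have "w = w'" using edge_cell_unique[OF 1(4) 2(3) 1(2) 2(2)] 1(6) 2(5) by simp
  then have "{p ! (k-1), p ! k} \<inter> {p ! Suc k, p ! Suc (Suc k)} \<noteq> {}"
    using cell_edges_meet[OF 1(3) 2(4), of w] 1(5) 2(6) by simp
  then show False using nth_eq_iff_index_eq[OF d] 1(1) 2(1) by auto
qed

section \<open>Limit metric and limit curve of a single sample\<close>

locale good_path =
  fixes T :: "nat \<Rightarrow> 'w \<Rightarrow> complex set set" and \<omega> :: 'w and X :: "real \<Rightarrow> complex"
  assumes tr: "\<And>n. T n \<omega> \<in> trees n"
    and cons: "\<And>n. Tr n (T (Suc n) \<omega>) = T n \<omega>"
    and lim: "\<And>n a b. a \<in> VG n \<Longrightarrow> b \<in> VG n \<Longrightarrow> (\<lambda>m. real (tdist (T m \<omega>) a b) / alpha_bar ^ m) \<longlonglongrightarrow> dstar T \<omega> a b"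
    and pos: "\<And>n a b. a \<in> VG n \<Longrightarrow> b \<in> VG n \<Longrightarrow> a \<noteq> b \<Longrightarrow> dstar T \<omega> a b > 0"
    and gap: "\<And>\<epsilon>. \<epsilon> > 0 \<Longrightarrow> \<exists>n. \<forall>a b. {a,b} \<in> pth (T n \<omega>) u1 u2 \<longrightarrow> a \<noteq> b \<longrightarrow> dstar T \<omega> a b < \<epsilon>"
    and ulim: "uniform_limit {0..} (\<lambda>n. Xn T n \<omega>) X sequentially"
begin

abbreviation d :: "complex \<Rightarrow> complex \<Rightarrow> real" where "d a b \<equiv> dstar T \<omega> a b"
abbreviation D :: real where "D \<equiv> d u1 u2"

lemma st: "stree (VG m) (T m \<omega>)" "T m \<omega> \<subseteq> EG m" using tr trees_iff by auto

lemma a0: "alpha_bar > 0" "alpha_bar ^ m > 0" using alpha_bounds by simp_all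

lemma u12: "u1 \<in> VG n" "u2 \<in> VG n" using u_in_VG[of 1 n] u_in_VG[of 2 n] by (simp_all add: u_simps)
lemma u12s: "u1 \<in> Vstar" "u2 \<in> Vstar" using u12 by (auto simp: Vstar_def)

lemma common:
  assumes "a \<in> Vstar" "b \<in> Vstar" "c \<in> Vstar"
  obtains n where "a \<in> VG n" "b \<in> VG n" "c \<in> VG n"
proof -
  obtain i j k where "a \<in> VG i" "b \<in> VG j" "c \<in> VG k" using assms by (auto simp: Vstar_def)
  then have "a \<in> VG (i+j+k)" "b \<in> VG (i+j+k)" "c \<in> VG (i+j+k)"
    using VG_mono[of i "i+j+k"] VG_mono[of j "i+j+k"] VG_mono[of k "i+j+k"] by auto
  then show ?thesis using that by blast
qed

lemma lim': "a \<in> Vstar \<Longrightarrow> b \<in> Vstar \<Longrightarrow> (\<lambda>m. real (tdist (T m \<omega>) a b) / alpha_bar ^ m) \<longlonglongrightarrow> d a b"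
  using common[of a b b] lim by metis

lemma d_self: assumes "a \<in> Vstar" shows "d a a = 0"
proof -
  obtain n where n: "a \<in> VG n" using assms by (auto simp: Vstar_def)
  have E: "\<forall>\<^sub>F m in sequentially. real (tdist (T m \<omega>) a a) / alpha_bar ^ m = 0"
    unfolding eventually_sequentially
  proof (intro exI allI impI)
    fix m assume "m \<ge> n"
    then have "a \<in> VG m" using n VG_mono by blast
    then show "real (tdist (T m \<omega>) a a) / alpha_bar ^ m = 0" using tdist_self[OF st(1)] by simp
  qed
  show ?thesis by (rule LIMSEQ_unique[OF lim'[OF assms assms] tendsto_eventually[OF E]])
qed

lemma d_sym: assumes "a \<in> Vstar" "b \<in> Vstar" shows "d a b = d b a"
proof -
  obtain n where n: "a \<in> VG n" "b \<in> VG n" using common[of a b b] assms by metis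
  have "\<forall>\<^sub>F m in sequentially. real (tdist (T m \<omega>) a b) / alpha_bar ^ m = real (tdist (T m \<omega>) b a) / alpha_bar ^ m"
    unfolding eventually_sequentially
  proof (intro exI allI impI)
    fix m assume "m \<ge> n"
    then have "a \<in> VG m" "b \<in> VG m" using n VG_mono by blast+
    then show "real (tdist (T m \<omega>) a b) / alpha_bar ^ m = real (tdist (T m \<omega>) b a) / alpha_bar ^ m"
      using tdist_sym[OF st(1)] by simp
  qed
  from Lim_transform_eventually[OF lim'[OF assms] this]
  show ?thesis using LIMSEQ_unique[OF lim'[OF assms(2,1)]] by simp
qed

lemma d_triangle: assumes "a \<in> Vstar" "b \<in> Vstar" "c \<in> Vstar" shows "d a c \<le> d a b + d b c"
proof -
  obtain n where n: "a \<in> VG n" "b \<in> VG n" "c \<in> VG n" using common[OF assms] .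
  show ?thesis
  proof (rule LIMSEQ_le[OF lim'[OF assms(1,3)] tendsto_add[OF lim'[OF assms(1,2)] lim'[OF assms(2,3)]]])
    show "\<exists>N. \<forall>m\<ge>N. real (tdist (T m \<omega>) a c) / alpha_bar ^ m \<le> real (tdist (T m \<omega>) a b) / alpha_bar ^ m + real (tdist (T m \<omega>) b c) / alpha_bar ^ m"
    proof (intro exI allI impI)
      fix m assume "m \<ge> n"
      then have "a \<in> VG m" "b \<in> VG m" "c \<in> VG m" using n VG_mono by blast+
      then have "tdist (T m \<omega>) a c \<le> tdist (T m \<omega>) a b + tdist (T m \<omega>) b c" by (rule tdist_triangle[OF st(1)])
      then have "real (tdist (T m \<omega>) a c) \<le> real (tdist (T m \<omega>) a b) + real (tdist (T m \<omega>) b c)" by linarith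
      then show "real (tdist (T m \<omega>) a c) / alpha_bar ^ m \<le> real (tdist (T m \<omega>) a b) / alpha_bar ^ m + real (tdist (T m \<omega>) b c) / alpha_bar ^ m"
        using a0(2)[of m] by (simp add: add_divide_distrib[symmetric] divide_right_mono)
    qed
  qed
qed

lemma d_diff: assumes "a \<in> Vstar" "b \<in> Vstar" "c \<in> Vstar" shows "\<bar>d a b - d a c\<bar> \<le> d b c"
  using d_triangle[OF assms(1,2,3)] d_triangle[OF assms(1,3,2)] d_sym[OF assms(2,3)] by linarith

text \<open>In the limit of the trees, \<open>exc x\<close> is twice the distance from
  \<open>x\<close> to the path between \<open>u1\<close> and \<open>u2\<close>, and
  \<open>prj x\<close>, a Gromov product, is the distance from \<open>u1\<close> to the projection
  of \<open>x\<close>. The projection itself may change with the level and is not named.\<close>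

definition exc :: "complex \<Rightarrow> real" where "exc x = d u1 x + d x u2 - D"
definition prj :: "complex \<Rightarrow> real" where "prj x = (d u1 x + D - d x u2) / 2"

lemma prj_nonneg: "x \<in> Vstar \<Longrightarrow> prj x \<ge> 0"
  using d_triangle[OF _ u12s(1) u12s(2), of x] d_sym[OF u12s(1), of x] by (simp add: prj_def)

lemma four_point:
  assumes "x \<in> Vstar" "y \<in> Vstar"
  shows "2 * d x y \<le> \<bar>(d u1 x - d x u2) - (d u1 y - d y u2)\<bar> + exc x + exc y"
proof -
  obtain n where n: "x \<in> VG n" "y \<in> VG n" using common[of x y y] assms by metis
  let ?q = "\<lambda>a b m. real (tdist (T m \<omega>) a b) / alpha_bar ^ m"
  have R: "(\<lambda>m. \<bar>(?q u1 x m - ?q x u2 m) - (?q u1 y m - ?q y u2 m)\<bar> + (?q u1 x m + ?q x u2 m - ?q u1 u2 m) + (?q u1 y m + ?q y u2 m - ?q u1 u2 m))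
     \<longlonglongrightarrow> \<bar>(d u1 x - d x u2) - (d u1 y - d y u2)\<bar> + (d u1 x + d x u2 - D) + (d u1 y + d y u2 - D)"
    by (intro tendsto_add tendsto_diff tendsto_rabs lim' u12s assms)
  show ?thesis unfolding exc_def
  proof (rule LIMSEQ_le[OF tendsto_mult_left[OF lim'[OF assms]] R], intro exI allI impI)
    fix m assume "m \<ge> n"
    then have "x \<in> VG m" "y \<in> VG m" using n VG_mono by blast+
    from scaled_four_point[OF a0(2) tree_four_point[OF st(1) u12 this]]
    show "2 * ?q x y m \<le> \<bar>(?q u1 x m - ?q x u2 m) - (?q u1 y m - ?q y u2 m)\<bar> + (?q u1 x m + ?q x u2 m - ?q u1 u2 m) + (?q u1 y m + ?q y u2 m - ?q u1 u2 m)" .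
  qed
qed

lemma X_continuous: "continuous_on {0..} X"
proof (rule uniform_limit_theorem[OF _ ulim])
  show "\<forall>\<^sub>F n in sequentially. continuous_on {0..} (Xn T n \<omega>)"
  proof (rule always_eventually, rule allI)
    fix n
    have ne: "tree_path (T n \<omega>) u1 u2 \<noteq> []"
      by (rule tree_path_props(1)[OF streeD(1,2)[OF st(1)] streeD(3)[OF st(1) u12]])
    have "continuous_on {0..} (LI (tree_path (T n \<omega>) u1 u2) \<circ> (\<lambda>t. alpha_bar ^ n * t))"
      by (rule continuous_on_compose2[OF LI_continuous[OF ne], unfolded o_def[symmetric]])
         (use a0(2)[of n] in \<open>auto intro!: continuous_intros\<close>)
    then show "continuous_on {0..} (Xn T n \<omega>)" by (simp add: Xn_def[abs_def] o_def)
  qed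
qed simp

lemma X_seq:
  assumes "\<And>m. s m \<ge> 0" "s \<longlonglongrightarrow> t" shows "(\<lambda>m. X (s m)) \<longlonglongrightarrow> X t"
proof -
  have "t \<ge> 0" by (rule LIMSEQ_le_const[OF assms(2)]) (use assms(1) in auto)
  then show ?thesis using continuous_on_tendsto_compose[OF X_continuous assms(2)] assms(1) by auto
qed

text \<open>Uniform convergence and continuity of \<open>X\<close> allow the times to vary with the
  level.\<close>

lemma Xn_seq:
  assumes s: "\<And>m. s m \<ge> 0" "s \<longlonglongrightarrow> t" shows "(\<lambda>m. Xn T m \<omega> (s m)) \<longlonglongrightarrow> X t"
proof -
  have "(\<lambda>m. Xn T m \<omega> (s m) - X (s m)) \<longlonglongrightarrow> 0"
  proof (rule tendstoI)
    fix e :: real assume "e > 0"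
    from uniform_limitD[OF ulim this]
    show "\<forall>\<^sub>F m in sequentially. dist (Xn T m \<omega> (s m) - X (s m)) 0 < e"
      by eventually_elim (use s(1) in \<open>auto simp: dist_norm\<close>)
  qed
  from tendsto_add[OF this X_seq[OF s]] show ?thesis by simp
qed

lemma Xn_vertex:
  assumes "tree_path (T m \<omega>) u1 u2 = xs @ v # ys" shows "Xn T m \<omega> (real (length xs) / alpha_bar ^ m) = v"
  using a0(1) LI_vertex[of xs v ys] by (simp add: Xn_def assms)

text \<open>Being on the path is expressed by additivity of distances, which passes to the
  limit.\<close>

definition onpath :: "complex \<Rightarrow> bool" where
  "onpath v \<longleftrightarrow> v \<in> Vstar \<and> (\<exists>n. \<forall>m\<ge>n. v \<in> VG m \<and> tdist (T m \<omega>) u1 u2 = tdist (T m \<omega>) u1 v + tdist (T m \<omega>) v u2)"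

lemma onpath_ends: "onpath u1" "onpath u2"
  unfolding onpath_def using u12 u12s tdist_self[OF st(1)] by auto

lemma onpath_d: assumes "onpath v" shows "d v u2 = D - d u1 v" "exc v = 0"
proof -
  obtain n where n: "\<And>m. m \<ge> n \<Longrightarrow> tdist (T m \<omega>) u1 u2 = tdist (T m \<omega>) u1 v + tdist (T m \<omega>) v u2" and v: "v \<in> Vstar"
    using assms unfolding onpath_def by blast
  have "\<forall>\<^sub>F m in sequentially. real (tdist (T m \<omega>) u1 v) / alpha_bar ^ m + real (tdist (T m \<omega>) v u2) / alpha_bar ^ m = real (tdist (T m \<omega>) u1 u2) / alpha_bar ^ m"
    unfolding eventually_sequentially by (intro exI[of _ n]) (simp add: n add_divide_distrib)
  from Lim_transform_eventually[OF tendsto_add[OF lim'[OF u12s(1) v] lim'[OF v u12s(2)]] this]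
  have "d u1 v + d v u2 = D" using LIMSEQ_unique[OF lim'[OF u12s]] by simp
  then show "d v u2 = D - d u1 v" "exc v = 0" by (simp_all add: exc_def)
qed

lemma onpath_V: "onpath v \<Longrightarrow> v \<in> Vstar" by (simp add: onpath_def)

text \<open>The excess vanishes on persistent vertices, so the four-point inequality reduces to the
  upper bound; the lower one is the triangle inequality.\<close>

lemma onpath_dist: assumes "onpath v" "onpath w" shows "d v w = \<bar>d u1 v - d u1 w\<bar>"
proof (rule antisym)
  show "d v w \<le> \<bar>d u1 v - d u1 w\<bar>"
    using four_point[OF onpath_V onpath_V, OF assms] onpath_d[OF assms(1)] onpath_d[OF assms(2)] by linarith
  show "\<bar>d u1 v - d u1 w\<bar> \<le> d v w" using d_diff[OF u12s(1) onpath_V onpath_V, OF assms] .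
qed

text \<open>For all large levels the approximating curve is exactly at \<open>v\<close> at the
  normalised distance of \<open>v\<close> from \<open>u1\<close>, and these times converge to
  \<open>d u1 v\<close>.\<close>

lemma onpath_X: assumes "onpath v" shows "X (d u1 v) = v"
proof -
  obtain n where n: "\<And>m. m \<ge> n \<Longrightarrow> v \<in> VG m \<and> tdist (T m \<omega>) u1 u2 = tdist (T m \<omega>) u1 v + tdist (T m \<omega>) v u2"
    using assms unfolding onpath_def by blast
  let ?s = "\<lambda>m. real (tdist (T m \<omega>) u1 v) / alpha_bar ^ m"
  have "(\<lambda>m. Xn T m \<omega> (?s m)) \<longlonglongrightarrow> X (d u1 v)"
    by (rule Xn_seq[OF _ lim'[OF u12s(1) onpath_V[OF assms]]]) (use a0 in auto)
  moreover have "\<forall>\<^sub>F m in sequentially. Xn T m \<omega> (?s m) = v"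
    unfolding eventually_sequentially
  proof (intro exI allI impI)
    fix m assume m: "m \<ge> n"
    have vm: "v \<in> VG m" using n[OF m] by blast
    obtain w xs ys where w: "tree_path (T m \<omega>) u1 u2 = xs @ w # ys" "w \<in> VG m"
      "tdist (T m \<omega>) u1 v = tdist (T m \<omega>) u1 w + tdist (T m \<omega>) w v" "tdist (T m \<omega>) v u2 = tdist (T m \<omega>) v w + tdist (T m \<omega>) w u2"
      "tdist (T m \<omega>) u1 u2 = tdist (T m \<omega>) u1 w + tdist (T m \<omega>) w u2" "tdist (T m \<omega>) u1 w = length xs"
      using tree_projection[OF st(1) u12 vm] .
    \<comment> \<open>Zero excess forces \<open>v\<close> to coincide with its projection
      \<open>w\<close>.\<close>
    have "tdist (T m \<omega>) w v = 0" using w(3-5) n[OF m] by linarith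
    moreover have "tdist (T m \<omega>) w v = card (pth (T m \<omega>) w v)"
      by (rule tree_path_props(7)[OF streeD(1,2)[OF st(1)] streeD(3)[OF st(1) w(2) vm]])
    moreover have "pth (T m \<omega>) w v \<subseteq> T m \<omega>"
      by (rule pth_props(1)[OF streeD(1,2)[OF st(1)] streeD(3)[OF st(1) w(2) vm]])
    then have "finite (pth (T m \<omega>) w v)" by (rule edges2_finite[OF streeD(1)[OF st(1)]])
    ultimately have "pth (T m \<omega>) w v = {}" by simp
    then have "w = v" using tdist_pos[OF st(1) w(2) vm] by blast
    then have "tdist (T m \<omega>) u1 v = length xs" "tree_path (T m \<omega>) u1 u2 = xs @ v # ys" using w by auto
    then show "Xn T m \<omega> (?s m) = v" using Xn_vertex by simp
  qed
  then have "(\<lambda>m. Xn T m \<omega> (?s m)) \<longlonglongrightarrow> v" by (rule tendsto_eventually)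
  ultimately show ?thesis by (rule LIMSEQ_unique)
qed

lemma celldisj_onpath:
  assumes v: "v \<in> VG n" and c: "celldisj n (T n \<omega>) u1 v u2" shows "onpath v"
proof -
  have "celldisj (n + k) (T (n + k) \<omega>) u1 v u2" for k
  proof (induction k)
    case (Suc k)
    have vk: "v \<in> VG (n + k)" using v VG_mono[of n "n+k"] by auto
    have "celldisj (n + k + 1) (T (n + k + 1) \<omega>) u1 v u2"
    proof (rule celldisj_Suc[OF tr _ u12(1) vk u12(2)])
      have e: "Tr (n + k) (T (n + k + 1) \<omega>) = T (n + k) \<omega>" using cons[of "n + k"] by simp
      show "Tr (n + k) (T (n + k + 1) \<omega>) \<in> trees (n + k)" unfolding e by (rule tr)
      show "celldisj (n + k) (Tr (n + k) (T (n + k + 1) \<omega>)) u1 v u2" unfolding e by (rule Suc)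
    qed
    then show ?case by simp
  qed (use c in simp)
  then have cd: "celldisj m (T m \<omega>) u1 v u2" if "m \<ge> n" for m using that le_Suc_ex by blast
  have "v \<in> VG m \<and> tdist (T m \<omega>) u1 u2 = tdist (T m \<omega>) u1 v + tdist (T m \<omega>) v u2" if m: "m \<ge> n" for m
    using celldisj_add[OF tr u12(1) _ u12(2) cd[OF m]] v VG_mono[OF m] by blast
  then show ?thesis using v unfolding onpath_def Vstar_def by blast
qed

text \<open>Along the path at a level where all edges are shorter than \<open>\<epsilon>\<close>,
  the distance from \<open>u1\<close> passes \<open>s\<close> across some edge, and at least one end
  of this edge persists by \<open>celldisj_alternate\<close>.\<close>

lemma onpath_dense:
  assumes s: "0 \<le> s" "s \<le> D" and e: "\<epsilon> > 0" shows "\<exists>v. onpath v \<and> \<bar>d u1 v - s\<bar> < \<epsilon>"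
proof (cases "s = D")
  case True then show ?thesis using onpath_ends(2) e by (intro exI[of _ u2]) simp
next
  case False
  then have sD: "s < D" using s by simp
  obtain n where g: "\<And>a b. {a,b} \<in> pth (T n \<omega>) u1 u2 \<Longrightarrow> a \<noteq> b \<Longrightarrow> d a b < \<epsilon>" using gap[OF e] by blast
  define p where "p = tree_path (T n \<omega>) u1 u2"
  note tp = tree_path_props[OF streeD(1,2)[OF st(1)] streeD(3)[OF st(1) u12], of n, folded p_def]
  have pV: "p ! i \<in> VG n" if i: "i < length p" for i
  proof -
    have "take i p @ p ! i # drop (Suc i) p = tree_path (T n \<omega>) u1 u2" using id_take_nth_drop[OF i] p_def by simp
    then show ?thesis by (rule tdist_split(3)[OF st(1) _ u12])
  qed
  have s0: "\<not> s < d u1 (p ! 0)" using d_self[OF u12s(1)] tp(1,2) s(1) by (simp add: hd_conv_nth)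
  have s1: "s < d u1 (p ! (length p - 1))" using tp(1,3) sD by (simp add: last_conv_nth)
  obtain k where k: "k < length p - 1" "\<forall>i\<le>k. \<not> s < d u1 (p ! i)" "s < d u1 (p ! (k + 1))"
    using ex_least_nat_less[of "\<lambda>i. s < d u1 (p ! i)" "length p - 1", OF s1 s0] by auto
  have kk: "Suc k < length p" using k(1) by simp
  have V: "p ! k \<in> VG n" "p ! Suc k \<in> VG n" using pV kk by auto
  have Vs: "p ! k \<in> Vstar" "p ! Suc k \<in> Vstar" using V by (auto simp: Vstar_def)
  have "p ! k \<noteq> p ! Suc k" using nth_eq_iff_index_eq[OF tp(4)] kk by simp
  moreover have "{p ! k, p ! Suc k} \<in> pe p" unfolding pe_conv using kk by blast
  then have "{p ! k, p ! Suc k} \<in> pth (T n \<omega>) u1 u2" unfolding tp(6) .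
  ultimately have "d (p ! k) (p ! Suc k) < \<epsilon>" using g by blast
  then have "\<bar>d u1 (p ! k) - d u1 (p ! Suc k)\<bar> < \<epsilon>" using d_diff[OF u12s(1) Vs] by linarith
  then have "\<bar>d u1 (p ! k) - s\<bar> < \<epsilon>" "\<bar>d u1 (p ! Suc k) - s\<bar> < \<epsilon>"
    using k(2)[rule_format, of k] k(3) by auto
  moreover have "onpath (p ! k) \<or> onpath (p ! Suc k)"
    using celldisj_alternate[OF st u12 p_def kk] celldisj_onpath V by blast
  ultimately show ?thesis by blast
qed

lemma D_pos: "D > 0"
proof -
  have "u1 \<noteq> u2" by (simp add: u1_def u2_def)
  then show ?thesis using pos[OF u12] by blast
qed

text \<open>After time \<open>D\<close> the approximating curves have stopped at \<open>u2\<close>.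
  Between any earlier time and \<open>D\<close> the curve visits, by density, a persistent vertex
  other than \<open>u2\<close>.\<close>

lemma hit_D: "hit X = ereal D"
proof -
  have after: "X s = u2" if s: "s \<ge> D" for s
  proof (cases "s = D")
    case True then show ?thesis using onpath_X[OF onpath_ends(2)] by simp
  next
    case False
    then have "D < s" using s by simp
    then have "\<forall>\<^sub>F m in sequentially. real (tdist (T m \<omega>) u1 u2) / alpha_bar ^ m < s"
      using order_tendstoD(2)[OF lim'[OF u12s]] by blast
    then have "\<forall>\<^sub>F m in sequentially. Xn T m \<omega> s = u2"
    proof eventually_elim
      case (elim m)
      have "real (tdist (T m \<omega>) u1 u2) \<le> alpha_bar ^ m * s"
        using elim a0(2)[of m] by (simp add: divide_less_eq mult.commute)
      moreover have "last (tree_path (T m \<omega>) u1 u2) = u2"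
        by (rule tree_path_props(3)[OF streeD(1,2)[OF st(1)] streeD(3)[OF st(1) u12]])
      ultimately show ?case by (simp add: Xn_def LI_def tdist_def)
    qed
    then have "(\<lambda>m. Xn T m \<omega> s) \<longlonglongrightarrow> u2" by (rule tendsto_eventually)
    moreover have "(\<lambda>m. Xn T m \<omega> s) \<longlonglongrightarrow> X s" by (rule Xn_seq) (use \<open>D < s\<close> D_pos in auto)
    ultimately show ?thesis by (rule LIMSEQ_unique[symmetric])
  qed
  show ?thesis unfolding hit_def
  proof (rule antisym)
    show "Inf {ereal t | t. t \<ge> 0 \<and> (\<forall>s\<ge>t. X s = u2)} \<le> ereal D"
      by (rule Inf_lower) (use after D_pos in auto)
    show "ereal D \<le> Inf {ereal t | t. t \<ge> 0 \<and> (\<forall>s\<ge>t. X s = u2)}"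
    proof (rule Inf_greatest)
      fix z assume "z \<in> {ereal t | t. t \<ge> 0 \<and> (\<forall>s\<ge>t. X s = u2)}"
      then obtain t where t: "z = ereal t" "t \<ge> 0" "\<And>s. s \<ge> t \<Longrightarrow> X s = u2" by blast
      have "D \<le> t"
      proof (rule ccontr)
        assume "\<not> D \<le> t"
        then obtain v where v: "onpath v" "\<bar>d u1 v - (t + D) / 2\<bar> < (D - t) / 2"
          using onpath_dense[of "(t + D) / 2" "(D - t) / 2"] t(2) D_pos by auto
        have lt: "t < d u1 v" "d u1 v < D" using v(2) by (auto simp: abs_less_iff field_simps)
        have "v = u2" using onpath_X[OF v(1)] t(3)[of "d u1 v"] lt by simp
        then show False using lt by simp
      qed
      then show "ereal D \<le> z" using t by simp
    qed
  qed
qed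

subsection \<open>The Cauchy completion\<close>

lemma dcauchy_V: "dcauchy T \<omega> x \<Longrightarrow> x n \<in> Vstar" by (simp add: dcauchy_def)

lemma cls_self: "dcauchy T \<omega> x \<Longrightarrow> x \<in> cls T \<omega> x"
  using d_self[OF dcauchy_V] by (simp add: cls_def)

lemma cls_some:
  assumes "dcauchy T \<omega> x" defines "y \<equiv> SOME y. y \<in> cls T \<omega> x"
  shows "dcauchy T \<omega> y" "(\<lambda>n. d (x n) (y n)) \<longlonglongrightarrow> 0"
proof -
  have "y \<in> cls T \<omega> x" unfolding y_def by (rule someI[of "\<lambda>y. y \<in> cls T \<omega> x", OF cls_self[OF assms(1)]])
  then show "dcauchy T \<omega> y" "(\<lambda>n. d (x n) (y n)) \<longlonglongrightarrow> 0" by (auto simp: cls_def)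
qed

text \<open>The representatives chosen by \<open>SOME\<close> are at vanishing distance from the
  given ones, hence do not affect the limit.\<close>

lemma dcheck_lim:
  assumes x: "dcauchy T \<omega> x" and y: "dcauchy T \<omega> y" and L: "(\<lambda>n. d (x n) (y n)) \<longlonglongrightarrow> L"
  shows "dcheck T \<omega> (cls T \<omega> x) (cls T \<omega> y) = L"
proof -
  define x' where "x' = (SOME z. z \<in> cls T \<omega> x)"
  define y' where "y' = (SOME z. z \<in> cls T \<omega> y)"
  note cx = cls_some[OF x, folded x'_def] and cy = cls_some[OF y, folded y'_def]
  have "(\<lambda>n. d (x' n) (y' n) - d (x n) (y n)) \<longlonglongrightarrow> 0"
  proof (rule Lim_null_comparison)
    show "(\<lambda>n. d (x n) (x' n) + d (y n) (y' n)) \<longlonglongrightarrow> 0"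
      using tendsto_add[OF cx(2) cy(2)] by simp
    have "\<bar>d (x' n) (y' n) - d (x n) (y n)\<bar> \<le> d (x n) (x' n) + d (y n) (y' n)" for n
    proof -
      note V = dcauchy_V[OF x, of n] dcauchy_V[OF y, of n] dcauchy_V[OF cx(1), of n] dcauchy_V[OF cy(1), of n]
      show ?thesis
        using d_diff[OF V(3,4,2)] d_diff[OF V(2,3,1)] d_sym[OF V(3,2)] d_sym[OF V(2,1)] d_sym[OF V(3,1)] d_sym[OF V(4,2)]
        by linarith
    qed
    then show "\<forall>\<^sub>F n in sequentially. norm (d (x' n) (y' n) - d (x n) (y n)) \<le> d (x n) (x' n) + d (y n) (y' n)"
      by simp
  qed
  from tendsto_add[OF this L] have "(\<lambda>n. d (x' n) (y' n)) \<longlonglongrightarrow> L" by simp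
  then show ?thesis unfolding dcheck_def x'_def y'_def by (rule limI)
qed

lemma dcauchy_const: "a \<in> Vstar \<Longrightarrow> dcauchy T \<omega> (\<lambda>_. a)"
  using d_self by (auto simp: dcauchy_def)

text \<open>The point at time \<open>s\<close> is the class of persistent vertices whose distance
  from \<open>u1\<close> tends to \<open>s\<close>; isometry is \<open>onpath_dist\<close> in the
  limit.\<close>

lemma geodesic_exists: "\<exists>\<gamma>. isometric_geodesic T \<omega> \<gamma>"
proof -
  \<comment> \<open>At the two ends the sequences are constant, so that their classes are literally
    those demanded of a geodesic.\<close>
  define y where "y = (\<lambda>s n. if s = 0 then u1 else if s = D then u2 else SOME v. onpath v \<and> \<bar>d u1 v - s\<bar> < 1 / real (Suc n))"
  have y: "onpath (y s n) \<and> \<bar>d u1 (y s n) - s\<bar> < 1 / real (Suc n)" if s: "s \<in> {0..D}" for s n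
  proof -
    consider "s = 0" | "s \<noteq> 0" "s = D" | "s \<noteq> 0" "s \<noteq> D" by blast
    then show ?thesis
    proof cases
      case 1 then show ?thesis using onpath_ends(1) d_self[OF u12s(1)] by (simp add: y_def)
    next
      case 2 then show ?thesis using onpath_ends(2) by (simp add: y_def)
    next
      case 3
      have "\<exists>v. onpath v \<and> \<bar>d u1 v - s\<bar> < 1 / real (Suc n)" using onpath_dense[of s] s by simp
      then have "onpath (SOME v. onpath v \<and> \<bar>d u1 v - s\<bar> < 1 / real (Suc n)) \<and>
         \<bar>d u1 (SOME v. onpath v \<and> \<bar>d u1 v - s\<bar> < 1 / real (Suc n)) - s\<bar> < 1 / real (Suc n)" by (rule someI_ex)
      then show ?thesis using 3 by (simp add: y_def)
    qed
  qed
  have yl: "(\<lambda>n. d u1 (y s n)) \<longlonglongrightarrow> s" if s: "s \<in> {0..D}" for s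
  proof -
    have "(\<lambda>n. d u1 (y s n) - s) \<longlonglongrightarrow> 0"
      by (rule Lim_null_comparison[OF _ LIMSEQ_inverse_real_of_nat])
         (use y[OF s] in \<open>auto intro!: always_eventually less_imp_le simp: inverse_eq_divide\<close>)
    then show ?thesis by (simp add: LIM_zero_iff)
  qed
  have yc: "dcauchy T \<omega> (y s)" if s: "s \<in> {0..D}" for s
    unfolding dcauchy_def
  proof (intro conjI allI impI)
    show "y s n \<in> Vstar" for n using y[OF s] onpath_V by blast
    fix e :: real assume "e > 0"
    have "Cauchy (\<lambda>n. d u1 (y s n))" using yl[OF s] by (rule LIMSEQ_imp_Cauchy)
    from CauchyD[OF this \<open>e > 0\<close>] show "\<exists>N. \<forall>m\<ge>N. \<forall>n\<ge>N. d (y s m) (y s n) < e"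
      using onpath_dist y[OF s] by simp
  qed
  have "isometric_geodesic T \<omega> (\<lambda>s. cls T \<omega> (y s))"
    unfolding isometric_geodesic_def Let_def
  proof (intro conjI ballI)
    show "cls T \<omega> (y s) \<in> Vcheck T \<omega>" if "s \<in> {0..D}" for s using yc[OF that] by (simp add: Vcheck_def)
    show "dcheck T \<omega> (cls T \<omega> (y s)) (cls T \<omega> (y t)) = \<bar>s - t\<bar>" if s: "s \<in> {0..D}" and t: "t \<in> {0..D}" for s t
    proof (rule dcheck_lim[OF yc[OF s] yc[OF t]])
      have "(\<lambda>n. \<bar>d u1 (y s n) - d u1 (y t n)\<bar>) \<longlonglongrightarrow> \<bar>s - t\<bar>" by (intro tendsto_intros yl s t)
      then show "(\<lambda>n. d (y s n) (y t n)) \<longlonglongrightarrow> \<bar>s - t\<bar>" using onpath_dist y[OF s] y[OF t] by simp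
    qed
    show "cls T \<omega> (y 0) = cls T \<omega> (\<lambda>_. u1)" by (simp add: y_def)
    show "cls T \<omega> (y D) = cls T \<omega> (\<lambda>_. u2)" using D_pos by (simp add: y_def)
  qed
  then show ?thesis by blast
qed

text \<open>A point close to the path in \<open>d\<close> is close to its projection in the plane: otherwise the connecting
  path would pass through two vertices of \<open>VG k\<close>.\<close>

lemma near_X:
  assumes x: "x \<in> Vstar" and c: "exc x / 2 < c" "\<And>a b. a \<in> VG k \<Longrightarrow> b \<in> VG k \<Longrightarrow> a \<noteq> b \<Longrightarrow> c < d a b"
  shows "norm (x - X (prj x)) \<le> 4 / 2 ^ k"
proof -
  obtain n where n: "x \<in> VG n" using x by (auto simp: Vstar_def)
  let ?q = "\<lambda>a b m. real (tdist (T m \<omega>) a b) / alpha_bar ^ m"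
  \<comment> \<open>The time at which the curve of level \<open>m\<close> visits the projection of
    \<open>x\<close>. The maximum with 0 guarantees a nonnegative time also at levels where
    \<open>x\<close> is not yet a vertex.\<close>
  define s where "s = (\<lambda>m. max 0 ((?q u1 x m + ?q u1 u2 m - ?q x u2 m) / 2))"
  have "s \<longlonglongrightarrow> max 0 ((d u1 x + D - d x u2) / 2)"
    unfolding s_def by (intro tendsto_max tendsto_const tendsto_divide tendsto_add tendsto_diff lim' u12s x) simp
  then have "s \<longlonglongrightarrow> prj x" using prj_nonneg[OF x] by (simp add: prj_def max_def)
  then have L: "(\<lambda>m. Xn T m \<omega> (s m)) \<longlonglongrightarrow> X (prj x)" by (intro Xn_seq) (simp_all add: s_def)
  have "(\<lambda>m. (?q u1 x m + ?q x u2 m - ?q u1 u2 m) / 2) \<longlonglongrightarrow> exc x / 2"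
    unfolding exc_def by (intro tendsto_divide tendsto_const tendsto_add tendsto_diff lim' u12s x) simp
  then have e1: "\<forall>\<^sub>F m in sequentially. (?q u1 x m + ?q x u2 m - ?q u1 u2 m) / 2 < c"
    using c(1) by (rule order_tendstoD(2))
  have e2: "\<forall>\<^sub>F m in sequentially. \<forall>a\<in>VG k. \<forall>b\<in>VG k. a \<noteq> b \<longrightarrow> c < ?q a b m"
  proof (intro eventually_ball_finite finite_VG ballI)
    fix a b assume ab: "a \<in> VG k" "b \<in> VG k"
    show "\<forall>\<^sub>F m in sequentially. a \<noteq> b \<longrightarrow> c < ?q a b m"
    proof (cases "a = b")
      case False
      have "\<forall>\<^sub>F m in sequentially. c < ?q a b m" using order_tendstoD(1)[OF lim[OF ab] c(2)[OF ab False]] .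
      then show ?thesis by eventually_elim simp
    qed simp
  qed
  have e3: "\<forall>\<^sub>F m in sequentially. m \<ge> max n k" by (rule eventually_ge_at_top)
  have "\<forall>\<^sub>F m in sequentially. norm (x - Xn T m \<omega> (s m)) \<le> 4 / 2 ^ k"
    using e1 e2 e3
  proof eventually_elim
    case (elim m)
    have xm: "x \<in> VG m" using n VG_mono[of n m] elim(3) by auto
    obtain v xs ys where v: "tree_path (T m \<omega>) u1 u2 = xs @ v # ys" "v \<in> VG m"
      "tdist (T m \<omega>) u1 x = tdist (T m \<omega>) u1 v + tdist (T m \<omega>) v x" "tdist (T m \<omega>) x u2 = tdist (T m \<omega>) x v + tdist (T m \<omega>) v u2"
      "tdist (T m \<omega>) u1 u2 = tdist (T m \<omega>) u1 v + tdist (T m \<omega>) v u2" "tdist (T m \<omega>) u1 v = length xs"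
      using tree_projection[OF st(1) u12 xm] .
    have sy: "tdist (T m \<omega>) v x = tdist (T m \<omega>) x v" by (rule tdist_sym[OF st(1) v(2) xm])
    have "real (tdist (T m \<omega>) u1 x) + real (tdist (T m \<omega>) u1 u2) - real (tdist (T m \<omega>) x u2) = 2 * real (length xs)"
      using v(3-6) sy by linarith
    then have "(?q u1 x m + ?q u1 u2 m - ?q x u2 m) / 2 = real (length xs) / alpha_bar ^ m"
      by (simp add: add_divide_distrib[symmetric] diff_divide_distrib[symmetric])
    then have "s m = real (length xs) / alpha_bar ^ m" using a0(2)[of m] by (simp add: s_def)
    then have X: "Xn T m \<omega> (s m) = v" using Xn_vertex[OF v(1)] by simp
    have "real (tdist (T m \<omega>) u1 x) + real (tdist (T m \<omega>) x u2) - real (tdist (T m \<omega>) u1 u2) = 2 * real (tdist (T m \<omega>) x v)"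
      using v(3-6) sy by linarith
    then have "(?q u1 x m + ?q x u2 m - ?q u1 u2 m) / 2 = ?q x v m"
      by (simp add: add_divide_distrib[symmetric] diff_divide_distrib[symmetric])
    then have lt: "?q x v m < c" using elim(1) by simp
    show ?case unfolding X
    proof (rule ccontr)
      assume "\<not> norm (x - v) \<le> 4 / 2 ^ k"
      then obtain a b where ab: "a \<in> VG k" "b \<in> VG k" "a \<noteq> b" "tdist (T m \<omega>) a b \<le> tdist (T m \<omega>) x v"
        using far_points_cross[OF tr _ xm v(2), of k] elim(3) by auto
      then have "?q a b m \<le> ?q x v m" using a0(2)[of m] by (simp add: divide_right_mono)
      moreover have "c < ?q a b m" using elim(2) ab by blast
      ultimately show False using lt by simp
    qed
  qed
  then show ?thesis
    by (intro tendsto_upperbound[OF tendsto_norm[OF tendsto_diff[OF tendsto_const L]]]) auto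
qed

text \<open>The isometry fixes the distances of \<open>\<gamma> t\<close> from both ends, so along a
  representing sequence the excess tends to 0 and the projection time to \<open>t\<close>;
  \<open>near_X\<close> compares the sequence with the curve at these times.\<close>

lemma geodesic_X:
  assumes g: "isometric_geodesic T \<omega> \<gamma>" and t: "t \<in> {0..D}" shows "X t = xi (\<gamma> t)"
proof -
  have G: "\<And>s. s \<in> {0..D} \<Longrightarrow> \<gamma> s \<in> Vcheck T \<omega>" "\<And>s r. s \<in> {0..D} \<Longrightarrow> r \<in> {0..D} \<Longrightarrow> dcheck T \<omega> (\<gamma> s) (\<gamma> r) = \<bar>s - r\<bar>"
    "\<gamma> 0 = cls T \<omega> (\<lambda>_. u1)" "\<gamma> D = cls T \<omega> (\<lambda>_. u2)"
    using g unfolding isometric_geodesic_def Let_def by blast+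
  have DD: "0 \<in> {0..D}" "D \<in> {0..D}" using D_pos by auto
  obtain x where x: "dcauchy T \<omega> x" "\<gamma> t = cls T \<omega> x" using G(1)[OF t] by (auto simp: Vcheck_def)
  \<comment> \<open>\<open>xi\<close> takes the limit of the representative chosen by
    \<open>SOME\<close>, so this sequence is the one to follow.\<close>
  define y where "y = (SOME y. y \<in> cls T \<omega> x)"
  note cy = cls_some[OF x(1), folded y_def]
  have yV: "y n \<in> Vstar" and xV: "x n \<in> Vstar" for n using dcauchy_V cy(1) x(1) by auto
  have conv: "convergent (\<lambda>n. d a (x n))" if a: "a \<in> Vstar" for a
  proof (rule Cauchy_convergent, rule CauchyI)
    fix e :: real assume "e > 0"
    then obtain N where N: "\<And>m n. m \<ge> N \<Longrightarrow> n \<ge> N \<Longrightarrow> d (x m) (x n) < e" using x(1) unfolding dcauchy_def by blast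
    have "norm (d a (x m) - d a (x n)) < e" if "m \<ge> N" "n \<ge> N" for m n
      using d_diff[OF a xV xV, of m n] N[OF that] by simp
    then show "\<exists>N. \<forall>m\<ge>N. \<forall>n\<ge>N. norm (d a (x m) - d a (x n)) < e" by blast
  qed
  have dl: "(\<lambda>n. d a (x n)) \<longlonglongrightarrow> dcheck T \<omega> (cls T \<omega> (\<lambda>_. a)) (cls T \<omega> x)" if a: "a \<in> Vstar" for a
  proof -
    obtain L where L: "(\<lambda>n. d a (x n)) \<longlonglongrightarrow> L" using conv[OF a] by (auto simp: convergent_def)
    then have "dcheck T \<omega> (cls T \<omega> (\<lambda>_. a)) (cls T \<omega> x) = L" by (rule dcheck_lim[OF dcauchy_const[OF a] x(1)])
    then show ?thesis using L by simp
  qed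
  have toy: "(\<lambda>n. d a (y n)) \<longlonglongrightarrow> L" if a: "a \<in> Vstar" and L: "(\<lambda>n. d a (x n)) \<longlonglongrightarrow> L" for a L
  proof -
    have "(\<lambda>n. d a (y n) - d a (x n)) \<longlonglongrightarrow> 0"
    proof (rule Lim_null_comparison[OF _ cy(2)], rule always_eventually, rule allI)
      show "norm (d a (y n) - d a (x n)) \<le> d (x n) (y n)" for n
        using d_diff[OF a xV yV, of n n] by (simp add: abs_minus_commute)
    qed
    from tendsto_add[OF this L] show ?thesis by simp
  qed
  have y1: "(\<lambda>n. d u1 (y n)) \<longlonglongrightarrow> t"
    using toy[OF u12s(1) dl[OF u12s(1)]] G(2)[OF DD(1) t] G(3) x(2) t by simp
  have y2: "(\<lambda>n. d (y n) u2) \<longlonglongrightarrow> D - t"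
    using toy[OF u12s(2) dl[OF u12s(2)]] G(2)[OF DD(2) t] G(4) x(2) t d_sym[OF yV u12s(2)] by simp
  have E: "(\<lambda>n. exc (y n) / 2) \<longlonglongrightarrow> 0"
  proof -
    have "(\<lambda>n. exc (y n) / 2) \<longlonglongrightarrow> (t + (D - t) - D) / 2" unfolding exc_def by (intro tendsto_intros y1 y2) simp
    then show ?thesis by simp
  qed
  have "(\<lambda>n. prj (y n)) \<longlonglongrightarrow> (t + D - (D - t)) / 2" unfolding prj_def by (intro tendsto_intros y1 y2) simp
  then have "(\<lambda>n. prj (y n)) \<longlonglongrightarrow> t" by simp
  then have XP: "(\<lambda>n. X (prj (y n))) \<longlonglongrightarrow> X t" by (intro X_seq prj_nonneg yV)
  have "(\<lambda>n. y n - X (prj (y n))) \<longlonglongrightarrow> 0"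
  proof (rule tendstoI)
    fix e :: real assume e: "e > 0"
    have "(\<lambda>k. 4 * (1/2) ^ k :: real) \<longlonglongrightarrow> 4 * 0"
      by (rule tendsto_mult_left, rule LIMSEQ_realpow_zero) simp_all
    then have "\<forall>\<^sub>F k in sequentially. 4 * (1/2) ^ k < e" using e by (intro order_tendstoD(2)) auto
    then obtain k where k: "4 * (1/2) ^ k < e" by (auto simp: eventually_sequentially)
    \<comment> \<open>The element 1 makes the set visibly nonempty for \<open>Min\<close>.\<close>
    let ?S = "insert 1 ((\<lambda>(a,b). d a b) ` {(a,b)\<in>VG k \<times> VG k. a \<noteq> b})"
    define c where "c = Min ?S / 2"
    have "finite {(a,b)\<in>VG k \<times> VG k. a \<noteq> b}" by (rule finite_subset[of _ "VG k \<times> VG k"]) auto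
    then have fin: "finite ?S" by (intro finite.insertI finite_imageI)
    have "Min ?S \<in> ?S" by (rule Min_in[OF fin]) simp
    then have "Min ?S > 0" using pos by auto
    then have c: "c > 0" "c < Min ?S" by (auto simp: c_def)
    have cd: "c < d a b" if "a \<in> VG k" "b \<in> VG k" "a \<noteq> b" for a b
    proof -
      have "d a b \<in> ?S" using that by (intro insertI2 image_eqI[of _ _ "(a,b)"]) auto
      then have "Min ?S \<le> d a b" using Min_le[OF fin] by blast
      then show ?thesis using c by simp
    qed
    have "\<forall>\<^sub>F n in sequentially. exc (y n) / 2 < c" using order_tendstoD(2)[OF E c(1)] .
    then show "\<forall>\<^sub>F n in sequentially. dist (y n - X (prj (y n))) 0 < e"
    proof eventually_elim
      case (elim n)
      have "norm (y n - X (prj (y n))) \<le> 4 / 2 ^ k" by (rule near_X[OF yV elim cd])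
      then show ?case using k by (simp add: power_one_over)
    qed
  qed
  from tendsto_add[OF this XP] have "y \<longlonglongrightarrow> X t" by simp
  then show ?thesis unfolding xi_def x(2) y_def[symmetric] by (simp add: limI)
qed

end

theorem mainTheorem17:
  fixes M :: "'w measure"
    and T :: "nat \<Rightarrow> 'w \<Rightarrow> complex set set"
    and X :: "'w \<Rightarrow> real \<Rightarrow> complex"
  assumes "prob_space M"
    and "\<forall>n. T n \<in> measurable M (count_space UNIV)"
    and "\<forall>n. \<forall>t\<in>trees n. measure M {\<omega> \<in> space M. T n \<omega> = t} = 1 / real (card (trees n))"
    and "\<forall>n. \<forall>\<omega>\<in>space M. Tr n (T (Suc n) \<omega>) = T n \<omega>"
    and "AE \<omega> in M. uniform_limit {0..} (\<lambda>n. Xn T n \<omega>) (X \<omega>) sequentially"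
  shows "AE \<omega> in M.
           hit (X \<omega>) = ereal (dstar T \<omega> u1 u2) \<and>
           (\<exists>\<gamma>. isometric_geodesic T \<omega> \<gamma>) \<and>
           (\<forall>\<gamma>. isometric_geodesic T \<omega> \<gamma> \<longrightarrow>
              (\<forall>t\<in>{0..dstar T \<omega> u1 u2}. X \<omega> t = xi (\<gamma> t)))"
proof -
  interpret ust M T
    using assms(1-4) by (auto simp: ust_def ust_axioms_def)
  show ?thesis using good assms(5)
  proof eventually_elim
    case (elim \<omega>)
    interpret good_path T \<omega> "X \<omega>"
      using elim by unfold_locales blast+
    show ?case using hit_D geodesic_exists geodesic_X by blast
  qed
qed

end
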